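(* Let $d\ge2$ and $0<\varepsilon<1$. Let $a\in L^\infty_{d+1+\varepsilon}(\mathbb{R}^d)$ be a divergence-free vector field, and $u\in\mathcal{C}_w([0,T);L^\infty_{d+1})$ the corresponding mild solution of the Navier--Stokes system (NS). For some $t>0$ (with $t<T$), assume that there exist an index $j\in\{1,\dots,d\}$ and a subset $\Sigma\subset\mathbb{S}^{d-1}$ of positive measure such that $$\forall\,\sigma\in\Sigma,\qquad\lim_{\substack{|x|\to+\infty\\ x\in\mathbb{R}\sigma}}|x|^{d+1}u_j(x,t)=0. \qquad(\ast)$$ Then there exists a constant $C>0$ such that $$|u_k(x,t)|\le C\,(1+|x|)^{-(d+1+\varepsilon)}$$ for all $x\in\mathbb{R}^d$ and all $k=1,\dots,d$. Moreover, if $(\ast)$ holds for all $t$ in a finite time interval $[T_0,T_1]$, then $C$ may be chosen uniformly with respect to $t\in[T_0,T_1]$.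
   Context: (NS) is the system on $\mathbb{R}^d$: $\partial_t u-\Delta u+(u\cdot\nabla)u=-\nabla p$, $\operatorname{div}u=0$, $u(x,0)=a(x)$, understood in the mild sense $u(t)=e^{t\Delta}a-\int_0^te^{(t-s)\Delta}\mathbb{P}\operatorname{div}(u\otimes u)(s)\,ds$ with $\mathbb{P}f=f-\nabla\Delta^{-1}(\operatorname{div}f)$. For $\vartheta\ge0$, $L^\infty_\vartheta$ is the space of measurable functions (or vector fields) $f$ on $\mathbb{R}^d$ with $\|f\|_{L^\infty_\vartheta}=\operatorname{ess\,sup}_x(1+|x|)^\vartheta|f(x)|<\infty$. $\mathcal{C}_w([0,T);L^\infty_\vartheta)$ is the space of $u(x,t)$ with $u(t)\in L^\infty_\vartheta$ for all $t\in[0,T)$, continuous in $t>0$ for the $L^\infty_\vartheta$ norm, with $u(t)\to u(0)$ in the distributional sense as $t\to0$; its elements are understood to be bounded in $L^\infty_\vartheta$ on each $[0,T']$, $T'<T$. Such a mild solution is unique and smooth for $t>0$. In the last sentence $0<T_0\le T_1<T$. *)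

theory Defs
  imports "HOL-Probability.Probability"
begin

section \<open>Weighted spaces and distributional notions\<close>

definition weighted_norm :: "real \<Rightarrow> (real^'n \<Rightarrow> real^'n) \<Rightarrow> ennreal" where
  "weighted_norm \<theta> f = esssup lebesgue (\<lambda>x. ennreal ((1 + norm x) powr \<theta> * norm (f x)))"

definition weighted_Linfty :: "real \<Rightarrow> (real^'n \<Rightarrow> real^'n) set" where
  "weighted_Linfty \<theta> = {f \<in> borel_measurable lebesgue. weighted_norm \<theta> f < \<infinity>}"

definition partial_deriv :: "'n \<Rightarrow> (real^'n \<Rightarrow> real) \<Rightarrow> real^'n \<Rightarrow> real" where
  "partial_deriv i f x = frechet_derivative f (at x) (axis i 1)"

(* Smoothness: every iterated partial derivative exists and is differentiable everywhere. *)
definition test_function :: "(real^'n \<Rightarrow> real) \<Rightarrow> bool" where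
  "test_function \<phi> \<longleftrightarrow>
     (\<forall>is x. foldr partial_deriv is \<phi> differentiable (at x)) \<and>
     compact (closure {x. \<phi> x \<noteq> 0})"

definition divergence_free :: "(real^'n \<Rightarrow> real^'n) \<Rightarrow> bool" where
  "divergence_free a \<longleftrightarrow>
     (\<forall>\<phi>. test_function \<phi> \<longrightarrow> (LINT x|lebesgue. (\<Sum>i\<in>UNIV. a x $ i * partial_deriv i \<phi> x)) = 0)"

(* Time comes first: u t x is the value at time t and point x.  The right endpoint T may be infinite. *)
definition Cw :: "ereal \<Rightarrow> real \<Rightarrow> (real \<Rightarrow> real^'n \<Rightarrow> real^'n) set" where
  "Cw T \<theta> = {u.
     (\<forall>t. 0 \<le> t \<and> ereal t < T \<longrightarrow> u t \<in> weighted_Linfty \<theta>) \<and>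
     (\<forall>t. 0 < t \<and> ereal t < T \<longrightarrow>
        ((\<lambda>s. weighted_norm \<theta> (\<lambda>x. u s x - u t x)) \<longlongrightarrow> 0) (at t)) \<and>
     (\<forall>\<phi>. test_function \<phi> \<longrightarrow>
        ((\<lambda>t. LINT x|lebesgue. \<phi> x *\<^sub>R u t x) \<longlongrightarrow> (LINT x|lebesgue. \<phi> x *\<^sub>R u 0 x)) (at_right 0)) \<and>
     (\<forall>T'. 0 \<le> T' \<and> ereal T' < T \<longrightarrow>
        (\<exists>M::real. \<forall>t\<in>{0..T'}. weighted_norm \<theta> (u t) \<le> ennreal M))}"

section \<open>Fourier multipliers and mild solutions\<close>

definition fourier :: "(real^'n \<Rightarrow> real) \<Rightarrow> real^'n \<Rightarrow> complex" where
  "fourier f \<xi> = (LINT x|lebesgue. complex_of_real (f x) * cis (- (x \<bullet> \<xi>)))"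

definition inverse_fourier :: "(real^'n \<Rightarrow> complex) \<Rightarrow> real^'n \<Rightarrow> complex" where
  "inverse_fourier g x = (LINT \<xi>|lebesgue. g \<xi> * cis (x \<bullet> \<xi>)) / (2 * pi) ^ CARD('n)"

definition deriv_symbol :: "'n \<Rightarrow> real^'n \<Rightarrow> complex" where
  "deriv_symbol k \<xi> = \<i> * complex_of_real (\<xi> $ k)"

definition inv_laplace_symbol :: "real^'n \<Rightarrow> complex" where
  "inv_laplace_symbol \<xi> = - 1 / complex_of_real ((norm \<xi>)\<^sup>2)"

definition heat_symbol :: "real \<Rightarrow> real^'n \<Rightarrow> complex" where
  "heat_symbol t \<xi> = complex_of_real (exp (- t * (norm \<xi>)\<^sup>2))"

(* The projector P f = f - grad (inverse Laplacian (div f)), acting on the Fourier side. *)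
definition leray_hat :: "('n \<Rightarrow> real^'n \<Rightarrow> complex) \<Rightarrow> 'n \<Rightarrow> real^'n \<Rightarrow> complex" where
  "leray_hat v j \<xi> =
     v j \<xi> - deriv_symbol j \<xi> * inv_laplace_symbol \<xi> * (\<Sum>k\<in>UNIV. deriv_symbol k \<xi> * v k \<xi>)"

definition div_hat :: "(real^'n \<Rightarrow> real^'n^'n) \<Rightarrow> 'n \<Rightarrow> real^'n \<Rightarrow> complex" where
  "div_hat F k \<xi> = (\<Sum>h\<in>UNIV. deriv_symbol h \<xi> * fourier (\<lambda>x. F x $ h $ k) \<xi>)"

(* The symbols are Hermitian and a, F are real, so Re only changes the type. *)
definition heat :: "real \<Rightarrow> (real^'n \<Rightarrow> real^'n) \<Rightarrow> real^'n \<Rightarrow> real^'n" where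
  "heat t a x =
     (\<chi> j. Re (inverse_fourier (\<lambda>\<xi>. heat_symbol t \<xi> * fourier (\<lambda>y. a y $ j) \<xi>) x))"

definition heat_leray_div :: "real \<Rightarrow> (real^'n \<Rightarrow> real^'n^'n) \<Rightarrow> real^'n \<Rightarrow> real^'n" where
  "heat_leray_div t F x =
     (\<chi> j. Re (inverse_fourier (\<lambda>\<xi>. heat_symbol t \<xi> * leray_hat (div_hat F) j \<xi>) x))"

definition tensor :: "real^'n \<Rightarrow> real^'n \<Rightarrow> real^'n^'n" where
  "tensor v w = (\<chi> h k. v $ h * w $ k)"

(* Meant for a and u s in a weighted space with exponent > d, hence integrable, with u in Cw: then
   all integrals converge absolutely for t > 0 and the right-hand side is continuous in x.  Asking
   for equality at every x selects the continuous representative of u t, so that its values along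
   rays are meaningful. *)
definition mild_solution ::
  "ereal \<Rightarrow> (real^'n \<Rightarrow> real^'n) \<Rightarrow> (real \<Rightarrow> real^'n \<Rightarrow> real^'n) \<Rightarrow> bool" where
  "mild_solution T a u \<longleftrightarrow>
     (AE x in lebesgue. u 0 x = a x) \<and>
     (\<forall>t x. 0 < t \<and> ereal t < T \<longrightarrow>
        u t x = heat t a x
          - (LINT s:{0<..<t}|lebesgue. heat_leray_div (t - s) (\<lambda>y. tensor (u s y) (u s y)) x))"

section \<open>Decay along the directions of a set of positive measure\<close>

(* Surface measure on the unit sphere in polar coordinates: sigma(S) = d * |{r s. 0 < r <= 1, s in S}|.
   It is 0 on nonmeasurable sets, so positive measure includes measurability. *)
definition sphere_measure :: "(real^'n) set \<Rightarrow> ennreal" where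
  "sphere_measure S =
     of_nat CARD('n) * emeasure lebesgue {r *\<^sub>R \<sigma> | r \<sigma>. 0 < r \<and> r \<le> 1 \<and> \<sigma> \<in> S}"

(* The limit is along the whole line spanned by sigma, i.e. in both directions. *)
definition decays_along :: "(real^'n \<Rightarrow> real^'n) \<Rightarrow> 'n \<Rightarrow> (real^'n) set \<Rightarrow> bool" where
  "decays_along v j S \<longleftrightarrow>
     (\<forall>\<sigma>\<in>S. ((\<lambda>x. norm x ^ (CARD('n) + 1) * v x $ j) \<longlongrightarrow> 0)
               (inf at_infinity (principal (range (\<lambda>r. r *\<^sub>R \<sigma>)))))"

definition decay_condition :: "(real^'n \<Rightarrow> real^'n) \<Rightarrow> bool" where
  "decay_condition v \<longleftrightarrow>
     (\<exists>j. \<exists>S \<subseteq> sphere 0 1. sphere_measure S > 0 \<and> decays_along v j S)"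

end

theory Submission
  imports Defs "HOL-Computational_Algebra.Polynomial"
begin

text \<open>On the Fourier side \<open>exp (- t |\<xi>|^2) / |\<xi>|^2\<close> is the integral of \<open>exp (- s |\<xi>|^2)\<close> over \<open>s > t\<close>.
  Hence the kernel of \<open>exp (t \<Delta>) P div\<close> is explicit: a first derivative of the heat kernel at time \<open>t\<close>
  plus the integral over \<open>s > t\<close> of third derivatives of the heat kernel at time \<open>s\<close>. Extending that integral
  to all \<open>s > 0\<close> gives a profile homogeneous of degree \<open>- (d + 1)\<close>, and the difference is
  \<open>O (sqrt t |x| ^ - (d + 2))\<close>. Inserted into the mild formulation this yields
  \<open>u(x, t) = exp (t \<Delta>) a(x) - profile(x) : K(t) + O (|x| ^ - (d + 2))\<close>, where \<open>K(t)\<close> is the integral of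
  \<open>u \<otimes> u\<close> over space and over the times up to \<open>t\<close>. The decay assumption makes one component of
  \<open>profile : K\<close>, a cubic form over a power of \<open>|x|\<close>, vanish on a cone of positive measure, hence everywhere;
  this forces \<open>K\<close> to be a multiple of the identity, and then all components of \<open>profile : K\<close> vanish.\<close>

subsection \<open>Moments of the Gaussian on the line\<close>

text \<open>The symbol of the projected divergence is not smooth at the origin, and this caps the
  decay of its kernel at order d + 1, however fast the convolved function decays. Since u \<otimes>
  u decays with the power 2 (d + 1), it acts on the kernel like a point mass, up to one further
  power of |x|; as \<epsilon> < 1, this error is within the target, and the heat flow keeps the
  decay of \<open>a\<close>. Two obstacles shape the estimates. The kernel at time t - s has L1 norm
  of order \<open>1 / sqrt (t - s)\<close>, so the bounds in time carry this integrable singularity.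
  And \<open>Cw\<close> does not state joint measurability in time and space, so continuity in time
  is proved, on the Fourier side, before the Duhamel integral is split. The decay hypothesis is only
  qualitative, but it annihilates the cubic form exactly; all constants come from the asymptotics,
  which are uniform for times in (0, T1], and this yields the uniform claim as well.\<close>

lemma power_exp_neg_square_bounded:
  fixes c :: real
  assumes "0 < c"
  shows "\<exists>C>0. \<forall>v\<ge>0. v ^ m * exp (- c * v\<^sup>2) \<le> C"
proof -
  let ?C = "1 + fact m / c ^ m"
  have "v ^ m * exp (- c * v\<^sup>2) \<le> ?C" if "v \<ge> 0" for v :: real
  proof -
    \<comment> \<open>The power m is traded for 2m because
      \<open>(c * v\<^sup>2) ^ m / fact m\<close> is a single term of the exponential series, hence
      at most the whole sum.\<close>
    have "v ^ m \<le> 1 + (v\<^sup>2) ^ m"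
    proof (cases "v \<le> 1")
      case True
      then have "v ^ m \<le> 1" using that by (simp add: power_le_one)
      then show ?thesis using that by (simp add: add_increasing2)
    next
      case False
      then have "v ^ m \<le> v ^ (2 * m)" by (intro power_increasing) auto
      then show ?thesis by (simp add: power_mult)
    qed
    moreover have "(v\<^sup>2) ^ m \<le> fact m / c ^ m * exp (c * v\<^sup>2)"
    proof -
      have "(c * v\<^sup>2) ^ m / fact m \<le> exp (c * v\<^sup>2)"
      proof -
        have "(\<lambda>k. (c * v\<^sup>2) ^ k / fact k) sums exp (c * v\<^sup>2)"
          using exp_converges[of "c * v\<^sup>2"] by (simp add: field_simps)
        then show ?thesis
          using assms sum_le_suminf[of "\<lambda>k. (c * v\<^sup>2) ^ k / fact k" "{m}"] by (auto simp: sums_iff)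
      qed
      then show ?thesis using assms by (simp add: field_simps power_mult_distrib)
    qed
    moreover have "1 \<le> exp (c * v\<^sup>2)" using assms by simp
    ultimately have "v ^ m \<le> ?C * exp (c * v\<^sup>2)" unfolding distrib_right by linarith
    then show ?thesis by (simp add: exp_minus field_simps)
  qed
  moreover have "?C > 0" using assms by (simp add: add_pos_pos)
  ultimately show ?thesis by blast
qed

lemma integrable_exp_neg_square:
  fixes s :: real assumes "0 < s"
  shows "integrable lborel (\<lambda>x::real. exp (- s * x\<^sup>2))"
proof -
  have "integrable lborel (\<lambda>x::real. sqrt (pi / s) * normal_density 0 (sqrt (1 / (2 * s))) x)"
    using assms by (intro integrable_mult_right integrable_normal_density) auto
  also have "(\<lambda>x::real. sqrt (pi / s) * normal_density 0 (sqrt (1 / (2 * s))) x) = (\<lambda>x. exp (- s * x\<^sup>2))"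
    using assms by (auto simp: normal_density_def real_sqrt_divide real_sqrt_mult field_simps fun_eq_iff)
  finally show ?thesis .
qed

text \<open>Half of the exponent absorbs the power; the other half remains integrable.\<close>

lemma integrable_power_exp_neg_square:
  fixes s :: real assumes "0 < s"
  shows "integrable lborel (\<lambda>x::real. \<bar>x\<bar> ^ m * exp (- s * x\<^sup>2))"
proof -
  obtain C where C: "C > 0" "\<And>v. v \<ge> 0 \<Longrightarrow> v ^ m * exp (- (s/2) * v\<^sup>2) \<le> C"
    using power_exp_neg_square_bounded[of "s/2" m] assms by auto
  have "\<bar>x\<bar> ^ m * exp (- s * x\<^sup>2) \<le> C * exp (- (s/2) * x\<^sup>2)" for x :: real
  proof -
    have "exp (- s * x\<^sup>2) = exp (- (s/2) * \<bar>x\<bar>\<^sup>2) * exp (- (s/2) * x\<^sup>2)"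
      by (simp flip: exp_add)
    then show ?thesis
      using mult_right_mono[OF C(2)[of "\<bar>x\<bar>"], of "exp (- (s/2) * x\<^sup>2)"] by (simp add: mult_ac)
  qed
  then show ?thesis
    by (intro Bochner_Integration.integrable_bound[OF integrable_mult_right[OF integrable_exp_neg_square[of "s/2"], of C]])
       (use assms C(1) in \<open>auto intro!: order_trans[OF _ abs_ge_self]\<close>)
qed

text \<open>Each factor \<open>\<i> * of_real x\<close> is one derivative in \<open>z\<close> under
  the integral sign, so these moments are the derivatives of the Fourier integral of a
  Gaussian.\<close>

definition moment_fun :: "real \<Rightarrow> real \<Rightarrow> nat \<Rightarrow> real \<Rightarrow> complex" where
  "moment_fun s z m x = (\<i> * of_real x) ^ m * of_real (exp (- s * x\<^sup>2)) * cis (z * x)"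

lemma moment_fun_eq:
  "moment_fun s z m x = (\<i> * of_real x) ^ m * exp (\<i> * (of_real z * of_real x) - of_real s * (of_real x)\<^sup>2)"
  by (simp add: moment_fun_def cis_conv_exp exp_diff exp_minus exp_of_real[symmetric] divide_inverse mult_ac)

lemma borel_measurable_cis [measurable]: "cis \<in> borel_measurable borel"
  by (intro borel_measurable_continuous_onI continuous_intros)

lemma borel_measurable_moment_fun [measurable]: "moment_fun s z m \<in> borel_measurable borel"
  unfolding moment_fun_def by measurable

lemma integrable_moment_fun:
  assumes "0 < s" shows "integrable lborel (moment_fun s z m)"
  using integrable_power_exp_neg_square[OF assms, of m]
  by (rule Bochner_Integration.integrable_bound) (auto simp: moment_fun_def norm_mult norm_power)

lemma integral_moment_fun_0:
  assumes "0 < s"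
  shows "(LINT x|lborel. moment_fun s z 0 x) = of_real (sqrt (pi / s) * exp (- z\<^sup>2 / (4 * s)))"
proof -
  \<comment> \<open>The dilation that turns the exponent of the standard normal density into
    \<open>s * x\<^sup>2\<close>; its characteristic function then gives the integral.\<close>
  define c where "c = sqrt (2 * s)"
  have c: "c > 0" "c\<^sup>2 = 2 * s" using assms by (auto simp: c_def)
  have "complex_of_real (exp (- ((z/c)\<^sup>2) / 2)) = char std_normal_distribution (z / c)"
    by (simp add: char_std_normal_distribution)
  also have "\<dots> = (LINT x|lborel. std_normal_density x *\<^sub>R iexp (z / c * x))"
    unfolding char_def by (subst integral_density) auto
  also have "\<dots> = c *\<^sub>R (LINT x|lborel. std_normal_density (0 + c * x) *\<^sub>R iexp (z / c * (0 + c * x)))"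
    using c(1) by (subst lborel_integral_real_affine[of c _ 0]) auto
  also have "(\<lambda>x. std_normal_density (0 + c * x) *\<^sub>R iexp (z / c * (0 + c * x)))
      = (\<lambda>x. (1 / sqrt (2 * pi)) *\<^sub>R moment_fun s z 0 x)"
    using c by (auto simp: fun_eq_iff std_normal_density_def moment_fun_def power_mult_distrib cis_conv_exp scaleR_conv_of_real)
  finally have "complex_of_real (exp (- ((z/c)\<^sup>2) / 2)) = (c / sqrt (2 * pi)) *\<^sub>R (LINT x|lborel. moment_fun s z 0 x)"
    by simp
  then have "(sqrt (2 * pi) / c) *\<^sub>R complex_of_real (exp (- ((z/c)\<^sup>2) / 2)) = (LINT x|lborel. moment_fun s z 0 x)"
    using c by simp
  moreover have "sqrt (2 * pi) / c = sqrt (pi / s)" "(z/c)\<^sup>2 / 2 = z\<^sup>2 / (4 * s)"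
    using assms c by (auto simp: c_def real_sqrt_mult real_sqrt_divide power_divide)
  ultimately show ?thesis by (simp add: scaleR_conv_of_real)
qed

lemma moment_fun_tendsto_0:
  assumes "0 < s"
  shows "(moment_fun s z m \<longlongrightarrow> 0) at_top" "(moment_fun s z m \<longlongrightarrow> 0) at_bot"
proof -
  obtain C where C: "C > 0" "\<And>v. v \<ge> 0 \<Longrightarrow> v ^ Suc m * exp (- s * v\<^sup>2) \<le> C"
    using power_exp_neg_square_bounded[of s "Suc m"] assms by auto
  have le: "norm (moment_fun s z m x) \<le> \<bar>C * inverse x\<bar>" if "x \<noteq> 0" for x
    using C(1) C(2)[of "\<bar>x\<bar>"] that
    by (simp add: moment_fun_def norm_mult norm_power abs_mult field_simps)
  have "((\<lambda>x::real. \<bar>C * inverse x\<bar>) \<longlongrightarrow> 0) at_infinity"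
    by (intro tendsto_rabs_zero tendsto_mult_right_zero tendsto_inverse_0)
  then have "(moment_fun s z m \<longlongrightarrow> 0) at_infinity"
    by (rule Lim_null_comparison[rotated])
       (auto intro!: exI[of _ 1] le simp: eventually_at_infinity)
  then show "(moment_fun s z m \<longlongrightarrow> 0) at_top" "(moment_fun s z m \<longlongrightarrow> 0) at_bot"
    by (auto intro: tendsto_mono[OF at_top_le_at_infinity] tendsto_mono[OF at_bot_le_at_infinity])
qed

lemma isCont_moment_fun: "isCont (moment_fun s z m) x"
proof -
  have "continuous_on UNIV (moment_fun s z m)"
    unfolding moment_fun_eq[abs_def] by (intro continuous_intros)
  then show ?thesis by (simp add: continuous_on_eq_continuous_at)
qed

text \<open>The derivative of \<open>moment_fun s z m\<close> integrates to zero because the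
  function vanishes at both ends; the three terms of this derivative give the recursion. At
  \<open>m = 0\<close> the truncated \<open>m - 1\<close> is harmless because of the factor
  \<open>of_nat m\<close>.\<close>

lemma integral_moment_fun_rec:
  assumes "0 < s"
  shows "(LINT x|lborel. moment_fun s z (Suc m) x)
    = - (z * (LINT x|lborel. moment_fun s z m x) + of_nat m * (LINT x|lborel. moment_fun s z (m - 1) x)) / (2 * s)"
proof -
  let ?f = "\<lambda>x. \<i> * (of_nat m * moment_fun s z (m - 1) x + 2 * s * moment_fun s z (Suc m) x + z * moment_fun s z m x)"
  have deriv: "(moment_fun s z m has_vector_derivative ?f x) (at x)" for x
  proof -
    have "((\<lambda>x::complex. (\<i> * x) ^ m * exp (\<i> * (z * x) - s * x\<^sup>2)) has_field_derivative ?f x) (at (of_real x))"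
    proof -
      let ?y = "complex_of_real x"
      have P: "((\<lambda>x::complex. (\<i> * x) ^ m) has_field_derivative of_nat m * (\<i> * (\<i> * ?y) ^ (m - Suc 0))) (at ?y)"
        by (rule DERIV_power[OF DERIV_cmult_Id])
      have "((\<lambda>x::complex. \<i> * (z * x) - s * x\<^sup>2) has_field_derivative (\<i> * z - 2 * s * ?y)) (at ?y)"
        by (auto intro!: derivative_eq_intros)
      note E = DERIV_fun_exp[OF this]
      have alg: "n * (\<i> * p1) * e + e * (\<i> * z - 2 * s * y) * p
          = \<i> * (n * (p1 * e) + 2 * s * (\<i> * y * p * e) + z * (p * e))" for e p p1 s z n y :: complex
        by (simp add: algebra_simps)
      show ?thesis
        by (rule DERIV_cong[OF DERIV_mult[OF P E]]) (simp only: moment_fun_eq power_Suc alg One_nat_def of_real_mult of_real_numeral)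
    qed
    from has_vector_derivative_real_field[OF this]
    show ?thesis by (simp add: moment_fun_eq[abs_def])
  qed
  have int: "integrable lborel ?f"
    by (intro integrable_mult_right Bochner_Integration.integrable_add integrable_moment_fun assms)
  have cont: "isCont ?f x" for x
    by (intro continuous_mult continuous_add continuous_const isCont_moment_fun)
  have "(LBINT x=-\<infinity>..\<infinity>. ?f x) = 0 - 0"
    using moment_fun_tendsto_0[OF assms, of z m]
    by (intro interval_integral_FTC_integrable[where F="moment_fun s z m"] deriv cont)
       (use int in \<open>auto simp: ereal_tendsto_simps set_integrable_def simp del: of_real_mult\<close>)
  then have "(LINT x|lborel. ?f x) = 0"
    by (simp add: interval_integral_to_infinity_eq interval_lebesgue_integral_def set_lebesgue_integral_def)
  also have "(LINT x|lborel. ?f x) = \<i> * (of_nat m * (LINT x|lborel. moment_fun s z (m - 1) x)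
       + 2 * s * (LINT x|lborel. moment_fun s z (Suc m) x) + z * (LINT x|lborel. moment_fun s z m x))"
    using assms by (simp add: integrable_moment_fun)
  finally have "of_nat m * (LINT x|lborel. moment_fun s z (m - 1) x)
       + 2 * s * (LINT x|lborel. moment_fun s z (Suc m) x) + z * (LINT x|lborel. moment_fun s z m x) = 0"
    by (subst (asm) mult_eq_0_iff) simp
  then have "(LINT x|lborel. moment_fun s z (Suc m) x) * (2 * s)
      = - (z * (LINT x|lborel. moment_fun s z m x) + of_nat m * (LINT x|lborel. moment_fun s z (m - 1) x))"
    by (simp add: eq_neg_iff_add_eq_0 algebra_simps)
  then show ?thesis using assms nonzero_eq_divide_eq[of "2 * complex_of_real s"] by simp
qed
text \<open>The ratio of the \<open>m\<close>-th to the zeroth moment; the last branch is \<open>m = 3\<close>, larger \<open>m\<close> do not occur.\<close>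

definition herm :: "real \<Rightarrow> real \<Rightarrow> nat \<Rightarrow> real" where
  "herm s z m = (if m = 0 then 1 else if m = 1 then - z / (2 * s)
     else if m = 2 then z\<^sup>2 / (4 * s\<^sup>2) - 1 / (2 * s)
     else 3 * z / (4 * s\<^sup>2) - z ^ 3 / (8 * s ^ 3))"

lemma herm_rec:
  assumes "0 < s"
  shows "herm s z 2 = - (z * herm s z 1 + herm s z 0) / (2 * s)"
    and "herm s z 3 = - (z * herm s z 2 + 2 * herm s z 1) / (2 * s)"
proof -
  show "herm s z 2 = - (z * herm s z 1 + herm s z 0) / (2 * s)"
    using assms by (simp add: herm_def field_simps power2_eq_square)
  have "- (z * (z\<^sup>2 / (4 * s\<^sup>2) - 1 / (2 * s)) + 2 * (- z / (2 * s))) / (2 * s)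
      = 3 * z / (4 * s\<^sup>2) - z ^ 3 / (8 * s ^ 3)"
    using assms by (simp add: divide_simps) algebra
  then show "herm s z 3 = - (z * herm s z 2 + 2 * herm s z 1) / (2 * s)"
    by (simp add: herm_def)
qed

lemma integral_moment_fun:
  assumes "0 < s" "m \<le> 3"
  shows "(LINT x|lborel. moment_fun s z m x) = of_real (sqrt (pi / s) * exp (- z\<^sup>2 / (4 * s)) * herm s z m)"
proof -
  define g where "g = sqrt (pi / s) * exp (- z\<^sup>2 / (4 * s))"
  let ?I = "\<lambda>m. LINT x|lborel. moment_fun s z m x"
  have I0: "?I 0 = of_real (g * herm s z 0)"
    using integral_moment_fun_0[OF assms(1)] by (simp add: herm_def g_def)
  have "?I 1 = of_real (- (z * (g * herm s z 0)) / (2 * s))"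
    using integral_moment_fun_rec[OF assms(1), of z 0] I0 by simp
  also have "- (z * (g * herm s z 0)) / (2 * s) = g * herm s z 1" by (simp add: herm_def)
  finally have I1: "?I 1 = of_real (g * herm s z 1)" .
  have "?I 2 = of_real (- (z * (g * herm s z 1) + g * herm s z 0) / (2 * s))"
    using integral_moment_fun_rec[OF assms(1), of z 1] I0 I1 by (simp add: numeral_2_eq_2)
  also have "- (z * (g * herm s z 1) + g * herm s z 0) / (2 * s) = g * herm s z 2"
    unfolding herm_rec(1)[OF assms(1)] by (simp add: algebra_simps)
  finally have I2: "?I 2 = of_real (g * herm s z 2)" .
  have "?I 3 = of_real (- (z * (g * herm s z 2) + 2 * (g * herm s z 1)) / (2 * s))"
    using integral_moment_fun_rec[OF assms(1), of z 2] I1 I2 by simp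
  also have "- (z * (g * herm s z 2) + 2 * (g * herm s z 1)) / (2 * s) = g * herm s z 3"
    unfolding herm_rec(2)[OF assms(1)] by (simp add: algebra_simps)
  finally have I3: "?I 3 = of_real (g * herm s z 3)" .
  have "m = 0 \<or> m = 1 \<or> m = 2 \<or> m = 3" using assms by auto
  then show ?thesis using I0 I1 I2 I3 unfolding g_def[symmetric] by auto
qed

subsection \<open>Derivatives of the heat kernel\<close>

text \<open>\<open>lborel\<close> on \<open>real^'n\<close> is the image of a product measure
  indexed by \<open>Basis\<close>, that is, by the vectors \<open>axis i 1\<close>; after
  reindexing, Fubini for finite products applies.\<close>

lemma integral_prod_vec:
  fixes f :: "'n::finite \<Rightarrow> real \<Rightarrow> 'a::{real_normed_field,banach,second_countable_topology}"
  assumes int: "\<And>i. integrable lborel (f i)"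
  shows "integrable lborel (\<lambda>x::real^'n. \<Prod>i\<in>UNIV. f i (x $ i))" (is ?int)
    and "(LINT x|lborel. (\<Prod>i\<in>UNIV. f i ((x::real^'n) $ i))) = (\<Prod>i\<in>UNIV. LINT t|lborel. f i t)" (is ?eq)
proof -
  interpret product_sigma_finite "\<lambda>_::real^'n. lborel :: real measure" ..
  define e where "e = (\<lambda>i::'n. axis i (1::real))"
  have inj: "inj e" by (auto simp: e_def inj_on_def axis_eq_axis)
  have B: "Basis = range e" by (auto simp: e_def Basis_vec_def)
  define F where "F = (\<lambda>b. f (inv e b))"
  have intF: "integrable lborel (F b)" for b by (simp add: F_def int)
  have [measurable]: "f i \<in> borel_measurable borel" "F b \<in> borel_measurable borel" for i b
    using int[of i] intF[of b] by auto
  have reindex: "(\<Prod>i\<in>UNIV. f i (x $ i)) = (\<Prod>b\<in>Basis. F b (x \<bullet> b))" for x :: "real^'n"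
    unfolding B by (subst prod.reindex[OF inj]) (simp add: F_def inv_f_f[OF inj], simp add: e_def inner_axis)
  have reindex': "(\<Prod>i\<in>UNIV. LINT t|lborel. f i t) = (\<Prod>b\<in>Basis. LINT t|lborel. F b t)"
    unfolding B by (subst prod.reindex[OF inj]) (simp add: F_def inv_f_f[OF inj])
  have "integrable (\<Pi>\<^sub>M b\<in>Basis. lborel) (\<lambda>x. \<Prod>b\<in>(Basis::(real^'n) set). F b (x b))"
    by (intro product_integrable_prod intF) auto
  moreover have "(LINT x|(\<Pi>\<^sub>M b\<in>Basis. lborel). (\<Prod>b\<in>(Basis::(real^'n) set). F b (x b))) = (\<Prod>b\<in>Basis. LINT t|lborel. F b t)"
    by (intro product_integral_prod intF) auto
  ultimately show ?int ?eq
    unfolding reindex reindex'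
    by (simp_all add: lborel_eq[where 'a="real^'n"] integrable_distr_eq integral_distr inner_sum_left_Basis cong: prod.cong)
qed

definition gauss :: "real \<Rightarrow> real^'n \<Rightarrow> real" where
  "gauss s z = exp (- (norm z)\<^sup>2 / (4 * s)) / sqrt (4 * pi * s) ^ CARD('n)"

lemma norm_vec_square: "(norm z)\<^sup>2 = (\<Sum>i\<in>UNIV. (z $ i)\<^sup>2)" for z :: "real^'n"
  unfolding norm_eq_sqrt_inner by (simp add: inner_vec_def power2_eq_square sum_nonneg)

lemma prod_gauss:
  fixes z :: "real^'n"
  assumes "0 < s"
  shows "(\<Prod>i\<in>UNIV. sqrt (pi / s) * exp (- (z $ i)\<^sup>2 / (4 * s))) = (2 * pi) ^ CARD('n) * gauss s z"
proof -
  have "(\<Prod>i\<in>UNIV. sqrt (pi / s) * exp (- (z $ i)\<^sup>2 / (4 * s)))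
      = sqrt (pi / s) ^ CARD('n) * exp (\<Sum>i\<in>UNIV. - (z $ i)\<^sup>2 / (4 * s))"
    by (simp add: prod.distrib exp_sum)
  also have "(\<Sum>i\<in>UNIV. - (z $ i)\<^sup>2 / (4 * s)) = - (norm z)\<^sup>2 / (4 * s)"
    unfolding norm_vec_square sum_negf[symmetric] sum_divide_distrib ..
  also have "sqrt (pi / s) ^ CARD('n) = (2 * pi / sqrt (4 * pi * s)) ^ CARD('n)"
    using assms by (intro arg_cong[where f="\<lambda>t. t ^ CARD('n)"]) (simp add: real_sqrt_mult real_sqrt_divide field_simps)
  finally show ?thesis by (simp only: gauss_def power_divide) simp
qed

text \<open>Passes from a multi-index, given by the multiplicities \<open>count_list js\<close>, to
  the list of differentiation directions.\<close>

lemma prod_power_count_list: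
  fixes f :: "'n::finite \<Rightarrow> 'a::comm_monoid_mult"
  shows "(\<Prod>i\<in>UNIV. f i ^ count_list js i) = prod_list (map f js)"
proof (induction js)
  case (Cons j js)
  have "(\<Prod>i\<in>UNIV. f i ^ count_list (j # js) i) = (\<Prod>i\<in>UNIV. (if i = j then f i else 1) * f i ^ count_list js i)"
    by (intro prod.cong) auto
  also have "\<dots> = f j * (\<Prod>i\<in>UNIV. f i ^ count_list js i)"
    by (simp add: prod.distrib prod.delta)
  finally show ?case using Cons by simp
qed simp

lemma prod_moment_fun:
  fixes z \<xi> :: "real^'n"
  shows "(\<Prod>i\<in>UNIV. moment_fun s (z $ i) (count_list js i) (\<xi> $ i))
    = heat_symbol s \<xi> * prod_list (map (\<lambda>j. deriv_symbol j \<xi>) js) * cis (z \<bullet> \<xi>)"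
proof -
  have "(\<Prod>i\<in>UNIV. cis (z $ i * \<xi> $ i)) = cis (z \<bullet> \<xi>)"
    by (simp add: cis_conv_exp exp_sum[symmetric] inner_vec_def sum_distrib_left)
  moreover have "(\<Prod>i\<in>UNIV. complex_of_real (exp (- s * (\<xi> $ i)\<^sup>2))) = heat_symbol s \<xi>"
    by (simp add: heat_symbol_def norm_vec_square exp_sum[symmetric] sum_distrib_left sum_negf flip: of_real_prod)
  moreover have "(\<Prod>i\<in>UNIV. (\<i> * complex_of_real (\<xi> $ i)) ^ count_list js i) = prod_list (map (\<lambda>j. deriv_symbol j \<xi>) js)"
    by (simp add: prod_power_count_list deriv_symbol_def)
  ultimately show ?thesis
    by (simp only: moment_fun_def prod.distrib mult_ac)
qed

text \<open>The iterated partial derivative of \<open>gauss s\<close> along \<open>js\<close>, valid for \<open>length js \<le> 3\<close>.\<close>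

definition gauss_deriv :: "'n list \<Rightarrow> real \<Rightarrow> real^'n \<Rightarrow> real" where
  "gauss_deriv js s z = gauss s z * (\<Prod>i\<in>UNIV. herm s (z $ i) (count_list js i))"

text \<open>Gaussian, monomial and character all factor over the coordinates, so the integral is a
  product of one-dimensional moments. The bound on \<open>length js\<close> keeps every multiplicity
  within the range of \<open>herm\<close>.\<close>

lemma
  fixes z :: "real^'n"
  assumes "0 < s"
  shows integrable_heat_symbol_deriv_symbol:
      "integrable lborel (\<lambda>\<xi>. heat_symbol s \<xi> * prod_list (map (\<lambda>j. deriv_symbol j \<xi>) js) * cis (z \<bullet> \<xi>))"
    and inverse_fourier_heat_symbol_deriv_symbol: "length js \<le> 3 \<Longrightarrow>
      (LINT \<xi>|lborel. heat_symbol s \<xi> * prod_list (map (\<lambda>j. deriv_symbol j \<xi>) js) * cis (z \<bullet> \<xi>))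
        = of_real ((2 * pi) ^ CARD('n) * gauss_deriv js s z)"
proof -
  show "integrable lborel (\<lambda>\<xi>. heat_symbol s \<xi> * prod_list (map (\<lambda>j. deriv_symbol j \<xi>) js) * cis (z \<bullet> \<xi>))"
    unfolding prod_moment_fun[symmetric]
    by (rule integral_prod_vec) (rule integrable_moment_fun[OF assms])
  assume len: "length js \<le> 3"
  have "count_list js i \<le> 3" for i using count_le_length[of js i] len by simp
  then have "(\<Prod>i\<in>UNIV. LINT x|lborel. moment_fun s (z $ i) (count_list js i) x)
      = (\<Prod>i\<in>UNIV. of_real (sqrt (pi / s) * exp (- (z $ i)\<^sup>2 / (4 * s)) * herm s (z $ i) (count_list js i)))"
    by (intro prod.cong refl integral_moment_fun assms)
  also have "\<dots> = of_real ((2 * pi) ^ CARD('n) * gauss_deriv js s z)"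
    unfolding of_real_prod[symmetric] prod.distrib[where h="\<lambda>i. herm s (z $ i) (count_list js i)"]
      prod_gauss[OF assms] gauss_deriv_def by (simp add: mult_ac)
  finally show "(LINT \<xi>|lborel. heat_symbol s \<xi> * prod_list (map (\<lambda>j. deriv_symbol j \<xi>) js) * cis (z \<bullet> \<xi>))
        = of_real ((2 * pi) ^ CARD('n) * gauss_deriv js s z)"
    unfolding prod_moment_fun[symmetric]
    by (subst integral_prod_vec) (rule integrable_moment_fun[OF assms])
qed

lemma gauss_deriv_Nil: "gauss_deriv [] s z = gauss s z"
  by (simp add: gauss_deriv_def herm_def)

lemma gauss_deriv_1: "gauss_deriv [h] s z = - z $ h / (2 * s) * gauss s z"
proof -
  have "(\<Prod>i\<in>UNIV. herm s (z $ i) (count_list [h] i)) = (\<Prod>i\<in>{h}. herm s (z $ i) (count_list [h] i))"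
    by (rule prod.mono_neutral_right) (auto simp: herm_def)
  then show ?thesis by (simp add: gauss_deriv_def herm_def)
qed

definition delta :: "'n \<Rightarrow> 'n \<Rightarrow> real" where "delta i j = (if i = j then 1 else 0)"

text \<open>The part linear in \<open>z\<close> of the third derivatives of a radial function, up to
  a radial factor.\<close>

definition sym_delta :: "'n \<Rightarrow> 'n \<Rightarrow> 'n \<Rightarrow> real^'n \<Rightarrow> real" where
  "sym_delta j h k z = delta j h * z $ k + delta j k * z $ h + delta h k * z $ j"

lemma gauss_deriv_3:
  assumes "0 < s"
  shows "gauss_deriv [j, h, k] s z
    = gauss s z * (sym_delta j h k z / (4 * s\<^sup>2) - z $ j * z $ h * z $ k / (8 * s ^ 3))"
proof -
  have "(\<Prod>i\<in>UNIV. herm s (z $ i) (count_list [j, h, k] i)) = (\<Prod>i\<in>{j, h, k}. herm s (z $ i) (count_list [j, h, k] i))"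
    by (rule prod.mono_neutral_right) (auto simp: herm_def)
  also have "\<dots> = sym_delta j h k z / (4 * s\<^sup>2) - z $ j * z $ h * z $ k / (8 * s ^ 3)"
    using assms
    by (cases "j = h"; cases "j = k"; cases "h = k")
       (auto simp: herm_def sym_delta_def delta_def field_simps power2_eq_square power3_eq_cube insert_commute)
  finally show ?thesis by (simp add: gauss_deriv_def)
qed

subsection \<open>Convolution with a Fourier multiplier\<close>

text \<open>For a nonnegative integrand the limits of the primitive deliver integrability along with
  the value.\<close>

lemma FTC_Ioi_nonneg:
  fixes f F :: "real \<Rightarrow> real"
  assumes "\<And>x. a < x \<Longrightarrow> DERIV F x :> f x" "\<And>x. a < x \<Longrightarrow> isCont f x" "\<And>x. a < x \<Longrightarrow> 0 \<le> f x"
    and "(F \<longlongrightarrow> A) (at_right a)" "(F \<longlongrightarrow> B) at_top"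
  shows "set_integrable lborel {a<..} f" "(LINT x:{a<..}|lborel. f x) = B - A"
proof -
  have e: "einterval (ereal a) \<infinity> = {a<..}" by (auto simp: einterval_def)
  have "set_integrable lborel (einterval (ereal a) \<infinity>) f" "(LBINT x=ereal a..\<infinity>. f x) = B - A"
    using assms by (intro interval_integral_FTC_nonneg[of "ereal a" \<infinity> F f A B]; simp add: ereal_tendsto_simps)+
  then show "set_integrable lborel {a<..} f" "(LINT x:{a<..}|lborel. f x) = B - A"
    by (simp_all add: interval_lebesgue_integral_def e)
qed

lemma FTC_Ioo_nonneg:
  fixes f F :: "real \<Rightarrow> real"
  assumes "a < b"
    and "\<And>x. a < x \<Longrightarrow> x < b \<Longrightarrow> DERIV F x :> f x" "\<And>x. a < x \<Longrightarrow> x < b \<Longrightarrow> isCont f x"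
    and "\<And>x. a < x \<Longrightarrow> x < b \<Longrightarrow> 0 \<le> f x"
    and "(F \<longlongrightarrow> A) (at_right a)" "(F \<longlongrightarrow> B) (at_left b)"
  shows "set_integrable lborel {a<..<b} f" "(LINT x:{a<..<b}|lborel. f x) = B - A"
proof -
  have e: "einterval (ereal a) (ereal b) = {a<..<b}" by (auto simp: einterval_def)
  have "set_integrable lborel (einterval (ereal a) (ereal b)) f" "(LBINT x=ereal a..ereal b. f x) = B - A"
    using assms by (intro interval_integral_FTC_nonneg[of "ereal a" "ereal b" F f A B]; simp add: ereal_tendsto_simps)+
  then show "set_integrable lborel {a<..<b} f" "(LINT x:{a<..<b}|lborel. f x) = B - A"
    using assms(1) by (simp_all add: interval_lebesgue_integral_def e)
qed

text \<open>Used with \<open>r = (norm \<xi>)\<^sup>2\<close>: it trades the inverse Laplacian for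
  an integral over heat times.\<close>

lemma exp_tail_integral:
  fixes r t :: real
  assumes "0 < r"
  shows "set_integrable lborel {t<..} (\<lambda>s. exp (- s * r))"
    and "(LINT s:{t<..}|lborel. exp (- s * r)) = exp (- t * r) / r"
proof -
  have "((\<lambda>s. - exp (- s * r) / r) \<longlongrightarrow> - 0 / r) at_top"
    using assms
    by (intro tendsto_intros filterlim_compose[OF exp_at_bot])
       (auto simp: filterlim_uminus_at_bot intro!: filterlim_at_top_mult_tendsto_pos filterlim_ident)
  moreover have "((\<lambda>s. - exp (- s * r) / r) \<longlongrightarrow> - exp (- t * r) / r) (at_right t)"
    using assms by (intro tendsto_intros) auto
  moreover have "DERIV (\<lambda>s. - exp (- s * r) / r) s :> exp (- s * r)" for s
    using assms by (auto intro!: derivative_eq_intros)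
  ultimately show "set_integrable lborel {t<..} (\<lambda>s. exp (- s * r))"
    "(LINT s:{t<..}|lborel. exp (- s * r)) = exp (- t * r) / r"
    using FTC_Ioi_nonneg[of t "\<lambda>s. - exp (- s * r) / r" "\<lambda>s. exp (- s * r)" "- exp (- t * r) / r" "- 0 / r"]
    by (auto intro!: continuous_intros)
qed

lemma sigma_finite_lebesgue: "sigma_finite_measure (lebesgue :: 'a::euclidean_space measure)"
proof
  obtain A :: "'a set set" where A: "countable A" "A \<subseteq> sets lborel" "\<Union>A = space lborel" "\<forall>a\<in>A. emeasure lborel a \<noteq> \<infinity>"
    using lborel.sigma_finite_countable by blast
  then show "\<exists>A::'a set set. countable A \<and> A \<subseteq> sets lebesgue \<and> \<Union>A = space lebesgue \<and> (\<forall>a\<in>A. emeasure lebesgue a \<noteq> \<infinity>)"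
    by (intro exI[of _ A]) (auto simp: subset_iff)
qed

text \<open>Frequencies and times are integrated against \<open>lborel\<close>, points against
  \<open>lebesgue\<close>, since fields such as \<open>a\<close> and \<open>u t\<close> are only
  Lebesgue measurable.\<close>

interpretation lebesgue_pair: pair_sigma_finite "lborel :: 'a::euclidean_space measure" "lebesgue :: 'b::euclidean_space measure"
  by (intro pair_sigma_finite.intro sigma_finite_lebesgue lborel.sigma_finite_measure_axioms)

lemma borel_measurable_ident_lebesgue: "(\<lambda>y. y) \<in> borel_measurable lebesgue"
  by (simp add: measurable_completion)

lemma norm_fourier_le: "norm (fourier f \<xi>) \<le> (LINT x|lebesgue. \<bar>f x\<bar>)"
proof -
  have "norm (fourier f \<xi>) \<le> (LINT x|lebesgue. norm (complex_of_real (f x) * cis (- (x \<bullet> \<xi>))))"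
    unfolding fourier_def by (rule integral_norm_bound)
  then show ?thesis by (simp add: norm_mult)
qed

text \<open>The convolution theorem by Fubini: the modulus of the double integrand is
  \<open>norm (\<phi> \<xi>) * \<bar>f y\<bar>\<close>, a product of integrable functions.\<close>

lemma
  fixes \<phi> :: "real^'n \<Rightarrow> complex" and f :: "real^'n \<Rightarrow> real"
  assumes \<phi>: "integrable lborel \<phi>" and f: "integrable lebesgue f"
  shows integrable_mult_fourier: "integrable lborel (\<lambda>\<xi>. \<phi> \<xi> * fourier f \<xi>)"
    and inverse_fourier_mult_fourier:
      "inverse_fourier (\<lambda>\<xi>. \<phi> \<xi> * fourier f \<xi>) x = (LINT y|lebesgue. of_real (f y) * inverse_fourier \<phi> (x - y))"
    and integrable_mult_inverse_fourier:
      "integrable lebesgue (\<lambda>y. of_real (f y) * inverse_fourier \<phi> (x - y))"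
proof -
  note borel_measurable_ident_lebesgue [measurable]
  have [measurable]: "\<phi> \<in> borel_measurable borel" "f \<in> borel_measurable lebesgue" using \<phi> f by auto
  let ?F = "\<lambda>x \<xi> y. \<phi> \<xi> * (of_real (f y) * cis ((x - y) \<bullet> \<xi>))"
  have int: "integrable (lborel \<Otimes>\<^sub>M lebesgue) (\<lambda>(\<xi>, y). ?F x \<xi> y)" for x
  proof (rule lebesgue_pair.Fubini_integrable)
    show "(\<lambda>(\<xi>, y). ?F x \<xi> y) \<in> borel_measurable (lborel \<Otimes>\<^sub>M lebesgue)"
      by measurable
    show "integrable lborel (\<lambda>\<xi>. LINT y|lebesgue. norm (case (\<xi>, y) of (\<xi>, y) \<Rightarrow> ?F x \<xi> y))"
      using \<phi> by (simp add: norm_mult)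
    show "AE \<xi> in lborel. integrable lebesgue (\<lambda>y. case (\<xi>, y) of (\<xi>, y) \<Rightarrow> ?F x \<xi> y)"
    proof (intro AE_I2)
      fix \<xi> :: "real^'n"
      have "integrable lebesgue (\<lambda>y. of_real (f y) * cis ((x - y) \<bullet> \<xi>))"
        by (rule Bochner_Integration.integrable_bound[OF f]) (auto simp: norm_mult)
      then show "integrable lebesgue (\<lambda>y. case (\<xi>, y) of (\<xi>, y) \<Rightarrow> ?F x \<xi> y)" by simp
    qed
  qed
  have inner: "(LINT y|lebesgue. ?F x \<xi> y) = \<phi> \<xi> * fourier f \<xi> * cis (x \<bullet> \<xi>)" for x \<xi>
  proof -
    have "(LINT y|lebesgue. of_real (f y) * cis ((x - y) \<bullet> \<xi>))
        = (LINT y|lebesgue. of_real (f y) * cis (- (y \<bullet> \<xi>)) * cis (x \<bullet> \<xi>))"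
      by (intro Bochner_Integration.integral_cong refl) (simp add: inner_diff_left cis_mult mult.assoc)
    then show ?thesis by (simp add: fourier_def)
  qed
  have outer: "(LINT \<xi>|lborel. ?F x \<xi> y) = of_real (f y) * inverse_fourier \<phi> (x - y) * (2 * pi) ^ CARD('n)" for x y
  proof -
    have "(LINT \<xi>|lborel. ?F x \<xi> y) = (LINT \<xi>|lborel. of_real (f y) * (\<phi> \<xi> * cis ((x - y) \<bullet> \<xi>)))"
      by (simp add: mult_ac)
    also have "\<dots> = of_real (f y) * (LINT \<xi>|lebesgue. \<phi> \<xi> * cis ((x - y) \<bullet> \<xi>))"
      by (simp add: integral_completion)
    finally show ?thesis by (simp add: inverse_fourier_def)
  qed
  show int1: "integrable lborel (\<lambda>\<xi>. \<phi> \<xi> * fourier f \<xi>)"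
    using lebesgue_pair.integrable_fst[OF int[of 0]] unfolding inner by simp
  have "inverse_fourier (\<lambda>\<xi>. \<phi> \<xi> * fourier f \<xi>) x * (2 * pi) ^ CARD('n) = (LINT \<xi>|lborel. (LINT y|lebesgue. ?F x \<xi> y))"
    using borel_measurable_integrable[OF int1] unfolding inner inverse_fourier_def
    by (simp add: integral_completion)
  also have "\<dots> = (LINT y|lebesgue. (LINT \<xi>|lborel. ?F x \<xi> y))"
    by (rule lebesgue_pair.Fubini_integral[OF int, symmetric])
  also have "\<dots> = (LINT y|lebesgue. of_real (f y) * inverse_fourier \<phi> (x - y)) * (2 * pi) ^ CARD('n)"
    unfolding outer by simp
  finally show "inverse_fourier (\<lambda>\<xi>. \<phi> \<xi> * fourier f \<xi>) x = (LINT y|lebesgue. of_real (f y) * inverse_fourier \<phi> (x - y))"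
    by simp
  show "integrable lebesgue (\<lambda>y. of_real (f y) * inverse_fourier \<phi> (x - y))"
    using integrable_divide[OF lebesgue_pair.integrable_snd[OF int[of x]], of "(2 * of_real pi) ^ CARD('n)"]
    unfolding outer by simp
qed

subsection \<open>The kernel of the heat flow composed with the Leray projector and the divergence\<close>

text \<open>The symbol that maps entry \<open>(h, k)\<close> of the tensor to component
  \<open>j\<close> of its projected divergence. The plus sign results from two minus signs, one in
  the projector and one in the inverse Laplacian.\<close>

definition leray_symbol :: "'n \<Rightarrow> 'n \<Rightarrow> 'n \<Rightarrow> real^'n \<Rightarrow> complex" where
  "leray_symbol j h k \<xi> = of_real (delta j k) * deriv_symbol h \<xi>
     + deriv_symbol j \<xi> * deriv_symbol h \<xi> * deriv_symbol k \<xi> / of_real ((norm \<xi>)\<^sup>2)"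

lemma leray_hat_div_hat:
  "leray_hat (div_hat F) j \<xi> = (\<Sum>h\<in>UNIV. \<Sum>k\<in>UNIV. leray_symbol j h k \<xi> * fourier (\<lambda>x. F x $ h $ k) \<xi>)"
proof -
  have "div_hat F j \<xi> = (\<Sum>h\<in>UNIV. \<Sum>k\<in>UNIV. (of_real (delta j k) * deriv_symbol h \<xi>) * fourier (\<lambda>x. F x $ h $ k) \<xi>)"
    unfolding div_hat_def
    by (intro sum.cong refl) (simp add: delta_def if_distrib if_distribR sum.delta cong: if_cong)
  moreover have "(\<Sum>k\<in>UNIV. deriv_symbol k \<xi> * div_hat F k \<xi>)
      = (\<Sum>h\<in>UNIV. \<Sum>k\<in>UNIV. deriv_symbol k \<xi> * deriv_symbol h \<xi> * fourier (\<lambda>x. F x $ h $ k) \<xi>)"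
    unfolding div_hat_def sum_distrib_left by (subst sum.swap) (simp add: mult_ac)
  ultimately show ?thesis
    unfolding leray_hat_def leray_symbol_def inv_laplace_symbol_def
    by (simp add: sum_distrib_left sum.distrib[symmetric] sum_subtractf[symmetric] algebra_simps)
qed

text \<open>The derivative in direction \<open>h\<close> of entry \<open>(j, k)\<close> of the Oseen
  tensor.\<close>

definition oseen_kernel :: "'n \<Rightarrow> 'n \<Rightarrow> 'n \<Rightarrow> real \<Rightarrow> real^'n \<Rightarrow> real" where
  "oseen_kernel j h k t z = delta j k * gauss_deriv [h] t z + (LINT s:{t<..}|lborel. gauss_deriv [j, h, k] s z)"

lemma norm_heat_symbol: "norm (heat_symbol s \<xi>) = exp (- s * (norm \<xi>)\<^sup>2)"
  by (simp add: heat_symbol_def)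

lemma norm_deriv_symbol_le: "norm (deriv_symbol j \<xi>) \<le> norm \<xi>"
  by (simp add: deriv_symbol_def norm_mult component_le_norm_cart)

lemma deriv_symbol_zero [simp]: "deriv_symbol j 0 = 0"
  by (simp add: deriv_symbol_def)

lemma borel_measurable_heat_symbol [measurable]:
  "(\<lambda>(s, \<xi>::real^'n). heat_symbol s \<xi>) \<in> borel_measurable (borel \<Otimes>\<^sub>M borel)"
  unfolding heat_symbol_def by measurable

lemma borel_measurable_heat_symbol' [measurable]: "heat_symbol s \<in> borel_measurable borel"
  unfolding heat_symbol_def by measurable

lemma borel_measurable_deriv_symbol [measurable]: "deriv_symbol j \<in> borel_measurable borel"
  unfolding deriv_symbol_def[abs_def] by (intro borel_measurable_continuous_onI continuous_intros)

lemma
  fixes j h k :: "'n::finite"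
  assumes t: "0 < t"
  shows integrable_leray_tail: "integrable lborel (\<lambda>\<xi>. heat_symbol t \<xi> *
      (deriv_symbol j \<xi> * deriv_symbol h \<xi> * deriv_symbol k \<xi> / of_real ((norm \<xi>)\<^sup>2)) * cis (z \<bullet> \<xi>))"
    and integral_leray_tail: "(LINT \<xi>|lborel. heat_symbol t \<xi> *
      (deriv_symbol j \<xi> * deriv_symbol h \<xi> * deriv_symbol k \<xi> / of_real ((norm \<xi>)\<^sup>2)) * cis (z \<bullet> \<xi>))
      = of_real ((2 * pi) ^ CARD('n) * (LINT s:{t<..}|lborel. gauss_deriv [j, h, k] s z))"
proof -
  let ?p = "\<lambda>\<xi>. deriv_symbol j \<xi> * deriv_symbol h \<xi> * deriv_symbol k \<xi>"
  let ?F = "\<lambda>\<xi> s. indicator {t<..} s *\<^sub>R (heat_symbol s \<xi> * (?p \<xi> * cis (z \<bullet> \<xi>)))"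
  have tail: "set_integrable lborel {t<..} (\<lambda>s. exp (- s * (norm \<xi>)\<^sup>2))"
    "(LINT s:{t<..}|lborel. exp (- s * (norm \<xi>)\<^sup>2)) = exp (- t * (norm \<xi>)\<^sup>2) / (norm \<xi>)\<^sup>2"
    if "\<xi> \<noteq> 0" for \<xi> :: "real^'n"
    using exp_tail_integral[of "(norm \<xi>)\<^sup>2" t] that by auto
  have inti: "integrable lborel (?F \<xi>)" for \<xi>
  proof (cases "\<xi> = 0")
    case False
    show ?thesis
      by (rule Bochner_Integration.integrable_bound[OF integrable_mult_left[OF tail(1)[OF False, unfolded set_integrable_def], of "norm (?p \<xi>)"]])
         (auto simp: norm_mult norm_heat_symbol)
  qed simp
  have norm_inner: "(LINT s|lborel. norm (?F \<xi> s)) = exp (- t * (norm \<xi>)\<^sup>2) / (norm \<xi>)\<^sup>2 * norm (?p \<xi>)" for \<xi>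
  proof (cases "\<xi> = 0")
    case False
    have "(LINT s|lborel. norm (?F \<xi> s)) = (LINT s|lborel. indicator {t<..} s *\<^sub>R exp (- s * (norm \<xi>)\<^sup>2) * norm (?p \<xi>))"
      by (simp add: norm_mult norm_heat_symbol mult_ac)
    also have "\<dots> = (LINT s:{t<..}|lborel. exp (- s * (norm \<xi>)\<^sup>2)) * norm (?p \<xi>)"
      unfolding set_lebesgue_integral_def by (rule integral_mult_left_zero)
    finally show ?thesis using tail(2)[OF False] by simp
  qed simp
  \<comment> \<open>Two of the three derivative symbols cancel the factor
    \<open>1 / (norm \<xi>)\<^sup>2\<close> produced by the time integral, so the double integral is
    dominated by \<open>heat_symbol t \<xi> * deriv_symbol k \<xi>\<close>.\<close>
  have p_le: "norm (?p \<xi>) / (norm \<xi>)\<^sup>2 \<le> norm (deriv_symbol k \<xi>)" for \<xi>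
  proof (cases "\<xi> = 0")
    case False
    have "norm (deriv_symbol j \<xi> * deriv_symbol h \<xi>) \<le> (norm \<xi>)\<^sup>2"
      unfolding norm_mult power2_eq_square by (intro mult_mono norm_deriv_symbol_le) auto
    then have "norm (?p \<xi>) \<le> (norm \<xi>)\<^sup>2 * norm (deriv_symbol k \<xi>)"
      unfolding norm_mult[of _ "deriv_symbol k \<xi>"] by (rule mult_right_mono) simp
    then show ?thesis using False
      by (simp only: pos_divide_le_eq zero_less_power zero_less_norm_iff mult.commute[of "norm (deriv_symbol k \<xi>)"] simp_thms)
  qed simp
  have int1: "integrable lborel (\<lambda>\<xi>. heat_symbol t \<xi> * deriv_symbol k \<xi>)"
    using integrable_heat_symbol_deriv_symbol[OF t, of "[k]" 0] by (simp add: cis_zero)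
  have int: "integrable (lborel \<Otimes>\<^sub>M lborel) (\<lambda>(\<xi>, s). ?F \<xi> s)"
  proof (rule lborel_pair.Fubini_integrable)
    show "(\<lambda>(\<xi>, s). ?F \<xi> s) \<in> borel_measurable (lborel \<Otimes>\<^sub>M lborel)"
      by measurable
    show "AE \<xi> in lborel. integrable lborel (\<lambda>s. case (\<xi>, s) of (\<xi>, s) \<Rightarrow> ?F \<xi> s)"
      using inti by simp
    show "integrable lborel (\<lambda>\<xi>. LINT s|lborel. norm (case (\<xi>, s) of (\<xi>, s) \<Rightarrow> ?F \<xi> s))"
      unfolding prod.case norm_inner
      by (rule Bochner_Integration.integrable_bound[OF int1])
         (auto simp: norm_mult norm_heat_symbol norm_divide norm_power p_le mult_left_mono intro!: order_trans[OF _ mult_left_mono[OF p_le]])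
  qed
  have inner: "(LINT s|lborel. ?F \<xi> s) = heat_symbol t \<xi> * (?p \<xi> / of_real ((norm \<xi>)\<^sup>2)) * cis (z \<bullet> \<xi>)" for \<xi>
  proof (cases "\<xi> = 0")
    case False
    have "(LINT s|lborel. ?F \<xi> s) = (LINT s|lborel. of_real (indicator {t<..} s *\<^sub>R exp (- s * (norm \<xi>)\<^sup>2)) * (?p \<xi> * cis (z \<bullet> \<xi>)))"
      by (simp add: heat_symbol_def scaleR_conv_of_real mult_ac)
    also have "\<dots> = of_real (LINT s:{t<..}|lborel. exp (- s * (norm \<xi>)\<^sup>2)) * (?p \<xi> * cis (z \<bullet> \<xi>))"
      unfolding set_lebesgue_integral_def by (simp only: integral_mult_left_zero integral_complex_of_real)
    finally show ?thesis unfolding tail(2)[OF False] by (simp add: heat_symbol_def mult_ac)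
  qed simp
  have outer: "(LINT \<xi>|lborel. ?F \<xi> s) = of_real ((2 * pi) ^ CARD('n) * (indicator {t<..} s *\<^sub>R gauss_deriv [j, h, k] s z))" for s
  proof (cases "t < s")
    case True
    then show ?thesis
      using inverse_fourier_heat_symbol_deriv_symbol[of s "[j, h, k]" z] t by (simp add: mult_ac)
  qed simp
  show "integrable lborel (\<lambda>\<xi>. heat_symbol t \<xi> * (?p \<xi> / of_real ((norm \<xi>)\<^sup>2)) * cis (z \<bullet> \<xi>))"
    using lborel_pair.integrable_fst[OF int] unfolding inner .
  have "(LINT \<xi>|lborel. heat_symbol t \<xi> * (?p \<xi> / of_real ((norm \<xi>)\<^sup>2)) * cis (z \<bullet> \<xi>)) = (LINT s|lborel. (LINT \<xi>|lborel. ?F \<xi> s))"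
    unfolding inner[symmetric] by (rule lborel_pair.Fubini_integral[OF int, symmetric])
  then show "(LINT \<xi>|lborel. heat_symbol t \<xi> * (?p \<xi> / of_real ((norm \<xi>)\<^sup>2)) * cis (z \<bullet> \<xi>))
      = of_real ((2 * pi) ^ CARD('n) * (LINT s:{t<..}|lborel. gauss_deriv [j, h, k] s z))"
    unfolding outer integral_complex_of_real set_lebesgue_integral_def by simp
qed

lemma
  fixes z :: "real^'n"
  assumes t: "0 < t"
  shows integrable_heat_leray_symbol: "integrable lborel (\<lambda>\<xi>. heat_symbol t \<xi> * leray_symbol j h k \<xi>)"
    and inverse_fourier_heat_leray_symbol:
      "inverse_fourier (\<lambda>\<xi>. heat_symbol t \<xi> * leray_symbol j h k \<xi>) z = of_real (oseen_kernel j h k t z)"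
proof -
  let ?A = "\<lambda>z \<xi>. heat_symbol t \<xi> * prod_list (map (\<lambda>j. deriv_symbol j \<xi>) [h]) * cis (z \<bullet> \<xi>)"
  let ?B = "\<lambda>z \<xi>. heat_symbol t \<xi> * (deriv_symbol j \<xi> * deriv_symbol h \<xi> * deriv_symbol k \<xi> / of_real ((norm \<xi>)\<^sup>2)) * cis (z \<bullet> \<xi>)"
  have eq: "heat_symbol t \<xi> * leray_symbol j h k \<xi> * cis (z \<bullet> \<xi>) = of_real (delta j k) * ?A z \<xi> + ?B z \<xi>" for z \<xi>
    by (simp add: leray_symbol_def algebra_simps)
  have iA: "integrable lborel (\<lambda>\<xi>. of_real (delta j k) * ?A z \<xi>)" for z
    by (intro integrable_mult_right integrable_heat_symbol_deriv_symbol t)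
  have iB: "integrable lborel (?B z)" for z by (rule integrable_leray_tail[OF t])
  have int: "integrable lborel (\<lambda>\<xi>. heat_symbol t \<xi> * leray_symbol j h k \<xi> * cis (z \<bullet> \<xi>))" for z
    unfolding eq by (intro Bochner_Integration.integrable_add iA iB)
  show int0: "integrable lborel (\<lambda>\<xi>. heat_symbol t \<xi> * leray_symbol j h k \<xi>)"
    using int[of 0] by (simp add: cis_zero)
  have "(LINT \<xi>|lebesgue. heat_symbol t \<xi> * leray_symbol j h k \<xi> * cis (z \<bullet> \<xi>))
      = (LINT \<xi>|lborel. heat_symbol t \<xi> * leray_symbol j h k \<xi> * cis (z \<bullet> \<xi>))"
    using int[of z] by (intro integral_completion) auto
  also have "\<dots> = of_real (delta j k) * (LINT \<xi>|lborel. ?A z \<xi>) + (LINT \<xi>|lborel. ?B z \<xi>)"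
    unfolding eq by (subst Bochner_Integration.integral_add[OF iA iB]) simp
  also have "\<dots> = of_real (oseen_kernel j h k t z) * (2 * pi) ^ CARD('n)"
    unfolding integral_leray_tail[OF t] oseen_kernel_def
    by (subst inverse_fourier_heat_symbol_deriv_symbol[OF t]) (simp_all add: algebra_simps)
  finally show "inverse_fourier (\<lambda>\<xi>. heat_symbol t \<xi> * leray_symbol j h k \<xi>) z = of_real (oseen_kernel j h k t z)"
    by (simp add: inverse_fourier_def)
qed

lemma
  fixes a :: "real^'n \<Rightarrow> real^'n"
  assumes t: "0 < t" and int: "integrable lebesgue (\<lambda>y. a y $ j)"
  shows heat_eq: "heat t a x $ j = (LINT y|lebesgue. a y $ j * gauss t (x - y))"
    and integrable_heat: "integrable lebesgue (\<lambda>y. a y $ j * gauss t (x - y))"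
proof -
  have i0: "integrable lborel (\<lambda>\<xi>::real^'n. heat_symbol t \<xi> * cis (z \<bullet> \<xi>))"
    and e0: "(LINT \<xi>|lborel. heat_symbol t \<xi> * cis (z \<bullet> \<xi>)) = of_real ((2 * pi) ^ CARD('n) * gauss t z)" for z :: "real^'n"
    using integrable_heat_symbol_deriv_symbol[OF t, of "[]" z] inverse_fourier_heat_symbol_deriv_symbol[OF t, of "[]" z]
    by (auto simp: gauss_deriv_Nil)
  have i1: "integrable lborel (heat_symbol t :: real^'n \<Rightarrow> complex)"
    using i0[of 0] by (simp add: cis_zero)
  have "(LINT \<xi>|lebesgue. heat_symbol t \<xi> * cis (z \<bullet> \<xi>)) = of_real ((2 * pi) ^ CARD('n) * gauss t z)" for z :: "real^'n"
    using e0[of z] by (subst integral_completion) auto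
  then have inv: "inverse_fourier (heat_symbol t) z = of_real (gauss t z)" for z :: "real^'n"
    by (simp add: inverse_fourier_def)
  have "inverse_fourier (\<lambda>\<xi>. heat_symbol t \<xi> * fourier (\<lambda>y. a y $ j) \<xi>) x
      = of_real (LINT y|lebesgue. a y $ j * gauss t (x - y))"
    by (subst inverse_fourier_mult_fourier[OF i1 int])
       (simp only: inv of_real_mult[symmetric] integral_complex_of_real)
  then show "heat t a x $ j = (LINT y|lebesgue. a y $ j * gauss t (x - y))"
    by (simp add: heat_def)
  show "integrable lebesgue (\<lambda>y. a y $ j * gauss t (x - y))"
    using integrable_mult_inverse_fourier[OF i1 int, of x] unfolding inv of_real_mult[symmetric]
    by (simp only: complex_of_real_integrable_eq)
qed

text \<open>The convolution form serves the spatial estimates. The Fourier form serves continuity in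
  time, because there the time enters through an explicit factor \<open>heat_symbol\<close>.\<close>

lemma
  fixes F :: "real^'n \<Rightarrow> real^'n^'n"
  assumes t: "0 < t" and int: "\<And>h k. integrable lebesgue (\<lambda>y. F y $ h $ k)"
  shows integrable_oseen: "integrable lebesgue (\<lambda>y. F y $ h $ k * oseen_kernel j h k t (x - y))"
    and heat_leray_div_eq: "heat_leray_div t F x $ j
      = (\<Sum>h\<in>UNIV. \<Sum>k\<in>UNIV. LINT y|lebesgue. F y $ h $ k * oseen_kernel j h k t (x - y))"
    and heat_leray_div_fourier: "heat_leray_div t F x $ j
      = (\<Sum>h\<in>UNIV. \<Sum>k\<in>UNIV. Re (inverse_fourier (\<lambda>\<xi>. heat_symbol t \<xi> * leray_symbol j h k \<xi> * fourier (\<lambda>y. F y $ h $ k) \<xi>) x))"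
proof -
  note S = integrable_heat_leray_symbol[OF t]
  note inv = inverse_fourier_heat_leray_symbol[OF t]
  let ?G = "\<lambda>h k \<xi>. heat_symbol t \<xi> * leray_symbol j h k \<xi> * fourier (\<lambda>y. F y $ h $ k) \<xi>"
  show "integrable lebesgue (\<lambda>y. F y $ h $ k * oseen_kernel j h k t (x - y))"
    using integrable_mult_inverse_fourier[OF S int, where x=x] unfolding inv of_real_mult[symmetric]
    by (simp only: complex_of_real_integrable_eq)
  have iG: "integrable lborel (?G h k)" for h k
    by (rule integrable_mult_fourier[OF S int])
  have iG': "integrable lebesgue (\<lambda>\<xi>. ?G h k \<xi> * cis (x \<bullet> \<xi>))" for h k
  proof -
    have "integrable lborel (\<lambda>\<xi>. ?G h k \<xi> * cis (x \<bullet> \<xi>))"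
      using borel_measurable_integrable[OF iG]
      by (intro Bochner_Integration.integrable_bound[OF iG[of h k]]) (auto simp: norm_mult)
    then show ?thesis by (simp add: integrable_completion borel_measurable_integrable)
  qed
  have "inverse_fourier (\<lambda>\<xi>. heat_symbol t \<xi> * leray_hat (div_hat F) j \<xi>) x
     = (LINT \<xi>|lebesgue. (\<Sum>h\<in>UNIV. \<Sum>k\<in>UNIV. ?G h k \<xi> * cis (x \<bullet> \<xi>))) / (2 * pi) ^ CARD('n)"
    unfolding inverse_fourier_def leray_hat_div_hat by (simp add: sum_distrib_left sum_distrib_right mult.assoc)
  also have "\<dots> = (\<Sum>h\<in>UNIV. \<Sum>k\<in>UNIV. inverse_fourier (?G h k) x)"
    by (simp add: Bochner_Integration.integral_sum iG' integrable_sum inverse_fourier_def sum_divide_distrib)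
  finally show fou: "heat_leray_div t F x $ j = (\<Sum>h\<in>UNIV. \<Sum>k\<in>UNIV. Re (inverse_fourier (?G h k) x))"
    by (simp add: heat_leray_div_def)
  have "inverse_fourier (?G h k) x = of_real (LINT y|lebesgue. F y $ h $ k * oseen_kernel j h k t (x - y))" for h k
    by (subst inverse_fourier_mult_fourier[OF S int])
       (simp only: inv of_real_mult[symmetric] integral_complex_of_real)
  then show "heat_leray_div t F x $ j
      = (\<Sum>h\<in>UNIV. \<Sum>k\<in>UNIV. LINT y|lebesgue. F y $ h $ k * oseen_kernel j h k t (x - y))"
    unfolding fou by simp
qed

subsection \<open>Gaussian bounds\<close>

lemma gauss_nonneg: "0 \<le> s \<Longrightarrow> 0 \<le> gauss s z"
  by (simp add: gauss_def)

lemma borel_measurable_gauss [measurable]: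
  "(\<lambda>(s, z::real^'n). gauss s z) \<in> borel_measurable (borel \<Otimes>\<^sub>M borel)"
  unfolding gauss_def by measurable

text \<open>Up to a constant, \<open>gauss s\<close> is the heat symbol at time
  \<open>1 / (4 * s)\<close>, so its mass is an inverse transform evaluated at the origin.\<close>

lemma integral_gauss:
  assumes "0 < s"
  shows "integrable lborel (gauss s :: real^'n \<Rightarrow> real)" "(LINT z|lborel. gauss s (z::real^'n)) = 1"
proof -
  let ?r = "1 / (4 * s)"
  have r: "0 < ?r" using assms by simp
  have eq: "complex_of_real (gauss s z) = heat_symbol ?r z / of_real (sqrt (4 * pi * s) ^ CARD('n))" for z :: "real^'n"
    by (simp add: gauss_def heat_symbol_def)
  have i: "integrable lborel (heat_symbol ?r :: real^'n \<Rightarrow> complex)"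
    using integrable_heat_symbol_deriv_symbol[OF r, of "[]" "0::real^'n"] by (simp add: cis_zero)
  have I: "(LINT \<xi>|lborel. heat_symbol ?r (\<xi>::real^'n)) = of_real ((2 * pi) ^ CARD('n) * gauss ?r (0::real^'n))"
    using inverse_fourier_heat_symbol_deriv_symbol[OF r, of "[]" "0::real^'n"] by (simp add: cis_zero gauss_deriv_Nil)
  have "integrable lborel (\<lambda>z::real^'n. complex_of_real (gauss s z))"
    unfolding eq using i by (rule integrable_divide)
  then show "integrable lborel (gauss s :: real^'n \<Rightarrow> real)" by (simp only: complex_of_real_integrable_eq)
  have "complex_of_real (LINT z|lborel. gauss s (z::real^'n))
      = of_real ((2 * pi) ^ CARD('n) * gauss ?r (0::real^'n) / sqrt (4 * pi * s) ^ CARD('n))"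
    unfolding integral_complex_of_real[symmetric] eq using I by simp
  also have "(2 * pi) ^ CARD('n) * gauss ?r (0::real^'n) / sqrt (4 * pi * s) ^ CARD('n)
      = (2 * pi / (sqrt (pi / s) * sqrt (4 * pi * s))) ^ CARD('n)"
    by (simp add: gauss_def power_divide power_mult_distrib)
  also have "sqrt (pi / s) * sqrt (4 * pi * s) = 2 * pi"
    unfolding real_sqrt_mult[symmetric] using assms by (intro real_sqrt_unique) (auto simp: power2_eq_square)
  finally show "(LINT z|lborel. gauss s (z::real^'n)) = 1" by (simp only: of_real_eq_iff) simp
qed

text \<open>In the variable \<open>v = norm z / sqrt s\<close> the Gaussian is exp (- v^2 / 4); half
  of the exponent absorbs \<open>v ^ m\<close>, and the other half is the Gaussian at time
  \<open>2 * s\<close>, up to the factor \<open>sqrt 2 ^ CARD('n)\<close> of the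
  normalization.\<close>

lemma gauss_moment:
  "\<exists>C>0. \<forall>s>0. \<forall>z::real^'n. norm z ^ m * gauss s z \<le> C * sqrt s ^ m * gauss (2 * s) z"
proof -
  obtain C where C: "C > 0" "\<And>v::real. v \<ge> 0 \<Longrightarrow> v ^ m * exp (- (1/8) * v\<^sup>2) \<le> C"
    using power_exp_neg_square_bounded[of "1/8" m] by auto
  have "norm z ^ m * gauss s z \<le> (C * sqrt 2 ^ CARD('n)) * sqrt s ^ m * gauss (2 * s) z"
    if s: "0 < s" for s and z :: "real^'n"
  proof -
    define v where "v = norm z / sqrt s"
    have nz: "norm z = v * sqrt s" and v: "v \<ge> 0" using s by (auto simp: v_def)
    have e: "exp (- (norm z)\<^sup>2 / (4 * s)) = exp (- (1/8) * v\<^sup>2) * exp (- (norm z)\<^sup>2 / (4 * (2 * s)))"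
      using s unfolding nz exp_add[symmetric] by (simp add: power_mult_distrib)
    have r: "sqrt (4 * pi * (2 * s)) = sqrt 2 * sqrt (4 * pi * s)"
      unfolding real_sqrt_mult[symmetric] by (simp add: mult_ac)
    have g: "gauss s z = exp (- (1/8) * v\<^sup>2) * sqrt 2 ^ CARD('n) * gauss (2 * s) z"
      unfolding gauss_def e r power_mult_distrib by simp
    have "norm z ^ m * gauss s z = (v ^ m * exp (- (1/8) * v\<^sup>2)) * (sqrt 2 ^ CARD('n) * sqrt s ^ m * gauss (2 * s) z)"
      unfolding g nz power_mult_distrib by (simp add: mult_ac)
    also have "\<dots> \<le> C * (sqrt 2 ^ CARD('n) * sqrt s ^ m * gauss (2 * s) z)"
      using s by (intro mult_right_mono C v mult_nonneg_nonneg gauss_nonneg) auto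
    finally show ?thesis by (simp add: mult_ac)
  qed
  then show ?thesis using C(1) by (intro exI[of _ "C * sqrt 2 ^ CARD('n)"]) auto
qed

lemma gauss_le:
  fixes z :: "real^'n"
  assumes "0 < s" shows "gauss s z \<le> 1 / sqrt s ^ CARD('n)"
proof -
  have "1 \<le> 4 * pi" using pi_ge_two by simp
  then have "sqrt s \<le> sqrt (4 * pi * s)" using assms by (intro real_sqrt_le_mono) (auto simp: mult_le_cancel_right1)
  then have "sqrt s ^ CARD('n) \<le> sqrt (4 * pi * s) ^ CARD('n)" using assms by (intro power_mono) auto
  moreover have "exp (- (norm z)\<^sup>2 / (4 * s)) \<le> 1" using assms by simp
  ultimately show ?thesis unfolding gauss_def using assms by (intro frac_le) auto
qed

text \<open>The exponent is chosen so that exactly one factor \<open>s\<close> survives: the moment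
  gives \<open>sqrt s ^ (CARD('n) + 2)\<close>, the peak of the Gaussian costs
  \<open>sqrt s ^ CARD('n)\<close>.\<close>

lemma gauss_decay:
  "\<exists>C>0. \<forall>s>0. \<forall>z::real^'n. norm z ^ (CARD('n) + 2) * gauss s z \<le> C * s"
proof -
  obtain C where C: "C > 0" "\<And>s z. s > 0 \<Longrightarrow>
      norm (z::real^'n) ^ (CARD('n) + 2) * gauss s z \<le> C * sqrt s ^ (CARD('n) + 2) * gauss (2 * s) z"
    using gauss_moment[of "CARD('n) + 2"] by blast
  have "norm z ^ (CARD('n) + 2) * gauss s z \<le> C * s" if s: "0 < s" for s and z :: "real^'n"
  proof -
    have "gauss (2 * s) z \<le> 1 / sqrt (2 * s) ^ CARD('n)" using s by (intro gauss_le) auto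
    also have "\<dots> \<le> 1 / sqrt s ^ CARD('n)" using s by (intro divide_left_mono power_mono) auto
    finally have "C * sqrt s ^ (CARD('n) + 2) * gauss (2 * s) z \<le> C * sqrt s ^ (CARD('n) + 2) * (1 / sqrt s ^ CARD('n))"
      using s C(1) by (intro mult_left_mono) auto
    also have "\<dots> = C * s" using s by (simp add: power_add power2_eq_square)
    finally show ?thesis using C(2)[OF s, of z] by linarith
  qed
  then show ?thesis using C(1) by blast
qed

lemma gauss_deriv_1_bound:
  "\<exists>C>0. \<forall>s>0. \<forall>z::real^'n. \<bar>gauss_deriv [h] s z\<bar> \<le> C / sqrt s * gauss (2 * s) z"
proof -
  obtain C where C: "C > 0" "\<And>s z. s > 0 \<Longrightarrow> norm (z::real^'n) ^ 1 * gauss s z \<le> C * sqrt s ^ 1 * gauss (2 * s) z"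
    using gauss_moment[of 1] by blast
  have "\<bar>gauss_deriv [h] s z\<bar> \<le> C / sqrt s * gauss (2 * s) z" if s: "0 < s" for s and z :: "real^'n"
  proof -
    have "\<bar>gauss_deriv [h] s z\<bar> = \<bar>z $ h\<bar> * gauss s z / (2 * s)"
      using s gauss_nonneg[of s z] by (simp add: gauss_deriv_1 abs_mult)
    also have "\<dots> \<le> norm z * gauss s z / (2 * s)"
      using s by (intro divide_right_mono mult_right_mono component_le_norm_cart gauss_nonneg) auto
    also have "\<dots> \<le> norm z * gauss s z / s"
      using s gauss_nonneg[of s z] by (intro divide_left_mono) auto
    also have "\<dots> \<le> C * sqrt s * gauss (2 * s) z / s"
      using C(2)[OF s, of z] s by (intro divide_right_mono) auto
    also have "\<dots> = C / sqrt s * gauss (2 * s) z"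
      using s by (simp add: field_simps)
    finally show ?thesis .
  qed
  then show ?thesis using C(1) by blast
qed

lemma sym_delta_le: "\<bar>sym_delta j h k z\<bar> \<le> 3 * norm z"
  using component_le_norm_cart[of z j] component_le_norm_cart[of z h] component_le_norm_cart[of z k]
  by (auto simp: sym_delta_def delta_def)

lemma triple_component_le: "\<bar>z $ j * z $ h * z $ k\<bar> \<le> norm z ^ 3"
  unfolding abs_mult power3_eq_cube by (intro mult_mono component_le_norm_cart) auto

text \<open>With |z| counted as \<open>sqrt s\<close>, both terms |z| / s^2 and |z|^3 / s^3 of the
  third derivative scale like s to the power - 3/2.\<close>

lemma gauss_deriv_3_bound:
  "\<exists>C>0. \<forall>s>0. \<forall>z::real^'n. \<bar>gauss_deriv [j, h, k] s z\<bar> \<le> C / (s * sqrt s) * gauss (2 * s) z"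
proof -
  obtain C1 where C1: "C1 > 0" "\<And>s z. s > 0 \<Longrightarrow> norm (z::real^'n) ^ 1 * gauss s z \<le> C1 * sqrt s ^ 1 * gauss (2 * s) z"
    using gauss_moment[of 1] by blast
  obtain C3 where C3: "C3 > 0" "\<And>s z. s > 0 \<Longrightarrow> norm (z::real^'n) ^ 3 * gauss s z \<le> C3 * sqrt s ^ 3 * gauss (2 * s) z"
    using gauss_moment[of 3] by blast
  have "\<bar>gauss_deriv [j, h, k] s z\<bar> \<le> (3 * C1 + C3) / (s * sqrt s) * gauss (2 * s) z" if s: "0 < s" for s and z :: "real^'n"
  proof -
    have g: "0 \<le> gauss s z" "0 \<le> gauss (2 * s) z" using s by (auto intro: gauss_nonneg)
    have "\<bar>sym_delta j h k z / (4 * s\<^sup>2) - z $ j * z $ h * z $ k / (8 * s ^ 3)\<bar>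
       \<le> \<bar>sym_delta j h k z\<bar> / (4 * s\<^sup>2) + \<bar>z $ j * z $ h * z $ k\<bar> / (8 * s ^ 3)"
      using s by (intro order_trans[OF abs_triangle_ineq4]) (auto simp: abs_mult)
    also have "\<dots> \<le> 3 * norm z / (1 * s\<^sup>2) + norm z ^ 3 / (1 * s ^ 3)"
      using s by (intro add_mono frac_le sym_delta_le triple_component_le mult_right_mono) auto
    finally have "\<bar>gauss_deriv [j, h, k] s z\<bar> \<le> gauss s z * (3 * norm z / s\<^sup>2 + norm z ^ 3 / s ^ 3)"
      using g by (simp add: gauss_deriv_3[OF s] abs_mult mult_left_mono)
    also have "\<dots> = 3 * (norm z * gauss s z) / s\<^sup>2 + norm z ^ 3 * gauss s z / s ^ 3"
      by (simp add: algebra_simps)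
    also have "\<dots> \<le> 3 * (C1 * sqrt s * gauss (2 * s) z) / s\<^sup>2 + C3 * sqrt s ^ 3 * gauss (2 * s) z / s ^ 3"
      using C1(2)[OF s, of z] C3(2)[OF s, of z] s by (intro add_mono divide_right_mono mult_left_mono) auto
    also have "\<dots> = (3 * C1 + C3) / (s * sqrt s) * gauss (2 * s) z"
    proof -
      define q where "q = sqrt s"
      have q: "s = q * q" "q > 0" using s by (auto simp: q_def)
      show ?thesis unfolding q_def[symmetric] unfolding q(1) using q(2)
        by (simp add: field_simps power2_eq_square power3_eq_cube)
    qed
    finally show ?thesis .
  qed
  then show ?thesis using C1(1) C3(1) by (intro exI[of _ "3 * C1 + C3"]) auto
qed

section \<open>An integrable majorant of the kernel, with mass proportional to
  \<open>1 / sqrt t\<close>\<close>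

lemma integral_inverse_power_three_halves:
  fixes t :: real
  assumes "0 < t"
  shows "set_integrable lborel {t<..} (\<lambda>s. 1 / (s * sqrt s))"
    and "(LINT s:{t<..}|lborel. 1 / (s * sqrt s)) = 2 / sqrt t"
proof -
  have "((\<lambda>s. - 2 / sqrt s) \<longlongrightarrow> 0) at_top"
    by (intro tendsto_divide_0[OF tendsto_const] filterlim_at_top_imp_at_infinity sqrt_at_top)
  moreover have "((\<lambda>s. - 2 / sqrt s) \<longlongrightarrow> - 2 / sqrt t) (at_right t)"
    using assms by (intro tendsto_intros) auto
  moreover have "DERIV (\<lambda>s. - 2 / sqrt s) s :> 1 / (s * sqrt s)" if "t < s" for s
    using assms that by (auto intro!: derivative_eq_intros simp: field_simps power2_eq_square)
  moreover have "isCont (\<lambda>s. 1 / (s * sqrt s)) s" "0 \<le> 1 / (s * sqrt s)" if "t < s" for s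
    using assms that by (auto intro!: continuous_intros)
  ultimately show "set_integrable lborel {t<..} (\<lambda>s. 1 / (s * sqrt s))"
    "(LINT s:{t<..}|lborel. 1 / (s * sqrt s)) = 2 / sqrt t"
    using FTC_Ioi_nonneg[of t "\<lambda>s. - 2 / sqrt s" "\<lambda>s. 1 / (s * sqrt s)" "- 2 / sqrt t" 0]
    by simp_all
qed

lemma integral_inverse_sqrt:
  fixes t :: real
  assumes "0 < t"
  shows "set_integrable lborel {0<..<t} (\<lambda>s. 1 / sqrt s)"
    and "(LINT s:{0<..<t}|lborel. 1 / sqrt s) = 2 * sqrt t"
proof -
  have "((\<lambda>s. 2 * sqrt s) \<longlongrightarrow> 2 * sqrt 0) (at_right 0)"
    by (intro tendsto_intros)
  moreover have "((\<lambda>s. 2 * sqrt s) \<longlongrightarrow> 2 * sqrt t) (at_left t)"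
    by (intro tendsto_intros)
  moreover have "DERIV (\<lambda>s. 2 * sqrt s) s :> 1 / sqrt s" if "0 < s" for s
    using that by (auto intro!: derivative_eq_intros simp: field_simps)
  moreover have "isCont (\<lambda>s. 1 / sqrt s) s" if "0 < s" for s
    using that by (auto intro!: continuous_intros)
  ultimately show "set_integrable lborel {0<..<t} (\<lambda>s. 1 / sqrt s)"
    "(LINT s:{0<..<t}|lborel. 1 / sqrt s) = 2 * sqrt t"
    using FTC_Ioo_nonneg[of 0 t "\<lambda>s. 2 * sqrt s" "\<lambda>s. 1 / sqrt s" "2 * sqrt 0" "2 * sqrt t"] assms
    by simp_all
qed

text \<open>Collects the Gaussian bounds of the two terms of \<open>oseen_kernel\<close>. The first
  has mass \<open>1 / sqrt t\<close>, the second \<open>2 / sqrt t\<close>; this is the singularity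
  of the Duhamel integrand.\<close>

definition majorant :: "real \<Rightarrow> real^'n \<Rightarrow> real" where
  "majorant t z = gauss (2 * t) z / sqrt t + (LINT s:{t<..}|lborel. gauss (2 * s) z / (s * sqrt s))"

lemma set_integrable_majorant:
  fixes z :: "real^'n"
  assumes "0 < t" shows "set_integrable lborel {t<..} (\<lambda>s. gauss (2 * s) z / (s * sqrt s))"
proof -
  have "integrable lborel (\<lambda>s. 1 / sqrt t ^ CARD('n) * (indicator {t<..} s *\<^sub>R (1 / (s * sqrt s))))"
    using integral_inverse_power_three_halves(1)[OF assms] unfolding set_integrable_def by (rule integrable_mult_right)
  then show ?thesis
    unfolding set_integrable_def
  proof (rule Bochner_Integration.integrable_bound)
    show "AE s in lborel. norm (indicator {t<..} s *\<^sub>R (gauss (2 * s) z / (s * sqrt s)))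
        \<le> norm (1 / sqrt t ^ CARD('n) * (indicator {t<..} s *\<^sub>R (1 / (s * sqrt s))))"
    proof (intro AE_I2)
      fix s
      have "gauss (2 * s) z \<le> 1 / sqrt t ^ CARD('n)" if "t < s"
      proof -
        have "gauss (2 * s) z \<le> 1 / sqrt (2 * s) ^ CARD('n)" using that assms by (intro gauss_le) auto
        also have "\<dots> \<le> 1 / sqrt t ^ CARD('n)" using that assms by (intro divide_left_mono power_mono) auto
        finally show ?thesis .
      qed
      then show "norm (indicator {t<..} s *\<^sub>R (gauss (2 * s) z / (s * sqrt s)))
        \<le> norm (1 / sqrt t ^ CARD('n) * (indicator {t<..} s *\<^sub>R (1 / (s * sqrt s))))"
        using assms gauss_nonneg[of "2 * s" z] divide_right_mono[of "gauss (2 * s) z" "1 / sqrt t ^ CARD('n)" "s * sqrt s"]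
        by (auto simp: indicator_def abs_mult)
    qed
  qed measurable
qed

lemma majorant_nonneg: "0 < t \<Longrightarrow> 0 \<le> majorant t z"
  unfolding majorant_def set_lebesgue_integral_def
  by (intro add_nonneg_nonneg divide_nonneg_nonneg gauss_nonneg Bochner_Integration.integral_nonneg)
     (auto simp: indicator_def intro!: divide_nonneg_nonneg gauss_nonneg)

lemma integral_majorant:
  assumes t: "0 < t"
  shows "integrable lborel (majorant t :: real^'n \<Rightarrow> real)" "(LINT z|lborel. majorant t (z::real^'n)) = 3 / sqrt t"
proof -
  let ?F = "\<lambda>s (z::real^'n). indicator {t<..} s *\<^sub>R (gauss (2 * s) z / (s * sqrt s))"
  note I = integral_inverse_power_three_halves[OF t]
  have inner: "(LINT z|lborel. ?F s z) = indicator {t<..} s *\<^sub>R (1 / (s * sqrt s))"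
    and inti: "integrable lborel (?F s)" for s
    using integral_gauss[of "2 * s", where 'n='n] t by (auto simp: indicator_def)
  have nn: "norm (?F s z) = ?F s z" for s z
    using t gauss_nonneg[of "2 * s" z] by (auto simp: indicator_def)
  have int: "integrable (lborel \<Otimes>\<^sub>M lborel) (\<lambda>(s, z). ?F s z)"
  proof (rule lborel_pair.Fubini_integrable)
    show "(\<lambda>(s, z). ?F s z) \<in> borel_measurable (lborel \<Otimes>\<^sub>M lborel)" by measurable
    show "integrable lborel (\<lambda>s. LINT z|lborel. norm (case (s, z) of (s, z) \<Rightarrow> ?F s z))"
      unfolding prod.case nn inner using I(1) by (simp add: set_integrable_def)
    show "AE s in lborel. integrable lborel (\<lambda>z. case (s, z) of (s, z) \<Rightarrow> ?F s z)"
      using inti by simp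
  qed
  have i2: "integrable lborel (\<lambda>z::real^'n. LINT s:{t<..}|lborel. gauss (2 * s) z / (s * sqrt s))"
    using lborel_pair.integrable_snd[OF int] by (simp add: set_lebesgue_integral_def)
  have e2: "(LINT z|lborel. (LINT s:{t<..}|lborel. gauss (2 * s) (z::real^'n) / (s * sqrt s))) = 2 / sqrt t"
    using lborel_pair.Fubini_integral[OF int] unfolding inner I(2)[symmetric] by (simp add: set_lebesgue_integral_def)
  have i1: "integrable lborel (\<lambda>z::real^'n. gauss (2 * t) z / sqrt t)"
    using integral_gauss(1)[of "2 * t"] t by (intro integrable_divide) auto
  show "integrable lborel (majorant t :: real^'n \<Rightarrow> real)"
    unfolding majorant_def by (intro Bochner_Integration.integrable_add i1 i2)
  show "(LINT z|lborel. majorant t (z::real^'n)) = 3 / sqrt t"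
    unfolding majorant_def using integral_gauss(2)[of "2 * t", where 'n='n] t
    by (subst Bochner_Integration.integral_add[OF i1 i2]) (simp add: e2)
qed

lemma set_integrable_gauss_deriv_3:
  fixes z :: "real^'n"
  assumes t: "0 < t" shows "set_integrable lborel {t<..} (\<lambda>s. gauss_deriv [j, h, k] s z)"
proof -
  obtain C where C: "C > 0" "\<And>s z. s > 0 \<Longrightarrow> \<bar>gauss_deriv [j, h, k] s (z::real^'n)\<bar> \<le> C / (s * sqrt s) * gauss (2 * s) z"
    using gauss_deriv_3_bound[of j h k] by blast
  have "integrable lborel (\<lambda>s. C * (indicator {t<..} s *\<^sub>R (gauss (2 * s) z / (s * sqrt s))))"
    using set_integrable_majorant[OF t] unfolding set_integrable_def by (rule integrable_mult_right)
  then show ?thesis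
    unfolding set_integrable_def
  proof (rule Bochner_Integration.integrable_bound)
    have "(\<lambda>s. indicator {t<..} s *\<^sub>R gauss_deriv [j, h, k] s z)
      = (\<lambda>s. indicator {t<..} s *\<^sub>R (gauss s z * (sym_delta j h k z / (4 * s\<^sup>2) - z $ j * z $ h * z $ k / (8 * s ^ 3))))"
      using t by (auto simp: indicator_def gauss_deriv_3)
    also have "\<dots> \<in> borel_measurable lborel" by measurable
    finally show "(\<lambda>s. indicator {t<..} s *\<^sub>R gauss_deriv [j, h, k] s z) \<in> borel_measurable lborel" .
    show "AE s in lborel. norm (indicator {t<..} s *\<^sub>R gauss_deriv [j, h, k] s z)
        \<le> norm (C * (indicator {t<..} s *\<^sub>R (gauss (2 * s) z / (s * sqrt s))))"
    proof (intro AE_I2)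
      fix s
      show "norm (indicator {t<..} s *\<^sub>R gauss_deriv [j, h, k] s z)
        \<le> norm (C * (indicator {t<..} s *\<^sub>R (gauss (2 * s) z / (s * sqrt s))))"
      proof (cases "t < s")
        case True
        then have "\<bar>gauss_deriv [j, h, k] s z\<bar> \<le> C * (gauss (2 * s) z / (s * sqrt s))" using C(2)[of s z] t by simp
        then have "\<bar>gauss_deriv [j, h, k] s z\<bar> \<le> \<bar>C * (gauss (2 * s) z / (s * sqrt s))\<bar>" by linarith
        then show ?thesis using True by simp
      qed simp
    qed
  qed
qed

lemma oseen_kernel_bound:
  "\<exists>C>0. \<forall>t>0. \<forall>z::real^'n. \<bar>oseen_kernel j h k t z\<bar> \<le> C * majorant t z"
proof -
  obtain C1 where C1: "C1 > 0" "\<And>s z. s > 0 \<Longrightarrow> \<bar>gauss_deriv [h] s (z::real^'n)\<bar> \<le> C1 / sqrt s * gauss (2 * s) z"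
    using gauss_deriv_1_bound[of h] by blast
  obtain C where C: "C > 0" "\<And>s z. s > 0 \<Longrightarrow> \<bar>gauss_deriv [j, h, k] s (z::real^'n)\<bar> \<le> C / (s * sqrt s) * gauss (2 * s) z"
    using gauss_deriv_3_bound[of j h k] by blast
  have "\<bar>oseen_kernel j h k t z\<bar> \<le> (C1 + C) * majorant t z" if t: "0 < t" for t and z :: "real^'n"
  proof -
    have g: "0 \<le> gauss (2 * t) z / sqrt t" using t by (intro divide_nonneg_nonneg gauss_nonneg) auto
    have I: "0 \<le> (LINT s:{t<..}|lborel. gauss (2 * s) z / (s * sqrt s))"
      unfolding set_lebesgue_integral_def using t
      by (intro Bochner_Integration.integral_nonneg) (auto simp: indicator_def intro!: divide_nonneg_nonneg gauss_nonneg)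
    have "\<bar>delta j k * gauss_deriv [h] t z\<bar> \<le> C1 * (gauss (2 * t) z / sqrt t)"
      using C1(2)[OF t, of z] C1(1) g by (auto simp: delta_def)
    moreover have "\<bar>LINT s:{t<..}|lborel. gauss_deriv [j, h, k] s z\<bar> \<le> C * (LINT s:{t<..}|lborel. gauss (2 * s) z / (s * sqrt s))"
    proof -
      have "\<bar>LINT s:{t<..}|lborel. gauss_deriv [j, h, k] s z\<bar> \<le> (LINT s:{t<..}|lborel. C * (gauss (2 * s) z / (s * sqrt s)))"
        unfolding set_lebesgue_integral_def real_norm_def[symmetric]
      proof (rule Bochner_Integration.integral_norm_bound_integral)
        show "integrable lborel (\<lambda>s. indicator {t<..} s *\<^sub>R gauss_deriv [j, h, k] s z)"
          using set_integrable_gauss_deriv_3[OF t] by (simp add: set_integrable_def)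
        show "integrable lborel (\<lambda>s. indicator {t<..} s *\<^sub>R (C * (gauss (2 * s) z / (s * sqrt s))))"
          using integrable_mult_right[OF set_integrable_majorant[OF t, unfolded set_integrable_def], of C] by (simp add: mult_ac)
        show "norm (indicator {t<..} s *\<^sub>R gauss_deriv [j, h, k] s z) \<le> indicator {t<..} s *\<^sub>R (C * (gauss (2 * s) z / (s * sqrt s)))" for s
          using C(2)[of s z] t by (auto simp: indicator_def)
      qed
      then show ?thesis by (simp only: set_integral_mult_right)
    qed
    ultimately have "\<bar>oseen_kernel j h k t z\<bar> \<le> C1 * (gauss (2 * t) z / sqrt t) + C * (LINT s:{t<..}|lborel. gauss (2 * s) z / (s * sqrt s))"
      unfolding oseen_kernel_def by linarith
    also have "\<dots> \<le> (C1 + C) * (gauss (2 * t) z / sqrt t) + (C1 + C) * (LINT s:{t<..}|lborel. gauss (2 * s) z / (s * sqrt s))"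
      using C1(1) C(1) g I by (intro add_mono mult_right_mono) auto
    finally show ?thesis by (simp add: majorant_def distrib_left)
  qed
  then show ?thesis using C1(1) C(1) by (intro exI[of _ "C1 + C"]) auto
qed

text \<open>The decay rate of the solution, written with a natural exponent; its square is the decay
  rate of u \<otimes> u.\<close>

definition weight :: "real^'n \<Rightarrow> real" where
  "weight y = 1 / (1 + norm y) ^ (CARD('n) + 1)"

lemma borel_measurable_weight [measurable]: "weight \<in> borel_measurable borel"
  unfolding weight_def[abs_def] by measurable

lemma weight_bounds: "0 < weight y" "weight y \<le> 1"
proof -
  have "0 < 1 + norm y" using norm_ge_zero[of y] by linarith
  then show "0 < weight y" "weight y \<le> 1" unfolding weight_def by (auto intro: one_le_power simp del: power_Suc simp: divide_le_eq_1)
qed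

text \<open>The majorant decays no faster than the weight, so its integrability passes to the weight.\<close>

lemma integrable_weight: "integrable lborel (weight :: real^'n \<Rightarrow> real)"
proof -
  define c :: real where "c = exp (- 1 / 8) / sqrt (16 * pi) ^ CARD('n) / (2 * sqrt 2)"
  have c: "c > 0" by (simp add: c_def)
  have le: "c * weight y \<le> majorant 1 y" for y :: "real^'n"
  proof -
    define R where "R = 1 + norm y"
    have R: "R \<ge> 1" by (simp add: R_def)
    \<comment> \<open>On this window of times the integrand is at least of order R to the power - (d
      + 3), and the window has length \<open>R\<^sup>2\<close>, which leaves the power - (d + 1).
      The constant \<open>c\<close> collects the worst cases:
      \<open>(norm y)\<^sup>2 \<le> s\<close> in the exponential and
      \<open>s \<le> 2 * R\<^sup>2\<close> in the denominators.\<close>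
    have lower: "c * (1 / R ^ (CARD('n) + 3)) \<le> gauss (2 * s) y / (s * sqrt s)" if s: "R\<^sup>2 \<le> s" "s \<le> 2 * R\<^sup>2" for s
    proof -
      have s0: "s > 0" using R s by (meson less_le_trans zero_less_power zero_less_one)
      have "(norm y)\<^sup>2 \<le> R\<^sup>2" by (simp add: R_def power_mono)
      then have "exp (- 1 / 8) \<le> exp (- (norm y)\<^sup>2 / (4 * (2 * s)))" using s s0 by (simp add: field_simps)
      moreover have "sqrt (4 * pi * (2 * s)) ^ CARD('n) \<le> sqrt (16 * pi) ^ CARD('n) * R ^ CARD('n)"
      proof -
        have "sqrt (4 * pi * (2 * s)) \<le> sqrt (16 * pi * R\<^sup>2)" using s by (intro real_sqrt_le_mono) simp
        also have "\<dots> = sqrt (16 * pi) * R" using R by (simp add: real_sqrt_mult)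
        finally show ?thesis using s0 by (simp only: power_mult_distrib[symmetric]) (intro power_mono, auto)
      qed
      ultimately have g: "exp (- 1 / 8) / (sqrt (16 * pi) ^ CARD('n) * R ^ CARD('n)) \<le> gauss (2 * s) y"
        unfolding gauss_def using s0 R by (intro frac_le) auto
      have "sqrt s \<le> sqrt (2 * R\<^sup>2)" using s by (intro real_sqrt_le_mono)
      then have "s * sqrt s \<le> (2 * R\<^sup>2) * (sqrt 2 * R)" using s s0 R by (intro mult_mono) (auto simp: real_sqrt_mult)
      then have "exp (- 1 / 8) / (sqrt (16 * pi) ^ CARD('n) * R ^ CARD('n)) / ((2 * R\<^sup>2) * (sqrt 2 * R)) \<le> gauss (2 * s) y / (s * sqrt s)"
        using s0 R by (intro frac_le g) (auto intro!: gauss_nonneg)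
      moreover have "exp (- 1 / 8) / (sqrt (16 * pi) ^ CARD('n) * R ^ CARD('n)) / ((2 * R\<^sup>2) * (sqrt 2 * R)) = c * (1 / R ^ (CARD('n) + 3))"
        by (simp add: c_def power_add power2_eq_square power3_eq_cube mult_ac)
      ultimately show ?thesis by simp
    qed
    have "c * weight y = c * (1 / R ^ (CARD('n) + 3)) * R\<^sup>2"
      using R by (simp add: weight_def R_def[symmetric] power_add power2_eq_square power3_eq_cube)
    also have "\<dots> = (LINT s|lborel. indicator {R\<^sup>2<..2 * R\<^sup>2} s *\<^sub>R (c * (1 / R ^ (CARD('n) + 3))))"
      by simp
    also have "\<dots> \<le> (LINT s|lborel. indicator {1<..} s *\<^sub>R (gauss (2 * s) y / (s * sqrt s)))"
    proof (rule integral_mono)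
      show "integrable lborel (\<lambda>s. indicator {1<..} s *\<^sub>R (gauss (2 * s) y / (s * sqrt s)))"
        using set_integrable_majorant[of 1 y] by (simp add: set_integrable_def)
      have "1 \<le> R\<^sup>2" using R by simp
      then show "indicator {R\<^sup>2<..2 * R\<^sup>2} s *\<^sub>R (c * (1 / R ^ (CARD('n) + 3))) \<le> indicator {1<..} s *\<^sub>R (gauss (2 * s) y / (s * sqrt s))" for s
        using lower[of s] by (auto simp: indicator_def gauss_nonneg)
    qed simp
    also have "\<dots> \<le> majorant 1 y"
      unfolding majorant_def set_lebesgue_integral_def using gauss_nonneg[of 2 y] by simp
    finally show ?thesis .
  qed
  have "integrable lborel (\<lambda>y::real^'n. majorant 1 y / c)"
    by (intro integrable_divide integral_majorant) simp
  then show ?thesis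
  proof (rule Bochner_Integration.integrable_bound)
    show "AE y::real^'n in lborel. norm (weight y) \<le> norm (majorant 1 y / c)"
    proof (intro AE_I2)
      fix y :: "real^'n"
      have "weight y \<le> majorant 1 y / c" using le[of y] c by (simp add: field_simps)
      then show "norm (weight y) \<le> norm (majorant 1 y / c)"
        using weight_bounds(1)[of y] unfolding real_norm_def by linarith
    qed
  qed simp
qed

subsection \<open>The homogeneous profile\<close>

text \<open>Its value is 4^(p - 1) \<Gamma>(d/2 + p - 1) / \<pi>^(d/2) for \<open>p \<ge> 2\<close>;
  the argument uses its positivity.\<close>

definition profile_const :: "nat \<Rightarrow> nat \<Rightarrow> real" where
  "profile_const d p = (LINT r:{0<..}|lborel. exp (- 1 / (4 * r)) / sqrt (4 * pi * r) ^ d / r ^ p)"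

text \<open>Away from the origin, these are the third derivatives of the fundamental solution of
  minus the Laplacian, in a form that exhibits the cubic numerator.\<close>

definition profile :: "'n \<Rightarrow> 'n \<Rightarrow> 'n \<Rightarrow> real^'n \<Rightarrow> real" where
  "profile j h k z = profile_const CARD('n) 2 / 4 * sym_delta j h k z / norm z ^ (CARD('n) + 2)
     - profile_const CARD('n) 3 / 8 * (z $ j * z $ h * z $ k) / norm z ^ (CARD('n) + 4)"

lemma set_integrable_profile_const:
  assumes p: "2 \<le> p"
  shows "set_integrable lborel {0<..} (\<lambda>r. exp (- 1 / (4 * r)) / sqrt (4 * pi * r) ^ d / r ^ p)"
proof -
  let ?f = "\<lambda>r::real. exp (- 1 / (4 * r)) / sqrt (4 * pi * r) ^ d / r ^ p"
  obtain C where C: "C > 0" "\<And>v::real. v \<ge> 0 \<Longrightarrow> v ^ (d + 2 * p) * exp (- (1/4) * v\<^sup>2) \<le> C"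
    using power_exp_neg_square_bounded[of "1/4" "d + 2 * p"] by auto
  have pi4: "1 \<le> 4 * pi" using pi_ge_two by simp
  have nn: "0 \<le> ?f r" if "0 < r" for r using that by auto
  \<comment> \<open>With \<open>v = 1 / sqrt r\<close> the negative powers of \<open>r\<close>
    become a power of \<open>v\<close> against a Gaussian in \<open>v\<close>.\<close>
  have small: "?f r \<le> C" if r: "0 < r" for r
  proof -
    define v where "v = 1 / sqrt r"
    have v: "v > 0" "1 / r = v\<^sup>2" using r by (auto simp: v_def power_divide)
    have "sqrt r ^ d \<le> sqrt (4 * pi * r) ^ d"
      using r pi4 by (intro power_mono real_sqrt_le_mono) (auto simp: mult_le_cancel_right1)
    then have "?f r \<le> exp (- 1 / (4 * r)) / sqrt r ^ d / r ^ p"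
      using r by (intro divide_right_mono divide_left_mono) auto
    also have "\<dots> = exp (- (1/4) * (1 / r)) * v ^ d * (1 / r) ^ p"
      by (simp add: v_def power_divide)
    also have "\<dots> = v ^ (d + 2 * p) * exp (- (1/4) * v\<^sup>2)"
      unfolding v(2) power_add power_mult by simp
    also have "\<dots> \<le> C" using v(1) by (intro C(2)) auto
    finally show ?thesis .
  qed
  \<comment> \<open>At infinity \<open>p \<ge> 2\<close> beats the integrable exponent 3/2.\<close>
  have large: "?f r \<le> 1 / (r * sqrt r)" if r: "1 < r" for r
  proof -
    have "1 \<le> 4 * pi * r" using pi4 r mult_mono[of 1 "4 * pi" 1 r] by simp
    then have "1 \<le> sqrt (4 * pi * r) ^ d" by (intro one_le_power) auto
    moreover have "r * sqrt r \<le> r ^ p"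
    proof -
      have "sqrt r \<le> r" using r real_sqrt_le_mono[of r "r * r"] by (simp add: mult_le_cancel_left1)
      then have "r * sqrt r \<le> r ^ 2" using r by (simp add: power2_eq_square)
      also have "\<dots> \<le> r ^ p" using r p by (intro power_increasing) auto
      finally show ?thesis .
    qed
    moreover have "exp (- 1 / (4 * r)) \<le> 1" using r by simp
    ultimately have "?f r \<le> 1 / 1 / (r * sqrt r)" using r by (intro frac_le) auto
    then show ?thesis by simp
  qed
  have "set_integrable lborel {0<..1} ?f"
    unfolding set_integrable_def
  proof (rule Bochner_Integration.integrable_bound)
    show "integrable lborel (\<lambda>r::real. C * indicator {0<..1} r)" by simp
    show "AE r in lborel. norm (indicator {0<..1} r *\<^sub>R ?f r) \<le> norm (C * indicator {0<..1} r)"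
      using small nn C(1) by (intro AE_I2) (auto simp: indicator_def)
  qed measurable
  moreover have "set_integrable lborel {1<..} ?f"
    unfolding set_integrable_def
  proof (rule Bochner_Integration.integrable_bound)
    show "integrable lborel (\<lambda>s::real. indicator {1<..} s *\<^sub>R (1 / (s * sqrt s)))"
      using integral_inverse_power_three_halves(1)[of 1] by (simp add: set_integrable_def)
    show "AE r in lborel. norm (indicator {1<..} r *\<^sub>R ?f r) \<le> norm (indicator {1<..} r *\<^sub>R (1 / (r * sqrt r)))"
    proof (intro AE_I2)
      fix r :: real
      show "norm (indicator {1<..} r *\<^sub>R ?f r) \<le> norm (indicator {1<..} r *\<^sub>R (1 / (r * sqrt r)))"
        using large[of r] nn[of r] by (cases "1 < r") auto
    qed
  qed measurable
  ultimately have "set_integrable lborel ({0<..1} \<union> {1<..}) ?f" by (rule set_integrable_Un) auto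
  moreover have "{0<..1} \<union> {1<..} = {0::real<..}" by auto
  ultimately show ?thesis by simp
qed

lemma profile_const_pos:
  assumes p: "2 \<le> p" shows "0 < profile_const d p"
proof -
  let ?f = "\<lambda>r::real. exp (- 1 / (4 * r)) / sqrt (4 * pi * r) ^ d / r ^ p"
  define c where "c = exp (- 1 / 4) / sqrt (4 * pi * 2) ^ d / 2 ^ p"
  have "c > 0" by (simp add: c_def)
  also have "c = (LINT r|lborel. indicator {1<..<2::real} r *\<^sub>R c)" by simp
  also have "\<dots> \<le> (LINT r|lborel. indicator {0<..} r *\<^sub>R ?f r)"
  proof (rule integral_mono)
    show "integrable lborel (\<lambda>r. indicator {0<..} r *\<^sub>R ?f r)"
      using set_integrable_profile_const[OF p] by (simp add: set_integrable_def)
    have le: "c \<le> ?f r" if "1 < r" "r < 2" for r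
    proof -
      have "exp (- 1 / 4) \<le> exp (- 1 / (4 * r))" using that by simp
      then show ?thesis unfolding c_def using that by (intro frac_le power_mono real_sqrt_le_mono) auto
    qed
    show "indicator {1<..<2} r *\<^sub>R c \<le> indicator {0<..} r *\<^sub>R ?f r" for r
      using le[of r] by (auto simp: indicator_def)
  qed simp
  finally show ?thesis by (simp add: profile_const_def set_lebesgue_integral_def)
qed

text \<open>The substitution \<open>s = |z|^2 r\<close> turns the integral over all times into a homogeneous function.\<close>

lemma
  fixes z :: "real^'n"
  assumes z: "z \<noteq> 0"
  shows set_integrable_gauss_deriv_3': "set_integrable lborel {0<..} (\<lambda>s. gauss_deriv [j, h, k] s z)"
    and integral_gauss_deriv_3: "(LINT s:{0<..}|lborel. gauss_deriv [j, h, k] s z) = profile j h k z"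
proof -
  define R where "R = norm z"
  have R: "R > 0" using z by (simp add: R_def)
  let ?w = "\<lambda>p r::real. indicator {0<..} r *\<^sub>R (exp (- 1 / (4 * r)) / sqrt (4 * pi * r) ^ CARD('n) / r ^ p)"
  let ?f = "\<lambda>s. indicator {0<..} s *\<^sub>R gauss_deriv [j, h, k] s z"
  define A B where "A = sym_delta j h k z / (4 * R ^ (CARD('n) + 4))"
    and "B = z $ j * z $ h * z $ k / (8 * R ^ (CARD('n) + 6))"
  have scale: "?f (0 + R\<^sup>2 * r) = A * ?w 2 r - B * ?w 3 r" for r
  proof (cases "0 < r")
    case True
    have e: "- (norm z)\<^sup>2 / (4 * (R\<^sup>2 * r)) = - 1 / (4 * r)"
      using R True by (simp add: R_def[symmetric])
    have q: "sqrt (4 * pi * (R\<^sup>2 * r)) = R * sqrt (4 * pi * r)"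
      using R by (simp add: real_sqrt_mult)
    have "gauss (R\<^sup>2 * r) z = exp (- 1 / (4 * r)) / sqrt (4 * pi * r) ^ CARD('n) / R ^ CARD('n)"
      unfolding gauss_def e q power_mult_distrib by simp
    then have "gauss_deriv [j, h, k] (R\<^sup>2 * r) z = exp (- 1 / (4 * r)) / sqrt (4 * pi * r) ^ CARD('n) / R ^ CARD('n) *
        (sym_delta j h k z / (4 * (R\<^sup>2 * r)\<^sup>2) - z $ j * z $ h * z $ k / (8 * (R\<^sup>2 * r) ^ 3))"
      using R True by (simp add: gauss_deriv_3)
    also have "\<dots> = A * (exp (- 1 / (4 * r)) / sqrt (4 * pi * r) ^ CARD('n) / r ^ 2)
         - B * (exp (- 1 / (4 * r)) / sqrt (4 * pi * r) ^ CARD('n) / r ^ 3)"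
    proof -
      have "(R\<^sup>2 * r)\<^sup>2 = R ^ 4 * r ^ 2" "(R\<^sup>2 * r) ^ 3 = R ^ 6 * r ^ 3"
        by (simp_all add: power_mult_distrib flip: power_mult)
      then show ?thesis by (simp add: A_def B_def power_add right_diff_distrib mult_ac)
    qed
    finally show ?thesis using True R by simp
  qed (use R in \<open>auto simp: zero_less_mult_iff\<close>)
  have w: "integrable lborel (?w p)" if "2 \<le> p" for p
    using set_integrable_profile_const[OF that] by (simp add: set_integrable_def)
  have i: "integrable lborel (\<lambda>r. A * ?w 2 r)" "integrable lborel (\<lambda>r. B * ?w 3 r)"
    by (intro integrable_mult_right w; simp)+
  have "integrable lborel (\<lambda>r. ?f (0 + R\<^sup>2 * r))"
    unfolding scale by (intro Bochner_Integration.integrable_diff i)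
  then show "set_integrable lborel {0<..} (\<lambda>s. gauss_deriv [j, h, k] s z)"
    using R by (subst (asm) lborel_integrable_real_affine_iff) (auto simp: set_integrable_def)
  have "(LINT s|lborel. ?f s) = R\<^sup>2 * (LINT r|lborel. ?f (0 + R\<^sup>2 * r))"
    using R by (subst lborel_integral_real_affine[of "R\<^sup>2" _ 0]) auto
  also have "(LINT r|lborel. ?f (0 + R\<^sup>2 * r)) = A * profile_const CARD('n) 2 - B * profile_const CARD('n) 3"
    unfolding scale Bochner_Integration.integral_diff[OF i] integral_mult_right_zero
    by (simp only: profile_const_def set_lebesgue_integral_def)
  also have "R\<^sup>2 * (A * profile_const CARD('n) 2 - B * profile_const CARD('n) 3) = profile j h k z"
  proof -
    have "R\<^sup>2 * A = sym_delta j h k z / (4 * R ^ (CARD('n) + 2))"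
      "R\<^sup>2 * B = z $ j * z $ h * z $ k / (8 * R ^ (CARD('n) + 4))"
      using R by (simp_all add: A_def B_def power_add eval_nat_numeral)
    then show ?thesis
      by (simp add: profile_def R_def[symmetric] right_diff_distrib mult.assoc[symmetric]) (simp add: mult_ac)
  qed
  finally show "(LINT s:{0<..}|lborel. gauss_deriv [j, h, k] s z) = profile j h k z"
    by (simp add: set_lebesgue_integral_def)
qed

text \<open>The difference consists of the first-derivative term and the time integral over
  \<open>0 < s \<le> t\<close>. Away from the origin \<open>gauss_decay\<close> gains a factor
  \<open>s\<close> in both: the first becomes \<open>t / sqrt t\<close>, the second an integral of
  \<open>1 / sqrt s\<close>.\<close>

lemma oseen_kernel_profile:
  "\<exists>C>0. \<forall>t>0. \<forall>z::real^'n. z \<noteq> 0 \<longrightarrow> \<bar>oseen_kernel j h k t z - profile j h k z\<bar> \<le> C * sqrt t / norm z ^ (CARD('n) + 2)"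
proof -
  obtain C1 where C1: "C1 > 0" "\<And>s z. s > 0 \<Longrightarrow> \<bar>gauss_deriv [h] s (z::real^'n)\<bar> \<le> C1 / sqrt s * gauss (2 * s) z"
    using gauss_deriv_1_bound[of h] by blast
  obtain C where C: "C > 0" "\<And>s z. s > 0 \<Longrightarrow> \<bar>gauss_deriv [j, h, k] s (z::real^'n)\<bar> \<le> C / (s * sqrt s) * gauss (2 * s) z"
    using gauss_deriv_3_bound[of j h k] by blast
  obtain D where D: "D > 0" "\<And>s z. s > 0 \<Longrightarrow> norm (z::real^'n) ^ (CARD('n) + 2) * gauss s z \<le> D * s"
    using gauss_decay[where 'n='n] by blast
  have "\<bar>oseen_kernel j h k t z - profile j h k z\<bar> \<le> (2 * C1 * D + 8 * C * D) * sqrt t / norm z ^ (CARD('n) + 2)"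
    if t: "0 < t" and z: "z \<noteq> 0" for t and z :: "real^'n"
  proof -
    define N where "N = norm z ^ (CARD('n) + 2)"
    have N: "N > 0" using z by (simp add: N_def)
    have g: "gauss (2 * s) z \<le> D * (2 * s) / N" if "0 < s" for s
      using D(2)[of "2 * s" z, folded N_def] that N by (intro mult_imp_le_div_pos) (auto simp only: mult.commute[of _ N] mult_pos_pos zero_less_numeral)
    have "\<bar>delta j k * gauss_deriv [h] t z\<bar> \<le> C1 / sqrt t * gauss (2 * t) z"
      using C1(1) C1(2)[OF t, of z] t gauss_nonneg[of "2 * t" z] by (auto simp: delta_def)
    also have "\<dots> \<le> C1 / sqrt t * (D * (2 * t) / N)"
      using C1(1) t by (intro mult_left_mono g) auto
    also have "\<dots> = 2 * C1 * D * (t / sqrt t) / N"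
      by simp
    also have "t / sqrt t = sqrt t" using t by (simp add: real_div_sqrt)
    finally have d1: "\<bar>delta j k * gauss_deriv [h] t z\<bar> \<le> 2 * C1 * D * sqrt t / N" .
    have d3: "\<bar>gauss_deriv [j, h, k] s z\<bar> \<le> 2 * C * D / N * (1 / sqrt s)" if s: "0 < s" for s
    proof -
      have "\<bar>gauss_deriv [j, h, k] s z\<bar> \<le> C / (s * sqrt s) * (D * (2 * s) / N)"
        using C(1) s by (intro order_trans[OF C(2)[OF s]] mult_left_mono g) auto
      then show ?thesis using s by (simp add: field_simps)
    qed
    \<comment> \<open>The open interval up to \<open>2 * t\<close> contains the endpoint
      \<open>t\<close>, so the bound holds for every \<open>s\<close>; the price is a constant
      factor.\<close>
    have "\<bar>LINT s:{0<..t}|lborel. gauss_deriv [j, h, k] s z\<bar>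
        \<le> (LINT s|lborel. 2 * C * D / N * (indicator {0<..<2 * t} s *\<^sub>R (1 / sqrt s)))"
      unfolding set_lebesgue_integral_def real_norm_def[symmetric]
    proof (rule Bochner_Integration.integral_norm_bound_integral)
      show "integrable lborel (\<lambda>s. indicator {0<..t} s *\<^sub>R gauss_deriv [j, h, k] s z)"
        using set_integrable_subset[OF set_integrable_gauss_deriv_3'[OF z, of j h k], of "{0<..t}"]
        by (simp add: set_integrable_def subset_iff)
      show "integrable lborel (\<lambda>s. 2 * C * D / N * (indicator {0<..<2 * t} s *\<^sub>R (1 / sqrt s)))"
        using integral_inverse_sqrt(1)[of "2 * t"] t unfolding set_integrable_def by (intro integrable_mult_right) auto
      show "norm (indicator {0<..t} s *\<^sub>R gauss_deriv [j, h, k] s z) \<le> 2 * C * D / N * (indicator {0<..<2 * t} s *\<^sub>R (1 / sqrt s))" for s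
        using d3[of s] C(1) D(1) N t by (auto simp: indicator_def)
    qed
    also have "\<dots> = 2 * C * D / N * (2 * sqrt (2 * t))"
      unfolding integral_mult_right_zero set_lebesgue_integral_def[symmetric]
      using integral_inverse_sqrt(2)[of "2 * t"] t by simp
    also have "\<dots> \<le> 2 * C * D / N * (2 * (2 * sqrt t))"
    proof -
      have "sqrt (2 * t) \<le> sqrt (4 * t)" using t by (intro real_sqrt_le_mono) auto
      also have "\<dots> = 2 * sqrt t" by (simp add: real_sqrt_mult)
      finally show ?thesis using C(1) D(1) N by (intro mult_left_mono) auto
    qed
    finally have small: "\<bar>LINT s:{0<..t}|lborel. gauss_deriv [j, h, k] s z\<bar> \<le> 8 * C * D * sqrt t / N"
      by (simp add: mult_ac)
    have "profile j h k z = (LINT s:{0<..t} \<union> {t<..}|lborel. gauss_deriv [j, h, k] s z)"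
    proof -
      have "{0<..t} \<union> {t<..} = {0<..}" using t by auto
      then show ?thesis by (simp add: integral_gauss_deriv_3[OF z])
    qed
    also have "\<dots> = (LINT s:{0<..t}|lborel. gauss_deriv [j, h, k] s z) + (LINT s:{t<..}|lborel. gauss_deriv [j, h, k] s z)"
      using set_integrable_subset[OF set_integrable_gauss_deriv_3'[OF z, of j h k], of "{0<..t}"] set_integrable_gauss_deriv_3[OF t, of j h k z]
      by (intro set_integral_Un) (auto simp: subset_iff)
    finally have "oseen_kernel j h k t z - profile j h k z
        = delta j k * gauss_deriv [h] t z - (LINT s:{0<..t}|lborel. gauss_deriv [j, h, k] s z)"
      by (simp add: oseen_kernel_def)
    then have "\<bar>oseen_kernel j h k t z - profile j h k z\<bar> \<le> 2 * C1 * D * sqrt t / N + 8 * C * D * sqrt t / N"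
      using d1 small by linarith
    then show ?thesis unfolding N_def[symmetric] distrib_right add_divide_distrib .
  qed
  then show ?thesis using C(1) C1(1) D(1)
    by (intro exI[of _ "2 * C1 * D + 8 * C * D"]) (auto intro!: add_pos_pos)
qed

text \<open>Functions with the size and the increments of a smooth homogeneous function of degree \<open>\<alpha>\<close>.\<close>

definition hom_lipschitz :: "int \<Rightarrow> ('a::real_normed_vector \<Rightarrow> real) \<Rightarrow> bool" where
  "hom_lipschitz \<alpha> f \<longleftrightarrow> (\<exists>C\<ge>0. \<forall>x y. x \<noteq> 0 \<and> norm y \<le> norm x / 2 \<longrightarrow>
     \<bar>f x\<bar> \<le> C * norm x powi \<alpha> \<and> \<bar>f (x - y)\<bar> \<le> C * norm x powi \<alpha> \<and>
     \<bar>f (x - y) - f x\<bar> \<le> C * norm y * norm x powi (\<alpha> - 1))"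

lemma hom_lipschitz_const: "hom_lipschitz 0 (\<lambda>_. c)"
  unfolding hom_lipschitz_def by (intro exI[of _ "\<bar>c\<bar>"]) auto

lemma hom_lipschitz_add:
  assumes "hom_lipschitz \<alpha> f" "hom_lipschitz \<alpha> g"
  shows "hom_lipschitz \<alpha> (\<lambda>x. f x + g x)"
proof -
  obtain C where C: "C \<ge> 0" "\<And>x y. x \<noteq> 0 \<Longrightarrow> norm y \<le> norm x / 2 \<Longrightarrow>
     \<bar>f x\<bar> \<le> C * norm x powi \<alpha> \<and> \<bar>f (x - y)\<bar> \<le> C * norm x powi \<alpha> \<and>
     \<bar>f (x - y) - f x\<bar> \<le> C * norm y * norm x powi (\<alpha> - 1)"
    using assms(1) unfolding hom_lipschitz_def by blast
  obtain D where D: "D \<ge> 0" "\<And>x y. x \<noteq> 0 \<Longrightarrow> norm y \<le> norm x / 2 \<Longrightarrow>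
     \<bar>g x\<bar> \<le> D * norm x powi \<alpha> \<and> \<bar>g (x - y)\<bar> \<le> D * norm x powi \<alpha> \<and>
     \<bar>g (x - y) - g x\<bar> \<le> D * norm y * norm x powi (\<alpha> - 1)"
    using assms(2) unfolding hom_lipschitz_def by blast
  show ?thesis
    unfolding hom_lipschitz_def
  proof (intro exI[of _ "C + D"] conjI allI impI)
    fix x y :: 'a assume xy: "x \<noteq> 0 \<and> norm y \<le> norm x / 2"
    with C(2)[of x y] D(2)[of x y]
    show "\<bar>f x + g x\<bar> \<le> (C + D) * norm x powi \<alpha>" "\<bar>f (x - y) + g (x - y)\<bar> \<le> (C + D) * norm x powi \<alpha>"
      "\<bar>f (x - y) + g (x - y) - (f x + g x)\<bar> \<le> (C + D) * norm y * norm x powi (\<alpha> - 1)"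
      unfolding distrib_right by linarith+
  qed (use C(1) D(1) in auto)
qed

text \<open>A product rule for increments: each of its two terms costs \<open>C * D\<close>, hence
  the factor 2. Closure under sums, products and powers replaces the differentiation of the
  profile.\<close>

lemma hom_lipschitz_mult:
  assumes "hom_lipschitz \<alpha> f" "hom_lipschitz \<beta> g"
  shows "hom_lipschitz (\<alpha> + \<beta>) (\<lambda>x. f x * g x)"
proof -
  obtain C where C: "C \<ge> 0" "\<And>x y. x \<noteq> 0 \<Longrightarrow> norm y \<le> norm x / 2 \<Longrightarrow>
     \<bar>f x\<bar> \<le> C * norm x powi \<alpha> \<and> \<bar>f (x - y)\<bar> \<le> C * norm x powi \<alpha> \<and>
     \<bar>f (x - y) - f x\<bar> \<le> C * norm y * norm x powi (\<alpha> - 1)"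
    using assms(1) unfolding hom_lipschitz_def by blast
  obtain D where D: "D \<ge> 0" "\<And>x y. x \<noteq> 0 \<Longrightarrow> norm y \<le> norm x / 2 \<Longrightarrow>
     \<bar>g x\<bar> \<le> D * norm x powi \<beta> \<and> \<bar>g (x - y)\<bar> \<le> D * norm x powi \<beta> \<and>
     \<bar>g (x - y) - g x\<bar> \<le> D * norm y * norm x powi (\<beta> - 1)"
    using assms(2) unfolding hom_lipschitz_def by blast
  show ?thesis
    unfolding hom_lipschitz_def
  proof (intro exI[of _ "2 * (C * D)"] conjI allI impI)
    fix x y :: 'a assume xy: "x \<noteq> 0 \<and> norm y \<le> norm x / 2"
    define r where "r = norm x"
    have r: "r > 0" using xy by (simp add: r_def)
    have F: "\<bar>f x\<bar> \<le> C * r powi \<alpha>" "\<bar>f (x - y)\<bar> \<le> C * r powi \<alpha>" "\<bar>f (x - y) - f x\<bar> \<le> C * norm y * r powi (\<alpha> - 1)"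
      and G: "\<bar>g x\<bar> \<le> D * r powi \<beta>" "\<bar>g (x - y)\<bar> \<le> D * r powi \<beta>" "\<bar>g (x - y) - g x\<bar> \<le> D * norm y * r powi (\<beta> - 1)"
      using C(2)[of x y] D(2)[of x y] xy by (auto simp: r_def)
    have p: "r powi (\<alpha> + \<beta>) = r powi \<alpha> * r powi \<beta>" "r powi (\<alpha> + \<beta> - 1) = r powi \<alpha> * r powi (\<beta> - 1)"
      "r powi (\<alpha> + \<beta> - 1) = r powi (\<alpha> - 1) * r powi \<beta>"
      using r by (auto simp: power_int_add[symmetric] algebra_simps)
    have pos: "0 \<le> r powi n" for n using r by simp
    have bd: "\<bar>f u * g v\<bar> \<le> 2 * (C * D) * r powi (\<alpha> + \<beta>)"
      if "\<bar>f u\<bar> \<le> C * r powi \<alpha>" "\<bar>g v\<bar> \<le> D * r powi \<beta>" for u v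
    proof -
      have "\<bar>f u * g v\<bar> \<le> (C * r powi \<alpha>) * (D * r powi \<beta>)"
        unfolding abs_mult using that C(1) pos by (intro mult_mono) auto
      also have "\<dots> \<le> 2 * (C * D) * r powi (\<alpha> + \<beta>)"
        unfolding p(1) using C(1) D(1) pos by (simp add: mult_ac)
      finally show ?thesis .
    qed
    show "\<bar>f x * g x\<bar> \<le> 2 * (C * D) * norm x powi (\<alpha> + \<beta>)" "\<bar>f (x - y) * g (x - y)\<bar> \<le> 2 * (C * D) * norm x powi (\<alpha> + \<beta>)"
      unfolding r_def[symmetric] by (intro bd F G)+
    have "f (x - y) * g (x - y) - f x * g x = f (x - y) * (g (x - y) - g x) + (f (x - y) - f x) * g x"
      by (simp add: algebra_simps)
    then have "\<bar>f (x - y) * g (x - y) - f x * g x\<bar> \<le> \<bar>f (x - y)\<bar> * \<bar>g (x - y) - g x\<bar> + \<bar>f (x - y) - f x\<bar> * \<bar>g x\<bar>"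
      by (metis abs_mult abs_triangle_ineq)
    also have "\<dots> \<le> (C * r powi \<alpha>) * (D * norm y * r powi (\<beta> - 1)) + (C * norm y * r powi (\<alpha> - 1)) * (D * r powi \<beta>)"
      using C(1) pos by (intro add_mono mult_mono F G) auto
    also have "\<dots> = C * D * norm y * (r powi \<alpha> * r powi (\<beta> - 1)) + C * D * norm y * (r powi (\<alpha> - 1) * r powi \<beta>)"
      by (simp add: mult_ac)
    also have "\<dots> = 2 * (C * D) * norm y * r powi (\<alpha> + \<beta> - 1)"
      unfolding p(2)[symmetric] p(3)[symmetric] by simp
    finally show "\<bar>f (x - y) * g (x - y) - f x * g x\<bar> \<le> 2 * (C * D) * norm y * norm x powi (\<alpha> + \<beta> - 1)"
      unfolding r_def .
  qed (use C(1) D(1) in auto)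
qed

lemma hom_lipschitz_power:
  "hom_lipschitz \<alpha> f \<Longrightarrow> hom_lipschitz (int n * \<alpha>) (\<lambda>x. f x ^ n)"
proof (induction n)
  case 0
  then show ?case using hom_lipschitz_const[of 1] by simp
next
  case (Suc n)
  then show ?case using hom_lipschitz_mult[of \<alpha> f "int n * \<alpha>" "\<lambda>x. f x ^ n"] by (simp add: algebra_simps)
qed

lemma norm_half_le:
  assumes "norm y \<le> norm x / 2" shows "norm x / 2 \<le> norm (x - y)" "norm (x - y) \<le> 2 * norm x"
  using assms norm_triangle_ineq2[of x y] norm_triangle_ineq4[of x y] norm_ge_zero[of x] by linarith+

lemma hom_lipschitz_component: "hom_lipschitz 1 (\<lambda>x::real^'n. x $ i)"
  unfolding hom_lipschitz_def
proof (intro exI[of _ 2] conjI allI impI)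
  fix x y :: "real^'n" assume xy: "x \<noteq> 0 \<and> norm y \<le> norm x / 2"
  show "\<bar>x $ i\<bar> \<le> 2 * norm x powi 1" "\<bar>(x - y) $ i\<bar> \<le> 2 * norm x powi 1"
    "\<bar>(x - y) $ i - x $ i\<bar> \<le> 2 * norm y * norm x powi (1 - 1)"
    using component_le_norm_cart[of x i] component_le_norm_cart[of "x - y" i] component_le_norm_cart[of y i]
      norm_half_le[of y x] xy norm_ge_zero[of x] norm_ge_zero[of y] by (auto simp del: norm_ge_zero)
qed simp

text \<open>The other building block of the profile besides the components. The reverse triangle
  inequality takes the place of the gradient bound, and \<open>norm y \<le> norm x / 2\<close> keeps
  \<open>x - y\<close> away from the origin.\<close>

lemma hom_lipschitz_inverse_norm: "hom_lipschitz (- 1) (\<lambda>x. 1 / norm x)"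
  unfolding hom_lipschitz_def
proof (intro exI[of _ 2] conjI allI impI)
  fix x y :: 'a assume xy: "x \<noteq> 0 \<and> norm y \<le> norm x / 2"
  then have x: "norm x > 0" and le: "norm x / 2 \<le> norm (x - y)" using norm_half_le[of y x] by auto
  then have xy0: "norm (x - y) > 0" by linarith
  show "\<bar>1 / norm x\<bar> \<le> 2 * norm x powi - 1" using x by (simp add: power_int_minus field_simps)
  show "\<bar>1 / norm (x - y)\<bar> \<le> 2 * norm x powi - 1"
    using x xy0 le by (simp add: power_int_minus field_simps)
  have "\<bar>norm x - norm (x - y)\<bar> \<le> norm y"
    using norm_triangle_ineq3[of x "x - y"] by simp
  then have "\<bar>1 / norm (x - y) - 1 / norm x\<bar> \<le> norm y / (norm (x - y) * norm x)"
    using x xy0 by (simp add: diff_frac_eq abs_mult divide_right_mono)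
  also have "\<dots> \<le> norm y / (norm x / 2 * norm x)"
    using x xy0 le by (intro divide_left_mono mult_right_mono) auto
  also have "\<dots> = 2 * norm y * norm x powi (- 1 - 1)"
    using x by (simp add: power_int_minus power2_eq_square field_simps)
  finally show "\<bar>1 / norm (x - y) - 1 / norm x\<bar> \<le> 2 * norm y * norm x powi (- 1 - 1)" .
qed simp

text \<open>Both terms have degree - (d + 1), namely 1 - (d + 2) and 3 - (d + 4); an increment loses
  one more power of |x|.\<close>

lemma profile_increment:
  "\<exists>C>0. \<forall>x y::real^'n. x \<noteq> 0 \<longrightarrow> \<bar>profile j h k x\<bar> \<le> C / norm x ^ (CARD('n) + 1) \<and>
     (norm y \<le> norm x / 2 \<longrightarrow> \<bar>profile j h k (x - y) - profile j h k x\<bar> \<le> C * norm y / norm x ^ (CARD('n) + 2))"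
proof -
  let ?d = "int CARD('n)"
  have lin: "hom_lipschitz 1 (\<lambda>x::real^'n. c * x $ i)" for c i
    using hom_lipschitz_mult[OF hom_lipschitz_const hom_lipschitz_component] by simp
  have inv: "hom_lipschitz (- int n) (\<lambda>x::real^'n. (1 / norm x) ^ n)" for n
    using hom_lipschitz_power[OF hom_lipschitz_inverse_norm, of n] by simp
  have s: "hom_lipschitz 1 (sym_delta j h k :: real^'n \<Rightarrow> real)"
    unfolding sym_delta_def[abs_def] by (intro hom_lipschitz_add lin)
  have c: "hom_lipschitz 3 (\<lambda>x::real^'n. x $ j * x $ h * x $ k)"
    using hom_lipschitz_mult[OF hom_lipschitz_mult[OF hom_lipschitz_component hom_lipschitz_component] hom_lipschitz_component]
    by simp
  have e1: "0 + 1 + - int (CARD('n) + 2) = - ?d - 1" and e2: "0 + 3 + - int (CARD('n) + 4) = - ?d - 1"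
    by simp_all
  have "hom_lipschitz (0 + 1 + - int (CARD('n) + 2)) (\<lambda>x::real^'n. profile_const CARD('n) 2 / 4 * sym_delta j h k x * (1 / norm x) ^ (CARD('n) + 2))"
    by (intro hom_lipschitz_mult hom_lipschitz_const s inv)
  note h1 = this[unfolded e1]
  have "hom_lipschitz (0 + 3 + - int (CARD('n) + 4)) (\<lambda>x::real^'n. (- profile_const CARD('n) 3 / 8) * (x $ j * x $ h * x $ k) * (1 / norm x) ^ (CARD('n) + 4))"
    by (intro hom_lipschitz_mult hom_lipschitz_const c inv)
  note h2 = this[unfolded e2]
  have "(profile j h k :: real^'n \<Rightarrow> real) = (\<lambda>x. profile_const CARD('n) 2 / 4 * sym_delta j h k x * (1 / norm x) ^ (CARD('n) + 2)
      + (- profile_const CARD('n) 3 / 8) * (x $ j * x $ h * x $ k) * (1 / norm x) ^ (CARD('n) + 4))"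
    by (intro ext) (simp only: profile_def power_divide power_one, simp)
  then have "hom_lipschitz (- ?d - 1) (profile j h k :: real^'n \<Rightarrow> real)"
    using hom_lipschitz_add[OF h1 h2] by (simp only:)
  then obtain C where C: "C \<ge> 0" "\<And>x y::real^'n. x \<noteq> 0 \<Longrightarrow> norm y \<le> norm x / 2 \<Longrightarrow>
     \<bar>profile j h k x\<bar> \<le> C * norm x powi (- ?d - 1) \<and>
     \<bar>profile j h k (x - y) - profile j h k x\<bar> \<le> C * norm y * norm x powi (- ?d - 1 - 1)"
    unfolding hom_lipschitz_def by blast
  have p: "r powi (- ?d - 1) = 1 / r ^ (CARD('n) + 1)" "r powi (- ?d - 1 - 1) = 1 / r ^ (CARD('n) + 2)" for r :: real
  proof -
    have e: "- ?d - 1 = - int (CARD('n) + 1)" "- ?d - 1 - 1 = - int (CARD('n) + 2)" by simp_all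
    show "r powi (- ?d - 1) = 1 / r ^ (CARD('n) + 1)"
      unfolding e(1) power_int_minus power_int_of_nat by (simp only: inverse_eq_divide)
    show "r powi (- ?d - 1 - 1) = 1 / r ^ (CARD('n) + 2)"
      unfolding e(2) power_int_minus power_int_of_nat by (simp only: inverse_eq_divide)
  qed
  show ?thesis
  proof (intro exI[of _ "C + 1"] conjI allI impI)
    fix x y :: "real^'n" assume x: "x \<noteq> 0"
    have "\<bar>profile j h k x\<bar> \<le> C / norm x ^ (CARD('n) + 1)" using C(2)[OF x, of 0] unfolding p by simp
    also have "\<dots> \<le> (C + 1) / norm x ^ (CARD('n) + 1)" by (intro divide_right_mono) auto
    finally show "\<bar>profile j h k x\<bar> \<le> (C + 1) / norm x ^ (CARD('n) + 1)" .
    assume y: "norm y \<le> norm x / 2"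
    have "\<bar>profile j h k (x - y) - profile j h k x\<bar> \<le> C * norm y / norm x ^ (CARD('n) + 2)"
      using C(2)[OF x y] unfolding p by simp
    also have "\<dots> \<le> (C + 1) * norm y / norm x ^ (CARD('n) + 2)" by (intro divide_right_mono mult_right_mono) auto
    finally show "\<bar>profile j h k (x - y) - profile j h k x\<bar> \<le> (C + 1) * norm y / norm x ^ (CARD('n) + 2)" .
  qed (use C(1) in auto)
qed

text \<open>Freezes the kernel at \<open>profile j h k x\<close>, so that convolution with u
  \<otimes> u reduces to its total integral. The squared weight is the decay available from u
  \<otimes> u; the right-hand side is integrable in \<open>y\<close> with mass of order
  \<open>1 + sqrt t + 1 / sqrt t\<close>.\<close>

lemma kernel_difference_bound:
  "\<exists>C>0. \<forall>t>0. \<forall>x y::real^'n. 1 \<le> norm x \<longrightarrow>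
     \<bar>oseen_kernel j h k t (x - y) - profile j h k x\<bar> * (weight y)\<^sup>2
       \<le> C / norm x ^ (CARD('n) + 2) * ((1 + sqrt t) * weight y + majorant t (x - y))"
proof -
  let ?d = "CARD('n)"
  obtain A where A: "A > 0" "\<And>t z. t > 0 \<Longrightarrow> \<bar>oseen_kernel j h k t (z::real^'n)\<bar> \<le> A * majorant t z"
    using oseen_kernel_bound[of j h k] by blast
  obtain B where B: "B > 0" "\<And>t z. t > 0 \<Longrightarrow> z \<noteq> 0 \<Longrightarrow>
      \<bar>oseen_kernel j h k t (z::real^'n) - profile j h k z\<bar> \<le> B * sqrt t / norm z ^ (?d + 2)"
    using oseen_kernel_profile[of j h k] by blast
  obtain D where D: "D > 0" "\<And>x y::real^'n. x \<noteq> 0 \<Longrightarrow> \<bar>profile j h k x\<bar> \<le> D / norm x ^ (?d + 1)"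
     "\<And>x y::real^'n. x \<noteq> 0 \<Longrightarrow> norm y \<le> norm x / 2 \<Longrightarrow>
       \<bar>profile j h k (x - y) - profile j h k x\<bar> \<le> D * norm y / norm x ^ (?d + 2)"
    using profile_increment[of j h k] by blast
  define C where "C = (A + B) * 2 ^ (?d + 2) + 2 * D"
  have C: "C > 0" using A(1) B(1) D(1) by (simp add: C_def add_pos_pos)
  have "\<bar>oseen_kernel j h k t (x - y) - profile j h k x\<bar> * (weight y)\<^sup>2
       \<le> C / norm x ^ (?d + 2) * ((1 + sqrt t) * weight y + majorant t (x - y))"
    if t: "0 < t" and x1: "1 \<le> norm x" for t and x y :: "real^'n"
  proof -
    define N where "N = norm x ^ (?d + 2)"
    have x: "x \<noteq> 0" using x1 by auto
    then have N: "N > 0" by (simp add: N_def del: power_Suc power_add)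
    have w: "0 < weight y" "weight y \<le> 1" by (rule weight_bounds)+
    have w2: "(weight y)\<^sup>2 \<le> weight y" using w by (simp add: power2_eq_square mult_le_cancel_left1)
    have wy: "weight y * norm y \<le> 1" "weight y \<le> 1 / (1 + norm y)"
    proof -
      have pos: "0 < 1 + norm y" using norm_ge_zero[of y] by linarith
      have "1 + norm y \<le> (1 + norm y) ^ (?d + 1)" using power_increasing[of 1 "?d + 1" "1 + norm y"] by simp
      then show *: "weight y \<le> 1 / (1 + norm y)" unfolding weight_def using pos by (intro divide_left_mono) auto
      have "weight y * norm y \<le> 1 / (1 + norm y) * norm y" using * by (intro mult_right_mono) auto
      also have "\<dots> \<le> 1" using pos by (simp add: divide_le_eq)
      finally show "weight y * norm y \<le> 1" .
    qed
    have M: "0 \<le> majorant t (x - y)" using t by (rule majorant_nonneg)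
    show ?thesis
    \<comment> \<open>For \<open>y\<close> near the origin, kernel and profile are compared at
      \<open>x - y\<close> and the profile is then moved to \<open>x\<close>; one copy of the weight
      absorbs the factor \<open>norm y\<close> of the increment.\<close>
    proof (cases "norm y \<le> norm x / 2")
      case True
      note h = norm_half_le[OF True]
      have xy: "x - y \<noteq> 0" using h x1 by auto
      have "\<bar>oseen_kernel j h k t (x - y) - profile j h k (x - y)\<bar> \<le> B * sqrt t / norm (x - y) ^ (?d + 2)"
        by (rule B(2)[OF t xy])
      also have "\<dots> \<le> B * sqrt t / (norm x / 2) ^ (?d + 2)"
      proof (intro divide_left_mono power_mono mult_pos_pos zero_less_power)
        show "0 < norm (x - y)" "0 < norm x / 2" using x1 xy by auto
      qed (use h x1 B(1) t in auto)
      also have "\<dots> = B * 2 ^ (?d + 2) * sqrt t / N"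
        by (simp add: N_def power_divide)
      finally have "\<bar>oseen_kernel j h k t (x - y) - profile j h k x\<bar> \<le> B * 2 ^ (?d + 2) * sqrt t / N + D * norm y / N"
        using D(3)[OF x True] unfolding N_def by linarith
      then have "\<bar>oseen_kernel j h k t (x - y) - profile j h k x\<bar> * (weight y)\<^sup>2
         \<le> (B * 2 ^ (?d + 2) * sqrt t / N + D * norm y / N) * (weight y)\<^sup>2"
        by (intro mult_right_mono) auto
      also have "\<dots> = (B * 2 ^ (?d + 2) * sqrt t * weight y + D * (weight y * norm y)) * weight y / N"
        unfolding add_divide_distrib[symmetric] power2_eq_square times_divide_eq_left
        by (rule arg_cong[where f="\<lambda>u. u / N"]) (simp only: algebra_simps)
      also have "\<dots> \<le> (B * 2 ^ (?d + 2) * sqrt t * 1 + D * 1) * weight y / N"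
        using w wy B(1) D(1) t N by (intro divide_right_mono mult_right_mono add_mono mult_left_mono) auto
      also have "\<dots> \<le> (C * sqrt t + C) * weight y / N"
        using w N A(1) B(1) D(1) t by (intro divide_right_mono mult_right_mono add_mono) (auto simp: C_def algebra_simps)
      also have "\<dots> = C / N * ((1 + sqrt t) * weight y)"
        by (simp add: field_simps)
      also have "\<dots> \<le> C / N * ((1 + sqrt t) * weight y + majorant t (x - y))"
        using C N M by (intro mult_left_mono) auto
      finally show ?thesis by (simp add: N_def)
    next
      case False
      \<comment> \<open>For large \<open>y\<close> no cancellation is used. The squared weight has
        exponent 2d + 2, at least d + 2, and supplies all the decay in \<open>x\<close>; the
        concentration of the kernel near \<open>y = x\<close> is left to
        \<open>majorant\<close>.\<close>
      then have half: "norm x / 2 \<le> 1 + norm y" by simp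
      have "(?d + 1) * 2 = 2 * ?d + 2" by simp
      then have "(weight y)\<^sup>2 = 1 / (1 + norm y) ^ (2 * ?d + 2)"
        by (simp only: weight_def power_divide power_one power_mult[symmetric])
      also have "\<dots> \<le> 1 / (1 + norm y) ^ (?d + 2)"
        by (intro divide_left_mono power_increasing) (auto intro!: mult_pos_pos zero_less_power add_pos_nonneg)
      also have "\<dots> \<le> 1 / (norm x / 2) ^ (?d + 2)"
        using half x1 by (intro divide_left_mono power_mono) (auto intro!: mult_pos_pos zero_less_power add_pos_nonneg)
      also have "\<dots> = 2 ^ (?d + 2) / N" by (simp add: N_def power_divide)
      finally have wN: "(weight y)\<^sup>2 \<le> 2 ^ (?d + 2) / N" .
      have "\<bar>oseen_kernel j h k t (x - y)\<bar> * (weight y)\<^sup>2 \<le> A * majorant t (x - y) * (2 ^ (?d + 2) / N)"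
        using A M t by (intro mult_mono wN A(2)) auto
      moreover have "\<bar>profile j h k x\<bar> * (weight y)\<^sup>2 \<le> 2 * D / N * weight y"
      proof -
        have "weight y \<le> 2 / norm x"
        proof -
          have "1 / (1 + norm y) \<le> 1 / (norm x / 2)" using half x1 by (intro divide_left_mono) (auto intro!: mult_pos_pos add_pos_nonneg)
          then show ?thesis using wy(2) by simp
        qed
        then have "\<bar>profile j h k x\<bar> * (weight y * weight y) \<le> D / norm x ^ (?d + 1) * (2 / norm x * weight y)"
          using D(1) D(2)[OF x] w by (intro mult_mono mult_right_mono) auto
        also have "\<dots> = 2 * D / N * weight y" by (simp add: N_def mult_ac)
        finally show ?thesis by (simp add: power2_eq_square)
      qed
      moreover have "\<bar>oseen_kernel j h k t (x - y) - profile j h k x\<bar> * (weight y)\<^sup>2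
          \<le> \<bar>oseen_kernel j h k t (x - y)\<bar> * (weight y)\<^sup>2 + \<bar>profile j h k x\<bar> * (weight y)\<^sup>2"
        unfolding distrib_right[symmetric] by (intro mult_right_mono abs_triangle_ineq4) auto
      ultimately have "\<bar>oseen_kernel j h k t (x - y) - profile j h k x\<bar> * (weight y)\<^sup>2
          \<le> A * 2 ^ (?d + 2) / N * majorant t (x - y) + 2 * D / N * weight y"
        by (simp add: mult_ac)
      also have "\<dots> \<le> C / N * majorant t (x - y) + C / N * ((1 + sqrt t) * weight y)"
      proof (intro add_mono mult_right_mono mult_mono divide_right_mono)
        show "weight y \<le> (1 + sqrt t) * weight y" using t w by (simp add: mult_le_cancel_right1)
      qed (use A(1) B(1) D(1) M N w in \<open>auto simp: C_def algebra_simps\<close>)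
      finally show ?thesis unfolding N_def[symmetric] distrib_left by linarith
    qed
  qed
  then show ?thesis using C by blast
qed

subsection \<open>Zeros of the cubic form\<close>

text \<open>Infinitely many translates of a bounded part of \<open>Z\<close> along \<open>v\<close> stay in a fixed ball,
  while every point lies in at most \<open>m\<close> of them.\<close>

lemma null_set_of_finite_line_intersections:
  fixes Z :: "(real^'n) set" and v :: "real^'n"
  assumes Z: "closed Z" and fin: "\<And>x. finite {c. x - c *\<^sub>R v \<in> Z} \<and> card {c. x - c *\<^sub>R v \<in> Z} \<le> m"
  shows "emeasure lebesgue (Z \<inter> cball 0 1) = 0"
proof -
  let ?A = "Z \<inter> cball 0 1"
  let ?B = "cball (0::real^'n) (1 + norm v)"
  have A: "?A \<in> lmeasurable" using Z by (intro lmeasurable_compact) (auto intro: compact_Int_closed simp: Int_commute closed_Int_compact)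
  have bound: "real N * measure lebesgue ?A \<le> real m * measure lebesgue ?B" for N :: nat
  proof -
    \<comment> \<open>Distinct shifts in (0, 1], so that all translates of the unit-ball part stay
      in the ball of radius \<open>1 + norm v\<close>.\<close>
    define c where "c i = 1 / (real i + 1)" for i :: nat
    have injc: "inj c" by (auto simp: c_def inj_on_def)
    let ?T = "\<lambda>i. (+) (c i *\<^sub>R v) ` ?A"
    have T: "?T i \<in> lmeasurable" "measure lebesgue (?T i) = measure lebesgue ?A" for i
      using A by (auto simp: measurable_translation measure_translation)
    have "real N * measure lebesgue ?A = (\<Sum>i<N. measure lebesgue (?T i))" by (simp add: T)
    also have "\<dots> = (\<Sum>i<N. LINT x|lebesgue. indicator (?T i) x)"
      using T(1) by (intro sum.cong refl) (simp add: fmeasurable_def)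
    also have "\<dots> = (LINT x|lebesgue. (\<Sum>i<N. indicator (?T i) x))"
      using T(1) by (subst Bochner_Integration.integral_sum) (auto simp: lmeasurable_iff_integrable)
    also have "\<dots> \<le> (LINT x|lebesgue. real m * indicator ?B x)"
    proof (rule integral_mono)
      show "integrable lebesgue (\<lambda>x. \<Sum>i<N. indicator (?T i) x :: real)"
        using T(1) by (intro Bochner_Integration.integrable_sum) (auto simp: lmeasurable_iff_integrable)
      show "integrable lebesgue (\<lambda>x. real m * indicator ?B x)"
        using lmeasurable_cball[of 0 "1 + norm v"] by (intro integrable_mult_right) (auto simp: lmeasurable_iff_integrable)
      fix x
      have mem: "x \<in> ?T i \<longleftrightarrow> x - c i *\<^sub>R v \<in> ?A" for i
        by (metis (no_types, lifting) add.commute add_diff_cancel diff_add_cancel image_iff)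
      show "(\<Sum>i<N. indicator (?T i) x) \<le> real m * indicator ?B x"
      proof (cases "x \<in> ?B")
        case True
        let ?I = "{i. i < N \<and> x - c i *\<^sub>R v \<in> ?A}"
        have "(\<Sum>i<N. indicator (?T i) x :: real) = (\<Sum>i<N. if i \<in> ?I then 1 else 0)"
          by (intro sum.cong) (auto simp: indicator_def mem)
        also have "\<dots> = real (card ?I)"
          by (subst sum.inter_filter[symmetric]) (auto simp: Collect_conj_eq[symmetric] conj_commute intro!: arg_cong[where f=card])
        also have "card ?I = card (c ` ?I)"
          by (rule card_image[symmetric]) (rule inj_on_subset[OF injc], simp)
        also have "\<dots> \<le> card {c. x - c *\<^sub>R v \<in> Z}"
          using fin[of x] by (intro card_mono) auto
        finally show ?thesis using fin[of x] True by (simp add: indicator_def)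
      next
        case False
        have "x \<notin> ?T i" for i
        proof
          assume "x \<in> ?T i"
          then have "norm (x - c i *\<^sub>R v) \<le> 1" by (simp add: mem)
          moreover have "norm (c i *\<^sub>R v) \<le> norm v" by (simp add: c_def field_simps)
          ultimately have "norm x \<le> 1 + norm v" using norm_triangle_sub[of x "c i *\<^sub>R v"] by linarith
          then show False using False by simp
        qed
        then show ?thesis by (simp add: indicator_def)
      qed
    qed
    also have "\<dots> = real m * measure lebesgue ?B"
      using lmeasurable_cball[of 0 "1 + norm v"] by (simp add: fmeasurable_def)
    finally show ?thesis .
  qed
  have "measure lebesgue ?A = 0"
  proof (rule ccontr)
    assume "measure lebesgue ?A \<noteq> 0"
    then have "0 < measure lebesgue ?A" by (simp add: zero_less_measure_iff)
    then obtain N :: nat where "real m * measure lebesgue ?B < real N * measure lebesgue ?A"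
      using ex_less_of_nat_mult by blast
    then show False using bound[of N] by simp
  qed
  then show ?thesis using A by (simp add: emeasure_eq_measure2)
qed

text \<open>Up to the factor \<open>|z| ^ (d + 4)\<close>, the contraction of the profile with \<open>K\<close>.\<close>

definition cubic :: "real \<Rightarrow> real \<Rightarrow> real^'n^'n \<Rightarrow> 'n \<Rightarrow> real^'n \<Rightarrow> real" where
  "cubic \<beta> \<gamma> K j z = (\<Sum>h\<in>UNIV. \<Sum>k\<in>UNIV. K $ h $ k * (\<beta> * (norm z)\<^sup>2 * sym_delta j h k z - \<gamma> * (z $ j * z $ h * z $ k)))"

text \<open>The form is homogeneous of degree 3, so its leading coefficient along direction
  \<open>- v\<close> is its value at \<open>- v\<close>. If that is nonzero, every line parallel to
  \<open>v\<close> meets the zero set in at most three points.\<close>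

lemma cubic_line:
  obtains p where "degree p \<le> 3" "coeff p 3 = - cubic \<beta> \<gamma> K j v" "\<And>c. poly p c = cubic \<beta> \<gamma> K j (x - c *\<^sub>R v)"
proof -
  let ?l = "\<lambda>i. [:x $ i, - v $ i:]"
  let ?n = "[:(norm x)\<^sup>2, - 2 * (x \<bullet> v), (norm v)\<^sup>2:]"
  let ?s = "\<lambda>h k. smult (delta j h) (?l k) + smult (delta j k) (?l h) + smult (delta h k) (?l j)"
  let ?p = "\<Sum>h\<in>UNIV. \<Sum>k\<in>UNIV. smult (K $ h $ k) (smult \<beta> (?n * ?s h k) - smult \<gamma> (?l j * (?l h * ?l k)))"
  have n: "poly ?n c = (norm (x - c *\<^sub>R v))\<^sup>2" for c
  proof -
    have "(norm (x - c *\<^sub>R v))\<^sup>2 = (norm x)\<^sup>2 - 2 * c * (x \<bullet> v) + c * c * (norm v)\<^sup>2"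
      unfolding power2_norm_eq_inner by (simp add: inner_diff_left inner_diff_right inner_commute algebra_simps)
    then show ?thesis by (simp add: algebra_simps)
  qed
  have "poly ?p c = cubic \<beta> \<gamma> K j (x - c *\<^sub>R v)" for c
  proof -
    have "poly ?p c = (\<Sum>h\<in>UNIV. \<Sum>k\<in>UNIV. K $ h $ k * (\<beta> * (poly ?n c * poly (?s h k) c) - \<gamma> * (poly (?l j) c * (poly (?l h) c * poly (?l k) c))))"
      by (simp only: poly_sum poly_smult poly_diff poly_mult)
    also have "\<dots> = cubic \<beta> \<gamma> K j (x - c *\<^sub>R v)"
      unfolding n cubic_def by (intro sum.cong refl) (simp add: sym_delta_def algebra_simps)
    finally show ?thesis .
  qed
  moreover have "degree ?p \<le> 3"
  proof -
    have l: "degree (?l i) \<le> 1" "degree ?n \<le> 2" for i by simp_all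
    have s: "degree (?s h k) \<le> 1" for h k
      by (intro degree_add_le order_trans[OF degree_smult_le] l)
    have "degree (?n * ?s h k) \<le> 3" for h k
      using degree_mult_le[of ?n "?s h k"] l(2) s[of h k] by linarith
    moreover have "degree (?l j * (?l h * ?l k)) \<le> 3" for h k
      using degree_mult_le[of "?l j" "?l h * ?l k"] degree_mult_le[of "?l h" "?l k"] l(1)[of j] l(1)[of h] l(1)[of k] by linarith
    ultimately show ?thesis
      by (intro degree_sum_le finite order_trans[OF degree_smult_le] degree_diff_le)
  qed
  moreover have "coeff ?p 3 = - cubic \<beta> \<gamma> K j v"
  proof -
    have "coeff (?n * ?s h k) 3 = - ((norm v)\<^sup>2 * sym_delta j h k v)" for h k
      by (simp add: sym_delta_def eval_nat_numeral coeff_pCons algebra_simps)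
    moreover have "coeff (?l j * (?l h * ?l k)) 3 = - (v $ j * v $ h * v $ k)" for h k
      by (simp add: eval_nat_numeral coeff_pCons algebra_simps)
    ultimately have "coeff ?p 3 = (\<Sum>h\<in>UNIV. \<Sum>k\<in>UNIV. - (K $ h $ k * (\<beta> * (norm v)\<^sup>2 * sym_delta j h k v - \<gamma> * (v $ j * v $ h * v $ k))))"
      unfolding coeff_sum coeff_smult coeff_diff by (intro sum.cong refl) (simp add: algebra_simps)
    then show ?thesis by (simp add: cubic_def sum_negf)
  qed
  ultimately show thesis using that by blast
qed

lemma continuous_on_cubic: "continuous_on UNIV (cubic \<beta> \<gamma> K j)"
  unfolding cubic_def[abs_def] sym_delta_def by (intro continuous_intros)

lemma cubic_scaleR: "cubic \<beta> \<gamma> K j (r *\<^sub>R z) = r ^ 3 * cubic \<beta> \<gamma> K j z"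
  unfolding cubic_def sum_distrib_left
  by (intro sum.cong refl) (simp add: sym_delta_def power_mult_distrib power2_eq_square power3_eq_cube algebra_simps)

text \<open>A point \<open>v\<close> where the form does not vanish serves as the direction of
  translation and makes the zero set null in the unit ball. By homogeneity that set contains the
  truncated cone whose volume defines \<open>sphere_measure S\<close>.\<close>

lemma cubic_eq_0_of_positive_measure:
  assumes "S \<subseteq> sphere 0 1" "sphere_measure S > 0" and zero: "\<And>\<sigma>. \<sigma> \<in> S \<Longrightarrow> cubic \<beta> \<gamma> K j \<sigma> = 0"
  shows "cubic \<beta> \<gamma> K j v = 0"
proof (rule ccontr)
  assume v: "cubic \<beta> \<gamma> K j v \<noteq> 0"
  let ?Z = "{x. cubic \<beta> \<gamma> K j x = 0}"
  have closed: "closed ?Z"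
    using continuous_closed_vimage[of "{0}" "cubic \<beta> \<gamma> K j"] continuous_on_cubic[of \<beta> \<gamma> K j]
    by (simp add: vimage_def continuous_on_eq_continuous_at)
  have "finite {c. x - c *\<^sub>R v \<in> ?Z} \<and> card {c. x - c *\<^sub>R v \<in> ?Z} \<le> 3" for x
  proof -
    obtain p where p: "degree p \<le> 3" "coeff p 3 = - cubic \<beta> \<gamma> K j v" "\<And>c. poly p c = cubic \<beta> \<gamma> K j (x - c *\<^sub>R v)"
      using cubic_line[of \<beta> \<gamma> K j v x] by metis
    have "p \<noteq> 0" using p(2) v by auto
    then show ?thesis using poly_roots_finite[of p] card_poly_roots_bound[of p] p(1) by (simp add: p(3))
  qed
  then have null: "emeasure lebesgue (?Z \<inter> cball 0 1) = 0"
    by (rule null_set_of_finite_line_intersections[OF closed])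
  have "{r *\<^sub>R \<sigma> |r \<sigma>. 0 < r \<and> r \<le> 1 \<and> \<sigma> \<in> S} \<subseteq> ?Z \<inter> cball 0 1"
    using assms(1) by (auto simp: cubic_scaleR zero)
  then have "emeasure lebesgue {r *\<^sub>R \<sigma> |r \<sigma>. 0 < r \<and> r \<le> 1 \<and> \<sigma> \<in> S} \<le> emeasure lebesgue (?Z \<inter> cball 0 1)"
    using closed by (intro emeasure_mono) (auto intro!: borel_closed closed_Int)
  then show False using assms(2) null by (simp add: sphere_measure_def)
qed

text \<open>Of the three deltas, two contract to row \<open>j\<close> of \<open>K\<close> by
  symmetry and the third to the trace.\<close>

lemma cubic_eq:
  fixes K :: "real^'n^'n"
  assumes "\<And>h k. K $ h $ k = K $ k $ h"
  shows "cubic \<beta> \<gamma> K j z = \<beta> * (norm z)\<^sup>2 * (2 * (\<Sum>h\<in>UNIV. K $ j $ h * z $ h) + (\<Sum>h\<in>UNIV. K $ h $ h) * z $ j)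
     - \<gamma> * z $ j * (\<Sum>h\<in>UNIV. \<Sum>k\<in>UNIV. K $ h $ k * z $ h * z $ k)"
proof -
  have "(\<Sum>k\<in>UNIV. K $ h $ k * (delta j h * z $ k)) = (if h = j then \<Sum>k\<in>UNIV. K $ j $ k * z $ k else 0)" for h
    by (auto simp: delta_def)
  moreover have "(\<Sum>k\<in>UNIV. K $ h $ k * (delta j k * z $ h)) = K $ h $ j * z $ h" for h
  proof -
    have "(\<Sum>k\<in>UNIV. K $ h $ k * (delta j k * z $ h)) = (\<Sum>k\<in>UNIV. if k = j then K $ h $ j * z $ h else 0)"
      by (rule sum.cong) (auto simp: delta_def)
    then show ?thesis by simp
  qed
  moreover have "(\<Sum>k\<in>UNIV. K $ h $ k * (delta h k * z $ j)) = K $ h $ h * z $ j" for h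
  proof -
    have "(\<Sum>k\<in>UNIV. K $ h $ k * (delta h k * z $ j)) = (\<Sum>k\<in>UNIV. if k = h then K $ h $ h * z $ j else 0)"
      by (rule sum.cong) (auto simp: delta_def)
    then show ?thesis by simp
  qed
  ultimately have "(\<Sum>h\<in>UNIV. \<Sum>k\<in>UNIV. K $ h $ k * sym_delta j h k z)
      = (\<Sum>k\<in>UNIV. K $ j $ k * z $ k) + (\<Sum>h\<in>UNIV. K $ h $ j * z $ h) + (\<Sum>h\<in>UNIV. K $ h $ h * z $ j)"
    by (simp add: sym_delta_def distrib_left sum.distrib)
  also have "\<dots> = 2 * (\<Sum>h\<in>UNIV. K $ j $ h * z $ h) + (\<Sum>h\<in>UNIV. K $ h $ h) * z $ j"
    using assms[of _ j] by (simp add: sum_distrib_right)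
  finally have s: "(\<Sum>h\<in>UNIV. \<Sum>k\<in>UNIV. K $ h $ k * sym_delta j h k z) = \<dots>" .
  have "cubic \<beta> \<gamma> K j z = \<beta> * (norm z)\<^sup>2 * (\<Sum>h\<in>UNIV. \<Sum>k\<in>UNIV. K $ h $ k * sym_delta j h k z)
      - \<gamma> * z $ j * (\<Sum>h\<in>UNIV. \<Sum>k\<in>UNIV. K $ h $ k * z $ h * z $ k)"
    unfolding cubic_def sum_distrib_left sum_subtractf[symmetric] by (intro sum.cong refl) (simp add: algebra_simps)
  then show ?thesis unfolding s .
qed

text \<open>The vanishing of one component forces \<open>K\<close> to be a multiple of the identity.\<close>

lemma cubic_eq_0_all_components:
  fixes K :: "real^'n^'n"
  assumes sym: "\<And>h k. K $ h $ k = K $ k $ h" and pos: "0 < \<beta>" "0 < \<gamma>"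
    and zero: "\<And>z. cubic \<beta> \<gamma> K j z = 0"
  shows "cubic \<beta> \<gamma> K i z = 0"
proof -
  let ?T = "\<Sum>h\<in>UNIV. K $ h $ h"
  let ?q = "\<lambda>z::real^'n. \<Sum>h\<in>UNIV. \<Sum>k\<in>UNIV. K $ h $ k * z $ h * z $ k"
  \<comment> \<open>At the unit vector along \<open>k\<close> the component \<open>z $ j\<close>
    vanishes, which removes the trace and the quadratic form and leaves twice the entry
    \<open>K $ j $ k\<close>.\<close>
  have off: "K $ j $ k = 0" if "k \<noteq> j" for k
  proof -
    have "(\<Sum>h\<in>UNIV. K $ j $ h * axis k 1 $ h) = K $ j $ k"
      by (simp add: axis_def if_distrib sum.delta cong: if_cong)
    then have "cubic \<beta> \<gamma> K j (axis k 1) = \<beta> * (2 * K $ j $ k)"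
      using that unfolding cubic_eq[OF sym] by (simp add: axis_def[of k 1] norm_axis_1[unfolded axis_def])
    then show ?thesis using zero[of "axis k 1"] pos by simp
  qed
  have lin: "(\<Sum>h\<in>UNIV. K $ j $ h * z $ h) = K $ j $ j * z $ j" for z :: "real^'n"
    using off by (subst sum.remove[of _ j]) (auto intro!: sum.neutral)
  \<comment> \<open>With row \<open>j\<close> diagonal, the cubic is \<open>z $ j\<close> times a
    quadratic form, and this factor can be divided out.\<close>
  have key: "\<beta> * (norm z)\<^sup>2 * (2 * K $ j $ j + ?T) = \<gamma> * ?q z" if "z $ j \<noteq> 0" for z
  proof -
    have "z $ j * (\<beta> * (norm z)\<^sup>2 * (2 * K $ j $ j + ?T) - \<gamma> * ?q z) = cubic \<beta> \<gamma> K j z"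
      unfolding cubic_eq[OF sym] lin by (simp add: algebra_simps)
    then show ?thesis using zero[of z] that by simp
  qed
  define L where "L = K $ j $ j"
  define \<mu> where "\<mu> = \<beta> * (2 * L + ?T)"
  \<comment> \<open>Evaluated on vectors supported in \<open>I\<close>. All-ones vectors on one, two
    and three indices, always including \<open>j\<close>, yield in turn
    \<open>\<mu> = \<gamma> * L\<close>, the diagonal entries and the remaining off-diagonal
    entries.\<close>
  have test: "\<mu> * (\<Sum>i\<in>I. (c i)\<^sup>2) = \<gamma> * (\<Sum>h\<in>I. \<Sum>k\<in>I. K $ h $ k * c h * c k)"
    if "j \<in> I" "c j \<noteq> 0" for I c
  proof -
    let ?z = "\<chi> h. if h \<in> I then c h else 0"
    have "(norm ?z)\<^sup>2 = (\<Sum>i\<in>I. (c i)\<^sup>2)"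
      unfolding norm_vec_square by (rule sum.mono_neutral_cong_right) auto
    moreover have "(\<Sum>k\<in>UNIV. K $ h $ k * ?z $ h * ?z $ k) = (\<Sum>k\<in>I. K $ h $ k * ?z $ h * c k)" for h
      by (rule sum.mono_neutral_cong_right) auto
    then have "?q ?z = (\<Sum>h\<in>I. \<Sum>k\<in>I. K $ h $ k * c h * c k)"
      by (simp only:) (rule sum.mono_neutral_cong_right, auto)
    moreover have "?z $ j \<noteq> 0" using that by simp
    ultimately show ?thesis
      using key[of ?z] by (simp only: \<mu>_def L_def mult_ac not_False_eq_True simp_thms)
  qed
  have 1: "\<mu> = \<gamma> * L" using test[of "{j}" "\<lambda>_. 1"] by (simp add: L_def)
  have diag: "K $ k $ k = L" for k
  proof (cases "k = j")
    case False
    then have "2 * \<mu> = \<gamma> * (L + K $ k $ k)" using test[of "{j, k}" "\<lambda>_. 1"] off[of k] sym[of k j] by (simp add: L_def)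
    then have "\<gamma> * (K $ k $ k) = \<gamma> * L" unfolding 1 distrib_left by linarith
    then show ?thesis using pos by simp
  qed (simp add: L_def)
  have offd: "K $ k $ l = 0" if kl: "k \<noteq> l" for k l
  proof (cases "k = j \<or> l = j")
    case True
    then show ?thesis using kl off[of l] off[of k] sym[of k l] by auto
  next
    case False
    then have "j \<noteq> k" "j \<noteq> l" "k \<noteq> j" "l \<noteq> j" by auto
    then have "3 * \<mu> = \<gamma> * (3 * L + 2 * K $ k $ l)"
      using test[of "{j, k, l}" "\<lambda>_. 1"] kl off[of k] off[of l] sym[of k j] sym[of l j] sym[of l k] diag[of j] diag[of k] diag[of l]
      by (simp add: algebra_simps)
    then have "\<gamma> * K $ k $ l = 0" unfolding 1 by (simp add: distrib_left)
    then show ?thesis using pos by simp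
  qed
  have q: "?q z = L * (norm z)\<^sup>2"
  proof -
    have "(\<Sum>k\<in>UNIV. K $ h $ k * z $ h * z $ k) = L * (z $ h)\<^sup>2" for h
      using offd[of h] diag[of h] by (subst sum.remove[of _ h]) (auto intro!: sum.neutral simp: power2_eq_square)
    then show ?thesis unfolding norm_vec_square by (simp add: sum_distrib_left)
  qed
  have "(\<Sum>h\<in>UNIV. K $ i $ h * z $ h) = L * z $ i"
    using offd[of i] diag[of i] by (subst sum.remove[of _ i]) (auto intro!: sum.neutral)
  then have "cubic \<beta> \<gamma> K i z = (norm z)\<^sup>2 * z $ i * (\<mu> - \<gamma> * L)"
    unfolding cubic_eq[OF sym] q \<mu>_def by (simp add: algebra_simps)
  then show ?thesis using 1 by simp
qed

subsection \<open>Bounds for the Duhamel integrand\<close>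

lemma lborel_reflect: "lborel = distr lborel borel (\<lambda>y::real^'n. x - y)"
  using lborel_affine[of "-1" x] by (simp add: density_1)

lemma
  fixes f :: "real^'n \<Rightarrow> real"
  assumes f: "integrable lborel f"
  shows integrable_reflect: "integrable lborel (\<lambda>y. f (x - y))"
    and integral_reflect: "(LINT y|lborel. f (x - y)) = (LINT y|lborel. f y)"
proof -
  have [measurable]: "f \<in> borel_measurable borel" using f by auto
  have "integrable (distr lborel borel (\<lambda>y. x - y)) f" using f by (simp flip: lborel_reflect)
  then show "integrable lborel (\<lambda>y. f (x - y))" by (subst (asm) integrable_distr_eq) auto
  have "(LINT y|lborel. f y) = (LINT y|distr lborel borel (\<lambda>y. x - y). f y)" by (simp flip: lborel_reflect)
  then show "(LINT y|lborel. f (x - y)) = (LINT y|lborel. f y)" by (simp add: integral_distr)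
qed

lemma
  fixes f :: "'a::euclidean_space \<Rightarrow> 'b::{banach,second_countable_topology}"
  assumes "integrable lborel f"
  shows integrable_lebesgue: "integrable lebesgue f"
    and integral_lebesgue: "(LINT x|lebesgue. f x) = (LINT x|lborel. f x)"
  using assms borel_measurable_integrable[OF assms] by (simp_all add: integrable_completion integral_completion)

lemma abs_integral_le:
  fixes f g :: "'a \<Rightarrow> real"
  assumes "f \<in> borel_measurable M" "integrable M g" "AE x in M. \<bar>f x\<bar> \<le> g x"
  shows "integrable M f" "\<bar>LINT x|M. f x\<bar> \<le> (LINT x|M. g x)"
proof -
  show i: "integrable M f"
    using assms by (intro Bochner_Integration.integrable_bound[OF assms(2)]) auto
  have "\<bar>LINT x|M. f x\<bar> \<le> (LINT x|M. \<bar>f x\<bar>)" using integral_norm_bound[of M f] by simp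
  also have "\<dots> \<le> (LINT x|M. g x)" using i assms by (intro integral_mono_AE) auto
  finally show "\<bar>LINT x|M. f x\<bar> \<le> (LINT x|M. g x)" .
qed

lemma weighted_norm_AE:
  assumes "weighted_norm \<theta> f \<le> ennreal M" "0 \<le> M"
  shows "AE x in lebesgue. norm (f x) \<le> M * (1 + norm x) powr (- \<theta>)"
proof -
  have "AE x in lebesgue. ennreal ((1 + norm x) powr \<theta> * norm (f x)) \<le> weighted_norm \<theta> f"
    unfolding weighted_norm_def by (rule esssup_AE)
  then show ?thesis
  proof (rule AE_mp, intro AE_I2 impI)
    fix x assume "ennreal ((1 + norm x) powr \<theta> * norm (f x)) \<le> weighted_norm \<theta> f"
    then have "(1 + norm x) powr \<theta> * norm (f x) \<le> M"
      using assms by (metis ennreal_le_iff order_trans)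
    moreover have "0 < 1 + norm x" using norm_ge_zero[of x] by linarith
    ultimately show "norm (f x) \<le> M * (1 + norm x) powr (- \<theta>)"
      by (simp add: powr_minus field_simps)
  qed
qed

lemma powr_weight: "(1 + norm x) powr (- (real CARD('n) + 1)) = weight (x::real^'n)"
proof -
  have pos: "0 < 1 + norm x" using norm_ge_zero[of x] by linarith
  have "real CARD('n) + 1 = real (CARD('n) + 1)" by simp
  then show ?thesis unfolding weight_def powr_minus using pos by (simp only: powr_realpow inverse_eq_divide)
qed

text \<open>Integrated over time, these moments form the matrix \<open>K\<close>.\<close>

definition quad_moment :: "(real^'n \<Rightarrow> real^'n) \<Rightarrow> 'n \<Rightarrow> 'n \<Rightarrow> real" where
  "quad_moment f h k = (LINT y|lebesgue. f y $ h * f y $ k)"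

definition weight_mass :: "'n::finite itself \<Rightarrow> real" where
  "weight_mass _ = (LINT y|lborel. weight (y::real^'n))"

lemma weight_mass_nonneg: "0 \<le> weight_mass TYPE('n::finite)"
  unfolding weight_mass_def by (intro Bochner_Integration.integral_nonneg less_imp_le weight_bounds)

lemma measurable_component:
  "f \<in> borel_measurable M \<Longrightarrow> (\<lambda>x. (f x :: real^'n) $ i) \<in> borel_measurable M"
  by (rule measurable_compose[of f M borel]) (auto intro!: borel_measurable_continuous_onI continuous_intros)

text \<open>The pointwise bound keeps both copies of the weight for
  \<open>kernel_difference_bound\<close>; the integral bounds give one up, since
  \<open>weight\<close> is at most 1.\<close>

lemma
  fixes f g :: "real^'n \<Rightarrow> real^'n"
  assumes [measurable]: "f \<in> borel_measurable lebesgue" "g \<in> borel_measurable lebesgue"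
    and f: "AE y in lebesgue. norm (f y) \<le> M * weight y"
    and g: "AE y in lebesgue. norm (g y) \<le> N * weight y"
    and MN: "0 \<le> M" "0 \<le> N"
  shows AE_product_weight: "AE y in lebesgue. \<bar>f y $ h * g y $ k\<bar> \<le> M * N * (weight y)\<^sup>2"
    and integrable_product: "integrable lebesgue (\<lambda>y. f y $ h * g y $ k)"
    and integral_abs_product: "(LINT y|lebesgue. \<bar>f y $ h * g y $ k\<bar>) \<le> M * N * weight_mass TYPE('n)"
proof -
  show AE: "AE y in lebesgue. \<bar>f y $ h * g y $ k\<bar> \<le> M * N * (weight y)\<^sup>2" for h k
    using f g
  proof eventually_elim
    case (elim y)
    have "\<bar>f y $ h * g y $ k\<bar> \<le> (M * weight y) * (N * weight y)"
      unfolding abs_mult using elim MN weight_bounds[of y] component_le_norm_cart[of "f y" h] component_le_norm_cart[of "g y" k]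
      by (intro mult_mono order_trans[OF component_le_norm_cart]) auto
    then show ?case by (simp add: power2_eq_square mult_ac)
  qed
  have AE': "AE y in lebesgue. \<bar>f y $ h * g y $ k\<bar> \<le> M * N * weight y" for h k
    using AE[of h k]
  proof eventually_elim
    case (elim y)
    have "(weight y)\<^sup>2 \<le> weight y" using weight_bounds[of y] by (simp add: power2_eq_square mult_le_cancel_left1)
    then have "M * N * (weight y)\<^sup>2 \<le> M * N * weight y" using MN by (intro mult_left_mono) auto
    then show ?case using elim by linarith
  qed
  have m: "(\<lambda>y. f y $ h * g y $ k) \<in> borel_measurable lebesgue" for h k
    by (intro borel_measurable_times measurable_component assms)
  have i: "integrable lebesgue (\<lambda>y::real^'n. M * N * weight y)"
    by (intro integrable_mult_right integrable_lebesgue integrable_weight)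
  show "integrable lebesgue (\<lambda>y. f y $ h * g y $ k)"
    by (rule abs_integral_le(1)[OF m i AE'])
  have "(LINT y|lebesgue. \<bar>f y $ h * g y $ k\<bar>) \<le> (LINT y|lebesgue. M * N * weight (y::real^'n))"
    using abs_integral_le(2)[of "\<lambda>y. \<bar>f y $ h * g y $ k\<bar>" lebesgue "\<lambda>y. M * N * weight y"] m AE' i
    by (auto intro!: order_trans[OF abs_ge_self])
  also have "\<dots> = M * N * weight_mass TYPE('n)"
    by (simp add: weight_mass_def integral_lebesgue integrable_weight)
  finally show "(LINT y|lebesgue. \<bar>f y $ h * g y $ k\<bar>) \<le> M * N * weight_mass TYPE('n)" .
qed

lemma tensor_component: "tensor v w $ h $ k = v $ h * w $ k"
  by (simp add: tensor_def)

text \<open>\<open>C\<close> is fixed before time, field and point, so the bounds can be integrated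
  in time. The first pairs a bounded product with the mass of \<open>majorant\<close>; in the second
  the profile is constant in \<open>y\<close>, and \<open>kernel_difference_bound\<close> is
  integrated.\<close>

lemma oseen_convolution_bounds:
  "\<exists>C>0. \<forall>t>0. \<forall>f. \<forall>M\<ge>0. f \<in> borel_measurable lebesgue \<longrightarrow> (AE y in lebesgue. norm (f y) \<le> M * weight y) \<longrightarrow>
     (\<forall>x::real^'n. \<bar>LINT y|lebesgue. f y $ h * f y $ k * oseen_kernel j h k t (x - y)\<bar> \<le> C * M\<^sup>2 * (1 + sqrt t + 1 / sqrt t) \<and>
       (1 \<le> norm x \<longrightarrow> \<bar>(LINT y|lebesgue. f y $ h * f y $ k * oseen_kernel j h k t (x - y)) - profile j h k x * quad_moment f h k\<bar>
          \<le> C * M\<^sup>2 * (1 + sqrt t + 1 / sqrt t) / norm x ^ (CARD('n) + 2)))"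
proof -
  let ?W = "weight_mass TYPE('n)"
  obtain A where A: "A > 0" "\<And>t z. t > 0 \<Longrightarrow> \<bar>oseen_kernel j h k t (z::real^'n)\<bar> \<le> A * majorant t z"
    using oseen_kernel_bound[of j h k] by blast
  obtain B where B: "B > 0" "\<And>t x y. t > 0 \<Longrightarrow> 1 \<le> norm (x::real^'n) \<Longrightarrow>
     \<bar>oseen_kernel j h k t (x - y) - profile j h k x\<bar> * (weight y)\<^sup>2
       \<le> B / norm x ^ (CARD('n) + 2) * ((1 + sqrt t) * weight y + majorant t (x - y))"
    using kernel_difference_bound[of j h k] by blast
  define C where "C = 3 * A + B * (?W + 3)"
  have C: "C > 0" "3 * A \<le> C" "B * (?W + 3) \<le> C"
    using A(1) B(1) weight_mass_nonneg[where 'n='n] by (auto simp: C_def intro!: add_pos_nonneg)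
  show ?thesis
  proof (intro exI[of _ C] conjI allI impI)
    fix t M :: real and f :: "real^'n \<Rightarrow> real^'n" and x :: "real^'n"
    assume t: "0 < t" and M: "0 \<le> M" and f: "f \<in> borel_measurable lebesgue" and fM: "AE y in lebesgue. norm (f y) \<le> M * weight y"
    let ?F = "\<lambda>y. f y $ h * f y $ k"
    let ?s = "1 + sqrt t + 1 / sqrt t"
    have s0: "0 \<le> ?s" using t by simp
    have intF: "integrable lebesgue ?F" by (rule integrable_product[OF f f fM fM M M])
    have AEF: "AE y in lebesgue. \<bar>?F y\<bar> \<le> M * M * (weight y)\<^sup>2" by (rule AE_product_weight[OF f f fM fM M M])
    have intG: "integrable lebesgue (\<lambda>y. ?F y * oseen_kernel j h k t (x - y))"
      using integrable_oseen[of t "\<lambda>y. tensor (f y) (f y)" h k j x] t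
      by (simp add: tensor_component integrable_product[OF f f fM fM M M])
    have maj: "integrable lborel (\<lambda>y. majorant t (x - y))" "(LINT y|lborel. majorant t (x - y)) = 3 / sqrt t"
      using integral_majorant[OF t, where 'n='n] by (auto simp: integrable_reflect integral_reflect)
    have "\<bar>LINT y|lebesgue. ?F y * oseen_kernel j h k t (x - y)\<bar> \<le> (LINT y|lebesgue. M * M * A * majorant t (x - y))"
    proof (rule abs_integral_le(2))
      show "AE y in lebesgue. \<bar>?F y * oseen_kernel j h k t (x - y)\<bar> \<le> M * M * A * majorant t (x - y)"
        using AEF
      proof eventually_elim
        case (elim y)
        have "(weight y)\<^sup>2 \<le> 1" using weight_bounds[of y] by (simp add: power_le_one)
        then have "M * M * (weight y)\<^sup>2 \<le> M * M * 1" using M by (intro mult_left_mono) auto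
        then have "\<bar>?F y\<bar> \<le> M * M" using elim by linarith
        then have "\<bar>?F y * oseen_kernel j h k t (x - y)\<bar> \<le> (M * M) * (A * majorant t (x - y))"
          unfolding abs_mult[of "?F y"] using A(2)[OF t] M by (intro mult_mono) auto
        then show ?case by (simp add: mult_ac)
      qed
      show "(\<lambda>y. ?F y * oseen_kernel j h k t (x - y)) \<in> borel_measurable lebesgue"
        using intG by (rule borel_measurable_integrable)
      show "integrable lebesgue (\<lambda>y. M * M * A * majorant t (x - y))"
        by (intro integrable_mult_right integrable_lebesgue maj)
    qed
    also have "\<dots> = M * M * A * (3 / sqrt t)"
      by (simp only: integral_mult_right_zero integral_lebesgue[OF maj(1)] maj(2))
    also have "\<dots> = M\<^sup>2 * (3 * A) * (1 / sqrt t)" by (simp add: power2_eq_square)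
    also have "\<dots> \<le> M\<^sup>2 * C * ?s"
      using C t A(1) by (intro mult_mono mult_left_mono) auto
    finally show "\<bar>LINT y|lebesgue. ?F y * oseen_kernel j h k t (x - y)\<bar> \<le> C * M\<^sup>2 * ?s" by (simp add: mult_ac)
    assume x: "1 \<le> norm x"
    define N where "N = norm x ^ (CARD('n) + 2)"
    have N: "0 < N" unfolding N_def using x by (intro zero_less_power) linarith
    have W: "integrable lborel (\<lambda>y::real^'n. (1 + sqrt t) * weight y)" by (intro integrable_mult_right integrable_weight)
    have int2: "integrable lborel (\<lambda>y. (1 + sqrt t) * weight y + majorant t (x - y))"
      by (intro Bochner_Integration.integrable_add W maj)
    have "\<bar>(LINT y|lebesgue. ?F y * oseen_kernel j h k t (x - y)) - profile j h k x * quad_moment f h k\<bar>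
        = \<bar>LINT y|lebesgue. ?F y * oseen_kernel j h k t (x - y) - profile j h k x * ?F y\<bar>"
      unfolding quad_moment_def by (subst Bochner_Integration.integral_diff[OF intG]) (auto intro: intF)
    also have "\<dots> \<le> (LINT y|lebesgue. M * M * (B / N) * ((1 + sqrt t) * weight y + majorant t (x - y)))"
    proof (rule abs_integral_le(2))
      show "AE y in lebesgue. \<bar>?F y * oseen_kernel j h k t (x - y) - profile j h k x * ?F y\<bar>
          \<le> M * M * (B / N) * ((1 + sqrt t) * weight y + majorant t (x - y))"
        using AEF
      proof eventually_elim
        case (elim y)
        have "?F y * oseen_kernel j h k t (x - y) - profile j h k x * ?F y = ?F y * (oseen_kernel j h k t (x - y) - profile j h k x)"
          by (simp add: algebra_simps)
        then have "\<bar>?F y * oseen_kernel j h k t (x - y) - profile j h k x * ?F y\<bar>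
            \<le> M * M * (weight y)\<^sup>2 * \<bar>oseen_kernel j h k t (x - y) - profile j h k x\<bar>"
          using elim by (simp only: abs_mult[of "?F y"]) (intro mult_right_mono, auto)
        also have "\<dots> = M * M * (\<bar>oseen_kernel j h k t (x - y) - profile j h k x\<bar> * (weight y)\<^sup>2)" by (simp add: mult_ac)
        also have "\<dots> \<le> M * M * (B / N * ((1 + sqrt t) * weight y + majorant t (x - y)))"
          using B(2)[OF t x] M unfolding N_def by (intro mult_left_mono) auto
        finally show ?case by (simp only: mult.assoc)
      qed
      show "(\<lambda>y. ?F y * oseen_kernel j h k t (x - y) - profile j h k x * ?F y) \<in> borel_measurable lebesgue"
        using intG intF by (intro borel_measurable_diff borel_measurable_times borel_measurable_const borel_measurable_integrable)
    qed (intro integrable_mult_right integrable_lebesgue int2)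
    also have "\<dots> = M * M * (B / N) * ((1 + sqrt t) * ?W + 3 / sqrt t)"
      by (simp only: integral_mult_right_zero integral_lebesgue[OF int2] Bochner_Integration.integral_add[OF W maj(1)] maj(2) weight_mass_def)
    also have "\<dots> = M\<^sup>2 * B * ((1 + sqrt t) * ?W + 3 * (1 / sqrt t)) / N"
      by (simp add: power2_eq_square)
    also have "\<dots> \<le> M\<^sup>2 * B * ((?W + 3) * ?s) / N"
    proof -
      have "(1 + sqrt t) * ?W \<le> ?s * ?W" using weight_mass_nonneg[where 'n='n] t by (intro mult_right_mono) auto
      moreover have "3 * (1 / sqrt t) \<le> 3 * ?s" using t by simp
      ultimately have "(1 + sqrt t) * ?W + 3 * (1 / sqrt t) \<le> (?W + 3) * ?s" unfolding distrib_right[of ?W 3] mult.commute[of ?W] by linarith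
      then show ?thesis using B(1) N by (intro divide_right_mono mult_left_mono) auto
    qed
    also have "\<dots> = (B * (?W + 3)) * (M\<^sup>2 * ?s) / N" by (simp only: mult_ac)
    also have "\<dots> \<le> C * (M\<^sup>2 * ?s) / N"
      using C(3) s0 N by (intro divide_right_mono mult_right_mono) auto
    finally show "\<bar>(LINT y|lebesgue. ?F y * oseen_kernel j h k t (x - y)) - profile j h k x * quad_moment f h k\<bar>
        \<le> C * M\<^sup>2 * ?s / norm x ^ (CARD('n) + 2)"
      by (simp only: N_def mult.assoc)
  qed (rule C(1))
qed

lemma heat_leray_div_bounds:
  "\<exists>C>0. \<forall>t>0. \<forall>f. \<forall>M\<ge>0. f \<in> borel_measurable lebesgue \<longrightarrow> (AE y in lebesgue. norm (f y) \<le> M * weight y) \<longrightarrow>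
     (\<forall>x::real^'n. \<bar>heat_leray_div t (\<lambda>y. tensor (f y) (f y)) x $ j\<bar> \<le> C * M\<^sup>2 * (1 + sqrt t + 1 / sqrt t) \<and>
       (1 \<le> norm x \<longrightarrow> \<bar>heat_leray_div t (\<lambda>y. tensor (f y) (f y)) x $ j - (\<Sum>h\<in>UNIV. \<Sum>k\<in>UNIV. profile j h k x * quad_moment f h k)\<bar>
          \<le> C * M\<^sup>2 * (1 + sqrt t + 1 / sqrt t) / norm x ^ (CARD('n) + 2)))"
proof -
  \<comment> \<open>Naming the statement lets one constant be chosen for each pair of indices; their
    sum serves all pairs.\<close>
  define P where "P C h k \<longleftrightarrow> (\<forall>t>0. \<forall>f. \<forall>M\<ge>0. f \<in> borel_measurable lebesgue \<longrightarrow> (AE y in lebesgue. norm (f y) \<le> M * weight y) \<longrightarrow>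
     (\<forall>x::real^'n. \<bar>LINT y|lebesgue. f y $ h * f y $ k * oseen_kernel j h k t (x - y)\<bar> \<le> C * M\<^sup>2 * (1 + sqrt t + 1 / sqrt t) \<and>
       (1 \<le> norm x \<longrightarrow> \<bar>(LINT y|lebesgue. f y $ h * f y $ k * oseen_kernel j h k t (x - y)) - profile j h k x * quad_moment f h k\<bar>
          \<le> C * M\<^sup>2 * (1 + sqrt t + 1 / sqrt t) / norm x ^ (CARD('n) + 2))))" for C h k
  have "\<exists>C. C > 0 \<and> P C h k" for h k
    using oseen_convolution_bounds[of h k j] unfolding P_def by auto
  then obtain c where c: "\<And>h k. c h k > 0" "\<And>h k. P (c h k) h k" by metis
  let ?C = "\<Sum>h\<in>UNIV. \<Sum>k\<in>UNIV. c h k"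
  show ?thesis
  proof (intro exI[of _ ?C] conjI allI impI)
    show "0 < ?C" by (intro sum_pos c) auto
    fix t M :: real and f :: "real^'n \<Rightarrow> real^'n" and x :: "real^'n"
    assume t: "0 < t" and M: "0 \<le> M" and f: "f \<in> borel_measurable lebesgue" and fM: "AE y in lebesgue. norm (f y) \<le> M * weight y"
    let ?s = "1 + sqrt t + 1 / sqrt t"
    let ?I = "\<lambda>h k. LINT y|lebesgue. f y $ h * f y $ k * oseen_kernel j h k t (x - y)"
    have eq: "heat_leray_div t (\<lambda>y. tensor (f y) (f y)) x $ j = (\<Sum>h\<in>UNIV. \<Sum>k\<in>UNIV. ?I h k)"
      using heat_leray_div_eq[of t "\<lambda>y. tensor (f y) (f y)" x j] t
      by (simp add: tensor_component integrable_product[OF f f fM fM M M])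
    have b1: "\<bar>?I h k\<bar> \<le> c h k * M\<^sup>2 * ?s" for h k
      using c(2)[of h k] t M f fM unfolding P_def by blast
    have "\<bar>\<Sum>h\<in>UNIV. \<Sum>k\<in>UNIV. ?I h k\<bar> \<le> (\<Sum>h\<in>UNIV. \<Sum>k\<in>UNIV. c h k * M\<^sup>2 * ?s)"
      by (intro order_trans[OF sum_abs] sum_mono b1)
    then show "\<bar>heat_leray_div t (\<lambda>y. tensor (f y) (f y)) x $ j\<bar> \<le> ?C * M\<^sup>2 * ?s"
      unfolding eq by (simp only: sum_distrib_right)
    assume x: "1 \<le> norm x"
    have b2: "\<bar>?I h k - profile j h k x * quad_moment f h k\<bar> \<le> c h k * M\<^sup>2 * ?s / norm x ^ (CARD('n) + 2)" for h k
      using c(2)[of h k] t M f fM x unfolding P_def by blast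
    have "\<bar>\<Sum>h\<in>UNIV. \<Sum>k\<in>UNIV. ?I h k - profile j h k x * quad_moment f h k\<bar>
        \<le> (\<Sum>h\<in>UNIV. \<Sum>k\<in>UNIV. c h k * M\<^sup>2 * ?s / norm x ^ (CARD('n) + 2))"
      by (intro order_trans[OF sum_abs] sum_mono b2)
    then show "\<bar>heat_leray_div t (\<lambda>y. tensor (f y) (f y)) x $ j - (\<Sum>h\<in>UNIV. \<Sum>k\<in>UNIV. profile j h k x * quad_moment f h k)\<bar>
        \<le> ?C * M\<^sup>2 * ?s / norm x ^ (CARD('n) + 2)"
      unfolding eq by (simp only: sum_distrib_right sum_divide_distrib sum_subtractf)
  qed
qed

text \<open>The weight is submultiplicative: \<open>1 + norm x\<close> is at most
  \<open>(1 + norm y) * (1 + norm (x - y))\<close>. One factor is paid by the decay of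
  \<open>a\<close>, the other by the Gaussian, uniformly for bounded times.\<close>

lemma heat_bound:
  fixes a :: "real^'n \<Rightarrow> real^'n"
  assumes \<theta>: "real CARD('n) + 1 \<le> \<theta>" and A: "0 \<le> A" "a \<in> borel_measurable lebesgue"
    "AE y in lebesgue. norm (a y) \<le> A * (1 + norm y) powr (- \<theta>)"
  shows "\<exists>C>0. \<forall>t x j. 0 < t \<and> t \<le> T1 \<longrightarrow> \<bar>heat t a x $ j\<bar> \<le> C * (1 + norm x) powr (- \<theta>)"
proof -
  \<comment> \<open>\<open>gauss_moment\<close> takes natural powers, so the exponent is rounded
    up.\<close>
  define m where "m = nat \<lceil>\<theta>\<rceil>"
  have m: "\<theta> \<le> real m" using \<theta> by (simp add: m_def)
  obtain C0 where C0: "C0 > 0" "\<And>s z. s > 0 \<Longrightarrow> norm (z::real^'n) ^ 0 * gauss s z \<le> C0 * sqrt s ^ 0 * gauss (2 * s) z"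
    using gauss_moment[of 0] by blast
  obtain Cm where Cm: "Cm > 0" "\<And>s z. s > 0 \<Longrightarrow> norm (z::real^'n) ^ m * gauss s z \<le> Cm * sqrt s ^ m * gauss (2 * s) z"
    using gauss_moment[of m] by blast
  \<comment> \<open>\<open>T1\<close> carries no sign assumption here; the absolute value keeps
    \<open>D\<close> positive.\<close>
  define D where "D = 2 ^ m * (C0 + Cm * sqrt \<bar>T1\<bar> ^ m)"
  have D: "D > 0" using C0(1) Cm(1) by (simp add: D_def add_pos_nonneg)
  have gw: "(1 + norm z) powr \<theta> * gauss t z \<le> D * gauss (2 * t) z" if t: "0 < t" "t \<le> T1" for t and z :: "real^'n"
  proof -
    have g: "0 \<le> gauss t z" "0 \<le> gauss (2 * t) z" using t by (auto intro: gauss_nonneg)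
    have "(1 + norm z) powr \<theta> \<le> (1 + norm z) powr real m" using m by (intro powr_mono) auto
    also have "\<dots> = (1 + norm z) ^ m" by (rule powr_realpow) (simp add: add_pos_nonneg)
    also have "\<dots> \<le> (2 * max 1 (norm z)) ^ m" by (intro power_mono) auto
    also have "\<dots> \<le> 2 ^ m * (1 + norm z ^ m)" unfolding power_mult_distrib by (intro mult_left_mono) (auto simp: max_def)
    finally have "(1 + norm z) powr \<theta> * gauss t z \<le> 2 ^ m * (1 + norm z ^ m) * gauss t z" using g by (intro mult_right_mono)
    also have "\<dots> = 2 ^ m * (gauss t z + norm z ^ m * gauss t z)" by (simp add: algebra_simps)
    also have "\<dots> \<le> 2 ^ m * (C0 * gauss (2 * t) z + Cm * sqrt t ^ m * gauss (2 * t) z)"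
      using C0(2)[OF t(1), of z] Cm(2)[OF t(1), of z] by (intro mult_left_mono add_mono) auto
    also have "\<dots> \<le> 2 ^ m * (C0 * gauss (2 * t) z + Cm * sqrt \<bar>T1\<bar> ^ m * gauss (2 * t) z)"
      using t g Cm(1) by (intro mult_left_mono add_mono mult_right_mono power_mono real_sqrt_le_mono) auto
    also have "\<dots> = D * gauss (2 * t) z" by (simp add: D_def algebra_simps)
    finally show ?thesis .
  qed
  have meas: "(\<lambda>y. a y $ j) \<in> borel_measurable lebesgue" for j by (intro measurable_component A)
  have inta: "integrable lebesgue (\<lambda>y. a y $ j)" for j
  proof (rule abs_integral_le(1)[OF meas])
    show "integrable lebesgue (\<lambda>y::real^'n. A * weight y)" by (intro integrable_mult_right integrable_lebesgue integrable_weight)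
    show "AE y in lebesgue. \<bar>a y $ j\<bar> \<le> A * weight y"
      using A(3)
    proof eventually_elim
      case (elim y)
      have "(1 + norm y) powr (- \<theta>) \<le> weight y" unfolding powr_weight[symmetric] using \<theta> by (intro powr_mono) auto
      then show ?case using elim component_le_norm_cart[of "a y" j] A(1) mult_left_mono[of _ "weight y" A] by fastforce
    qed
  qed
  show ?thesis
  proof (intro exI[of _ "A * D + 1"] conjI allI impI)
    show "0 < A * D + 1" using A(1) D by (simp add: add_nonneg_pos)
    fix t :: real and x :: "real^'n" and j assume t: "0 < t \<and> t \<le> T1"
    let ?X = "(1 + norm x) powr (- \<theta>)"
    have intg: "integrable lborel (\<lambda>y. gauss (2 * t) (x - y))" "(LINT y|lborel. gauss (2 * t) (x - y)) = 1"
      using integral_gauss[of "2 * t", where 'n='n] t by (auto simp: integrable_reflect integral_reflect)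
    have "\<bar>LINT y|lebesgue. a y $ j * gauss t (x - y)\<bar> \<le> (LINT y|lebesgue. A * D * ?X * gauss (2 * t) (x - y))"
    proof (rule abs_integral_le(2))
      show "(\<lambda>y. a y $ j * gauss t (x - y)) \<in> borel_measurable lebesgue"
        using integrable_heat[of t a j x] t inta by auto
      show "integrable lebesgue (\<lambda>y. A * D * ?X * gauss (2 * t) (x - y))"
        by (intro integrable_mult_right integrable_lebesgue intg)
      show "AE y in lebesgue. \<bar>a y $ j * gauss t (x - y)\<bar> \<le> A * D * ?X * gauss (2 * t) (x - y)"
        using A(3)
      proof eventually_elim
        case (elim y)
        have g: "0 \<le> gauss t (x - y)" using t by (auto intro: gauss_nonneg)
        have pos: "0 < 1 + norm x" "0 < 1 + norm y" "0 < 1 + norm (x - y)" by (auto intro: add_pos_nonneg)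
        have "(1 + norm y) * (1 + norm (x - y)) = 1 + norm y + norm (x - y) + norm y * norm (x - y)"
          by (simp add: algebra_simps)
        moreover have "0 \<le> norm y * norm (x - y)" by simp
        ultimately have "1 + norm x \<le> (1 + norm y) * (1 + norm (x - y))"
          using norm_triangle_sub[of x y] by linarith
        then have "(1 + norm x) powr \<theta> \<le> ((1 + norm y) * (1 + norm (x - y))) powr \<theta>" using pos \<theta> by (intro powr_mono2) auto
        then have "(1 + norm x) powr \<theta> \<le> (1 + norm y) powr \<theta> * (1 + norm (x - y)) powr \<theta>" using pos by (simp add: powr_mult)
        then have sub: "(1 + norm y) powr (- \<theta>) \<le> ?X * (1 + norm (x - y)) powr \<theta>" using pos by (simp add: powr_minus field_simps)
        have "\<bar>a y $ j * gauss t (x - y)\<bar> = \<bar>a y $ j\<bar> * gauss t (x - y)" using g by (simp add: abs_mult)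
        also have "\<dots> \<le> A * (1 + norm y) powr (- \<theta>) * gauss t (x - y)"
          using elim component_le_norm_cart[of "a y" j] g by (intro mult_right_mono) auto
        also have "\<dots> \<le> A * (?X * (1 + norm (x - y)) powr \<theta>) * gauss t (x - y)"
          using A(1) g sub by (intro mult_right_mono mult_left_mono) auto
        also have "\<dots> = A * ?X * ((1 + norm (x - y)) powr \<theta> * gauss t (x - y))" by (simp only: mult_ac)
        also have "\<dots> \<le> A * ?X * (D * gauss (2 * t) (x - y))" using gw[of t "x - y"] t A(1) by (intro mult_left_mono) auto
        finally show ?case by (simp only: mult_ac)
      qed
    qed
    also have "\<dots> = A * D * ?X" by (simp only: integral_mult_right_zero integral_lebesgue[OF intg(1)] intg(2) mult_1_right)
    also have "\<dots> \<le> (A * D + 1) * ?X" by (intro mult_right_mono) auto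
    finally show "\<bar>heat t a x $ j\<bar> \<le> (A * D + 1) * ?X"
      using heat_eq[of t a j x] t inta by simp
  qed
qed

subsection \<open>Continuity in time\<close>

text \<open>The difference of the products splits as f (f - g) + (f - g) g, entry by entry.\<close>

lemma product_difference_L1:
  fixes f g :: "real^'n \<Rightarrow> real^'n"
  assumes f: "f \<in> borel_measurable lebesgue" "AE y in lebesgue. norm (f y) \<le> M * weight y"
    and g: "g \<in> borel_measurable lebesgue" "AE y in lebesgue. norm (g y) \<le> M * weight y"
    and d: "AE y in lebesgue. norm (f y - g y) \<le> \<delta> * weight y" and M: "0 \<le> M" "0 \<le> \<delta>"
  shows "(LINT y|lebesgue. \<bar>f y $ h * f y $ k - g y $ h * g y $ k\<bar>) \<le> 2 * M * \<delta> * weight_mass TYPE('n)"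
proof -
  have fg: "(\<lambda>y. f y - g y) \<in> borel_measurable lebesgue" using f g by simp
  let ?A = "\<lambda>y. f y $ h * (f y - g y) $ k" and ?B = "\<lambda>y. (f y - g y) $ h * g y $ k"
  have iA: "integrable lebesgue ?A" "(LINT y|lebesgue. \<bar>?A y\<bar>) \<le> M * \<delta> * weight_mass TYPE('n)"
    by (rule integrable_product[OF f(1) fg f(2) d M] integral_abs_product[OF f(1) fg f(2) d M])+
  have iB: "integrable lebesgue ?B" "(LINT y|lebesgue. \<bar>?B y\<bar>) \<le> \<delta> * M * weight_mass TYPE('n)"
    by (rule integrable_product[OF fg g(1) d g(2) M(2,1)] integral_abs_product[OF fg g(1) d g(2) M(2,1)])+
  have eq: "f y $ h * f y $ k - g y $ h * g y $ k = ?A y + ?B y" for y by (simp add: algebra_simps)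
  have "(LINT y|lebesgue. \<bar>f y $ h * f y $ k - g y $ h * g y $ k\<bar>) \<le> (LINT y|lebesgue. \<bar>?A y\<bar> + \<bar>?B y\<bar>)"
    unfolding eq using iA(1) iB(1) by (intro integral_mono) auto
  also have "\<dots> = (LINT y|lebesgue. \<bar>?A y\<bar>) + (LINT y|lebesgue. \<bar>?B y\<bar>)"
    using iA(1) iB(1) by (intro Bochner_Integration.integral_add) auto
  also have "\<dots> \<le> 2 * M * \<delta> * weight_mass TYPE('n)" using iA(2) iB(2) by (simp add: mult_ac)
  finally show ?thesis .
qed

text \<open>Turns continuity in the weighted norm into L1 continuity of the products, which controls
  both their integrals and, uniformly in frequency, their Fourier transforms.\<close>

lemma Cw_L1_continuous:
  fixes u :: "real \<Rightarrow> real^'n \<Rightarrow> real^'n"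
  assumes u: "u \<in> Cw T (real CARD('n) + 1)" and s: "0 < s" "ereal s < T"
    and M: "0 \<le> M" "\<And>r. 0 \<le> r \<Longrightarrow> r \<le> t \<Longrightarrow> AE y in lebesgue. norm (u r y) \<le> M * weight y" and t: "s < t" "ereal t < T"
  shows "((\<lambda>r. LINT y|lebesgue. \<bar>u r y $ h * u r y $ k - u s y $ h * u s y $ k\<bar>) \<longlongrightarrow> 0) (at s)"
proof (rule tendstoI)
  fix e :: real assume e: "0 < e"
  let ?W = "weight_mass TYPE('n)"
  \<comment> \<open>The added 1 keeps the divisor in \<open>\<delta>\<close> positive even when
    \<open>M\<close> is zero.\<close>
  define Z where "Z = 2 * M * ?W + 1"
  define \<delta> where "\<delta> = e / (2 * Z)"
  have p: "Z > 0" unfolding Z_def using M(1) weight_mass_nonneg[where 'n='n] by (simp add: add_nonneg_pos)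
  then have \<delta>: "\<delta> > 0" using e by (simp add: \<delta>_def)
  have meas: "u r \<in> borel_measurable lebesgue" if "0 \<le> r" "r \<le> t" for r
  proof -
    have "ereal r < T" using that t by (meson ereal_less_eq(3) le_less_trans)
    then show ?thesis using u that by (auto simp: Cw_def weighted_Linfty_def)
  qed
  have "((\<lambda>r. weighted_norm (real CARD('n) + 1) (\<lambda>x. u r x - u s x)) \<longlongrightarrow> 0) (at s)"
    using u s by (auto simp: Cw_def)
  then have "eventually (\<lambda>r. weighted_norm (real CARD('n) + 1) (\<lambda>x. u r x - u s x) < ennreal \<delta>) (at s)"
    using \<delta> by (intro order_tendstoD) auto
  moreover have "eventually (\<lambda>r. r \<in> {0<..<t}) (at s)"
    using s t by (intro eventually_at_in_open') auto
  ultimately show "eventually (\<lambda>r. dist (LINT y|lebesgue. \<bar>u r y $ h * u r y $ k - u s y $ h * u s y $ k\<bar>) 0 < e) (at s)"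
  proof eventually_elim
    case (elim r)
    have "AE y in lebesgue. norm (u r y - u s y) \<le> \<delta> * weight y"
      using weighted_norm_AE[of "real CARD('n) + 1" "\<lambda>x. u r x - u s x" \<delta>] elim \<delta> by (simp only: powr_weight less_imp_le)
    then have "(LINT y|lebesgue. \<bar>u r y $ h * u r y $ k - u s y $ h * u s y $ k\<bar>) \<le> 2 * M * \<delta> * ?W"
      using elim s t M \<delta> by (intro product_difference_L1 meas) auto
    also have "\<dots> \<le> Z * \<delta>" using \<delta> by (simp add: Z_def algebra_simps)
    also have "\<dots> = e / 2" using p by (simp add: \<delta>_def)
    also have "\<dots> < e" using e by simp
    finally show ?case by (simp add: dist_real_def)
  qed
qed

lemma fourier_diff_le:
  assumes "integrable lebesgue f" "integrable lebesgue g"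
  shows "norm (fourier f \<xi> - fourier g \<xi>) \<le> (LINT x|lebesgue. \<bar>f x - g x\<bar>)"
proof -
  note borel_measurable_ident_lebesgue [measurable]
  have i: "integrable lebesgue (\<lambda>x. complex_of_real (f x) * cis (- (x \<bullet> \<xi>)))" if "integrable lebesgue f" for f
  proof -
    have [measurable]: "f \<in> borel_measurable lebesgue" using that by auto
    show ?thesis by (rule Bochner_Integration.integrable_bound[OF that]) (auto simp: norm_mult)
  qed
  have "fourier f \<xi> - fourier g \<xi> = fourier (\<lambda>x. f x - g x) \<xi>"
    unfolding fourier_def by (subst Bochner_Integration.integral_diff[symmetric]) (auto intro: i assms simp: algebra_simps)
  then show ?thesis using norm_fourier_le[of "\<lambda>x. f x - g x" \<xi>] by simp
qed

text \<open>Supplies the measurability in \<open>s\<close> on which the splitting of the Duhamel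
  integral rests. On the Fourier side it is dominated convergence: the heat symbol is continuous in
  time and the transforms of the products are bounded and continuous in \<open>s\<close>.\<close>

lemma continuous_on_heat_leray_div:
  fixes u :: "real \<Rightarrow> real^'n \<Rightarrow> real^'n"
  assumes u: "u \<in> Cw T (real CARD('n) + 1)" and t: "0 < t" "ereal t < T"
    and M: "0 \<le> M" "\<And>r. 0 \<le> r \<Longrightarrow> r \<le> t \<Longrightarrow> AE y in lebesgue. norm (u r y) \<le> M * weight y"
  shows "continuous_on {0<..<t} (\<lambda>s. heat_leray_div (t - s) (\<lambda>y. tensor (u s y) (u s y)) x $ j)"
    and "continuous_on {0<..<t} (\<lambda>s. quad_moment (u s) h k)"
proof -
  let ?W = "weight_mass TYPE('n)"
  have meas: "u r \<in> borel_measurable lebesgue" if "0 \<le> r" "r \<le> t" for r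
  proof -
    have "ereal r < T" using that t by (meson ereal_less_eq(3) le_less_trans)
    then show ?thesis using u that by (auto simp: Cw_def weighted_Linfty_def)
  qed
  let ?F = "\<lambda>s h k y. u s y $ h * u s y $ k"
  have int: "integrable lebesgue (?F s h k)" if "0 \<le> s" "s \<le> t" for s h k
    using that by (intro integrable_product[OF meas meas M(2) M(2) M(1) M(1)]) auto
  have L1: "((\<lambda>r. LINT y|lebesgue. \<bar>?F r h k y - ?F s h k y\<bar>) \<longlongrightarrow> 0) (at s)" if "0 < s" "s < t" for s h k
    using that t by (intro Cw_L1_continuous[OF u _ _ M]) (auto intro: less_trans[of _ "ereal t"])
  show "continuous_on {0<..<t} (\<lambda>s. quad_moment (u s) h k)"
    unfolding continuous_on_eq_continuous_at[OF open_greaterThanLessThan]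
  proof
    fix s assume s: "s \<in> {0<..<t}"
    have "((\<lambda>r. quad_moment (u r) h k - quad_moment (u s) h k) \<longlongrightarrow> 0) (at s)"
    proof (rule Lim_null_comparison[OF _ L1[of s h k]])
      have "eventually (\<lambda>r. r \<in> {0<..<t}) (at s)" using s by (intro eventually_at_in_open') auto
      then show "eventually (\<lambda>r. norm (quad_moment (u r) h k - quad_moment (u s) h k) \<le> (LINT y|lebesgue. \<bar>?F r h k y - ?F s h k y\<bar>)) (at s)"
      proof eventually_elim
        case (elim r)
        have "quad_moment (u r) h k - quad_moment (u s) h k = (LINT y|lebesgue. ?F r h k y - ?F s h k y)"
          unfolding quad_moment_def using elim s by (subst Bochner_Integration.integral_diff) (auto intro!: int)
        then show ?case using integral_norm_bound[of lebesgue "\<lambda>y. ?F r h k y - ?F s h k y"] by simp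
      qed
    qed (use s in auto)
    then show "isCont (\<lambda>s. quad_moment (u s) h k) s" by (simp add: isCont_def LIM_zero_iff)
  qed
  have B: "norm (fourier (?F s h k) \<xi>) \<le> M * M * ?W" if "0 \<le> s" "s \<le> t" for s h k \<xi>
    using that by (intro order_trans[OF norm_fourier_le integral_abs_product[OF meas meas M(2) M(2) M(1) M(1)]]) auto
  let ?g = "\<lambda>h k s \<xi>. heat_symbol (t - s) \<xi> * leray_symbol j h k \<xi> * fourier (?F s h k) \<xi>"
  have cont: "continuous_on {0<..<t} (\<lambda>s. inverse_fourier (?g h k s) x)" for h k
  proof -
    \<comment> \<open>Staying below some \<open>t' < t\<close> keeps the heat time above
      \<open>t - t'\<close>, so the symbol at \<open>t - t'\<close> dominates; as
      \<open>t - s\<close> tends to 0 this domination is lost. The intervals exhaust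
      \<open>{0<..<t}\<close>.\<close>
    have "continuous_on {0<..<t'} (\<lambda>s. inverse_fourier (?g h k s) x)" if t': "t' < t" for t'
    proof (unfold continuous_on_sequentially comp_def, intro allI ballI impI)
      fix S :: "nat \<Rightarrow> real" and s assume s: "s \<in> {0<..<t'}" and S: "(\<forall>n. S n \<in> {0<..<t'}) \<and> S \<longlonglongrightarrow> s"
      have ti: "0 < t - r" "0 \<le> r" "r \<le> t" if "r \<in> {0<..<t'}" for r using that t' by auto
      have ig: "integrable lborel (?g h k r)" if "r \<in> {0<..<t'}" for r
        using ti[OF that] by (intro integrable_mult_fourier integrable_heat_leray_symbol int) auto
      have mg: "(\<lambda>\<xi>. ?g h k r \<xi> * cis (x \<bullet> \<xi>)) \<in> borel_measurable lebesgue" if "r \<in> {0<..<t'}" for r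
        using borel_measurable_integrable[OF ig[OF that]]
        by - (rule measurable_completion, rule borel_measurable_times, assumption, measurable)
      have "(\<lambda>n. LINT \<xi>|lebesgue. ?g h k (S n) \<xi> * cis (x \<bullet> \<xi>)) \<longlonglongrightarrow> (LINT \<xi>|lebesgue. ?g h k s \<xi> * cis (x \<bullet> \<xi>))"
      proof (rule integral_dominated_convergence)
        show "integrable lebesgue (\<lambda>\<xi>. norm (heat_symbol (t - t') \<xi> * leray_symbol j h k \<xi>) * (M * M * ?W))"
          using t' by (intro integrable_mult_left integrable_norm integrable_lebesgue integrable_heat_leray_symbol) auto
        show "AE \<xi> in lebesgue. norm (?g h k (S n) \<xi> * cis (x \<bullet> \<xi>)) \<le> norm (heat_symbol (t - t') \<xi> * leray_symbol j h k \<xi>) * (M * M * ?W)" for n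
        proof (intro AE_I2)
          fix \<xi> :: "real^'n"
          have Sn: "S n \<in> {0<..<t'}" using S by auto
          have "norm (heat_symbol (t - S n) \<xi>) \<le> norm (heat_symbol (t - t') \<xi>)"
            unfolding norm_heat_symbol using Sn by (simp add: mult_right_mono)
          then show "norm (?g h k (S n) \<xi> * cis (x \<bullet> \<xi>)) \<le> norm (heat_symbol (t - t') \<xi> * leray_symbol j h k \<xi>) * (M * M * ?W)"
            unfolding norm_mult norm_cis mult_1_right using ti[OF Sn] B[of "S n" h k \<xi>]
            by (intro mult_mono mult_right_mono) auto
        qed
        show "AE \<xi> in lebesgue. (\<lambda>n. ?g h k (S n) \<xi> * cis (x \<bullet> \<xi>)) \<longlonglongrightarrow> ?g h k s \<xi> * cis (x \<bullet> \<xi>)"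
        proof (intro AE_I2 tendsto_mult tendsto_const)
          fix \<xi> :: "real^'n"
          show "(\<lambda>n. heat_symbol (t - S n) \<xi>) \<longlonglongrightarrow> heat_symbol (t - s) \<xi>"
            unfolding heat_symbol_def using S by (intro tendsto_intros) auto
          have "((\<lambda>r. fourier (?F r h k) \<xi>) \<longlongrightarrow> fourier (?F s h k) \<xi>) (at s)"
          proof (rule Lim_transform_bound[THEN LIM_zero_cancel, rotated])
            show "((\<lambda>r. LINT y|lebesgue. \<bar>?F r h k y - ?F s h k y\<bar>) \<longlongrightarrow> 0) (at s)" using s t' by (intro L1) auto
            have "eventually (\<lambda>r. r \<in> {0<..<t'}) (at s)" using s by (intro eventually_at_in_open') auto
            then show "eventually (\<lambda>r. norm (fourier (?F r h k) \<xi> - fourier (?F s h k) \<xi>) \<le> norm (LINT y|lebesgue. \<bar>?F r h k y - ?F s h k y\<bar>)) (at s)"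
            proof eventually_elim
              case (elim r)
              then show ?case using fourier_diff_le[OF int[of r h k] int[of s h k], of \<xi>] s t' by auto
            qed
          qed
          then have "isCont (\<lambda>r. fourier (?F r h k) \<xi>) s" by (simp add: isCont_def)
          then show "(\<lambda>n. fourier (?F (S n) h k) \<xi>) \<longlonglongrightarrow> fourier (?F s h k) \<xi>"
            using S by (intro isCont_tendsto_compose[of s "\<lambda>r. fourier (?F r h k) \<xi>"]) auto
        qed
      qed (use mg s S in auto)
      then show "(\<lambda>n. inverse_fourier (?g h k (S n)) x) \<longlonglongrightarrow> inverse_fourier (?g h k s) x"
        unfolding inverse_fourier_def by (intro tendsto_divide tendsto_const) auto
    qed
    then have "continuous_on (\<Union>t'\<in>{..<t}. {0<..<t'}) (\<lambda>s. inverse_fourier (?g h k s) x)"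
      by (intro continuous_on_open_UN) auto
    moreover have "(\<Union>t'\<in>{..<t}. {0<..<t'}) = {0<..<t}"
      by (auto intro: less_trans) (meson dense lessThan_iff)
    ultimately show ?thesis by simp
  qed
  have eq: "heat_leray_div (t - s) (\<lambda>y. tensor (u s y) (u s y)) x $ j = (\<Sum>h\<in>UNIV. \<Sum>k\<in>UNIV. Re (inverse_fourier (?g h k s) x))"
    if "s \<in> {0<..<t}" for s
    using heat_leray_div_fourier[of "t - s" "\<lambda>y. tensor (u s y) (u s y)" x j] that int[of s]
    by (simp add: tensor_component)
  have "continuous_on {0<..<t} (\<lambda>s. \<Sum>h\<in>UNIV. \<Sum>k\<in>UNIV. Re (inverse_fourier (?g h k s) x))"
    by (intro continuous_on_sum continuous_on_Re cont)
  then show "continuous_on {0<..<t} (\<lambda>s. heat_leray_div (t - s) (\<lambda>y. tensor (u s y) (u s y)) x $ j)"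
    by (rule continuous_on_eq) (rule eq[symmetric])
qed

section \<open>Time integrals with a square-root singularity at the final time\<close>

lemma integral_inverse_sqrt_reflected:
  fixes t :: real
  assumes "0 < t"
  shows "set_integrable lborel {0<..<t} (\<lambda>s. 1 / sqrt (t - s))"
    and "(LINT s:{0<..<t}|lborel. 1 / sqrt (t - s)) = 2 * sqrt t"
proof -
  have "((\<lambda>s. - 2 * sqrt (t - s)) \<longlongrightarrow> - 2 * sqrt (t - 0)) (at_right 0)"
    by (intro tendsto_intros)
  moreover have "((\<lambda>s. - 2 * sqrt (t - s)) \<longlongrightarrow> - 2 * sqrt (t - t)) (at_left t)"
    by (intro tendsto_intros)
  moreover have "DERIV (\<lambda>s. - 2 * sqrt (t - s)) s :> 1 / sqrt (t - s)" if "s < t" for s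
    using that by (auto intro!: derivative_eq_intros simp: field_simps)
  moreover have "isCont (\<lambda>s. 1 / sqrt (t - s)) s" if "s < t" for s
    using that by (auto intro!: continuous_intros)
  ultimately show "set_integrable lborel {0<..<t} (\<lambda>s. 1 / sqrt (t - s))"
    "(LINT s:{0<..<t}|lborel. 1 / sqrt (t - s)) = 2 * sqrt t"
    using FTC_Ioo_nonneg[of 0 t "\<lambda>s. - 2 * sqrt (t - s)" "\<lambda>s. 1 / sqrt (t - s)" "- 2 * sqrt (t - 0)" "- 2 * sqrt (t - t)"] assms
    by simp_all
qed

text \<open>Continuity on the open interval gives measurability, and the singularity at
  \<open>s = t\<close> is of the order produced by the kernel.\<close>

lemma set_integral_bound_inverse_sqrt:
  fixes f :: "real \<Rightarrow> real"
  assumes t: "0 < t" and cont: "continuous_on {0<..<t} f"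
    and le: "\<And>s. 0 < s \<Longrightarrow> s < t \<Longrightarrow> \<bar>f s\<bar> \<le> B / sqrt (t - s)"
  shows "set_integrable lborel {0<..<t} f" "\<bar>LINT s:{0<..<t}|lborel. f s\<bar> \<le> B * (2 * sqrt t)"
proof -
  have m: "(\<lambda>s. indicator {0<..<t} s *\<^sub>R f s) \<in> borel_measurable lborel"
    using borel_measurable_continuous_on_indicator[OF _ cont] by simp
  have i: "integrable lborel (\<lambda>s. B * (indicator {0<..<t} s *\<^sub>R (1 / sqrt (t - s))))"
    using integral_inverse_sqrt_reflected(1)[OF t] unfolding set_integrable_def by (rule integrable_mult_right)
  have AE: "AE s in lborel. \<bar>indicator {0<..<t} s *\<^sub>R f s\<bar> \<le> B * (indicator {0<..<t} s *\<^sub>R (1 / sqrt (t - s)))"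
    using le by (intro AE_I2) (auto simp: indicator_def)
  show "set_integrable lborel {0<..<t} f"
    unfolding set_integrable_def by (rule abs_integral_le(1)[OF m i AE])
  have "\<bar>LINT s:{0<..<t}|lborel. f s\<bar> \<le> (LINT s|lborel. B * (indicator {0<..<t} s *\<^sub>R (1 / sqrt (t - s))))"
    unfolding set_lebesgue_integral_def by (rule abs_integral_le(2)[OF m i AE])
  also have "\<dots> = B * (2 * sqrt t)"
    unfolding integral_mult_right_zero set_lebesgue_integral_def[symmetric] integral_inverse_sqrt_reflected(2)[OF t] ..
  finally show "\<bar>LINT s:{0<..<t}|lborel. f s\<bar> \<le> B * (2 * sqrt t)" .
qed

text \<open>All components are assumed integrable, not only the \<open>j\<close>-th: the vector
  integral defaults to 0 when the vector function is not integrable, and then its components could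
  differ from the scalar integrals.\<close>

lemma set_integral_vec_nth:
  fixes f :: "real \<Rightarrow> real^'n"
  assumes "\<And>j. set_integrable lborel A (\<lambda>s. f s $ j)"
  shows "(LINT s:A|lebesgue. f s) $ j = (LINT s:A|lborel. f s $ j)"
proof -
  have "integrable lborel (\<lambda>s. \<Sum>j\<in>UNIV. (indicator A s *\<^sub>R f s $ j) *\<^sub>R axis j (1::real))"
    using assms unfolding set_integrable_def
    by (intro Bochner_Integration.integrable_sum integrable_scaleR_left) auto
  moreover have "(\<Sum>j\<in>UNIV. (indicator A s *\<^sub>R f s $ j) *\<^sub>R axis j (1::real)) = indicator A s *\<^sub>R f s" for s
    by (simp add: vec_eq_iff axis_def if_distrib sum.delta cong: if_cong)
  ultimately have i: "integrable lborel (\<lambda>s. indicator A s *\<^sub>R f s)" by simp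
  have "(LINT s:A|lebesgue. f s) $ j = (LINT s|lborel. indicator A s *\<^sub>R f s) $ j"
    unfolding set_lebesgue_integral_def integral_lebesgue[OF i] ..
  also have "\<dots> = (LINT s|lborel. (indicator A s *\<^sub>R f s) $ j)"
    using integral_bounded_linear[OF bounded_linear_vec_nth i] by metis
  finally show ?thesis by (simp add: set_lebesgue_integral_def)
qed

subsection \<open>Asymptotics of the solution\<close>

lemma sum_profile_eq_cubic:
  fixes K :: "real^'n^'n"
  assumes "x \<noteq> 0"
  shows "(\<Sum>h\<in>UNIV. \<Sum>k\<in>UNIV. profile j h k x * K $ h $ k)
    = cubic (profile_const CARD('n) 2 / 4) (profile_const CARD('n) 3 / 8) K j x / norm x ^ (CARD('n) + 4)"
proof -
  have "profile j h k x = (profile_const CARD('n) 2 / 4 * (norm x)\<^sup>2 * sym_delta j h k x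
      - profile_const CARD('n) 3 / 8 * (x $ j * x $ h * x $ k)) / norm x ^ (CARD('n) + 4)" for h k
  proof -
    have "profile_const CARD('n) 2 / 4 * sym_delta j h k x / norm x ^ (CARD('n) + 2)
        = profile_const CARD('n) 2 / 4 * (norm x)\<^sup>2 * sym_delta j h k x / norm x ^ (CARD('n) + 4)"
      using assms by (simp add: power_add eval_nat_numeral)
    then show ?thesis unfolding profile_def by (simp only: diff_divide_distrib)
  qed
  then show ?thesis
    unfolding cubic_def sum_divide_distrib by (intro sum.cong refl) simp
qed

text \<open>\<open>C\<close> is chosen before \<open>t\<close>, and only \<open>K\<close> depends on
  \<open>t\<close>. The profile enters with a plus sign because the Duhamel term is subtracted in
  the mild formulation.\<close>

lemma solution_asymptotics:
  fixes a :: "real^'n \<Rightarrow> real^'n" and u :: "real \<Rightarrow> real^'n \<Rightarrow> real^'n"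
  assumes \<epsilon>: "0 < \<epsilon>" "\<epsilon> < 1"
    and a: "a \<in> weighted_Linfty (real CARD('n) + 1 + \<epsilon>)"
    and u: "u \<in> Cw T (real CARD('n) + 1)" and mild: "mild_solution T a u"
    and T1: "0 < T1" "ereal T1 < T"
  shows "\<exists>C>0. \<forall>t. 0 < t \<and> t \<le> T1 \<longrightarrow> (\<exists>K::real^'n^'n. (\<forall>h k. K $ h $ k = K $ k $ h) \<and>
    (\<forall>x j. \<bar>u t x $ j\<bar> \<le> C \<and> (1 \<le> norm x \<longrightarrow>
       \<bar>u t x $ j + (\<Sum>h\<in>UNIV. \<Sum>k\<in>UNIV. profile j h k x * K $ h $ k)\<bar>
         \<le> C * (1 + norm x) powr (- (real CARD('n) + 1 + \<epsilon>)))))"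
proof -
  let ?\<theta> = "real CARD('n) + 1 + \<epsilon>"
  let ?W = "weight_mass TYPE('n)"
  have "\<exists>M0. \<forall>t\<in>{0..T1}. weighted_norm (real CARD('n) + 1) (u t) \<le> ennreal M0"
    using u T1 unfolding Cw_def by (simp add: less_imp_le)
  then obtain M0 where M0: "\<And>t. t \<in> {0..T1} \<Longrightarrow> weighted_norm (real CARD('n) + 1) (u t) \<le> ennreal M0"
    by blast
  define M where "M = max 0 M0"
  have M: "0 \<le> M" by (simp add: M_def)
  have uM: "AE y in lebesgue. norm (u r y) \<le> M * weight y" if "0 \<le> r" "r \<le> T1" for r
  proof -
    have "weighted_norm (real CARD('n) + 1) (u r) \<le> ennreal M"
      using that by (intro order_trans[OF M0]) (auto simp: M_def intro!: ennreal_leI)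
    from weighted_norm_AE[OF this M] show ?thesis by (simp only: powr_weight)
  qed
  have meas: "u r \<in> borel_measurable lebesgue" if "0 \<le> r" "r \<le> T1" for r
  proof -
    have "ereal r < T" using that T1 by (meson ereal_less_eq(3) le_less_trans)
    then show ?thesis using u that by (auto simp: Cw_def weighted_Linfty_def)
  qed
  obtain A where A: "0 \<le> A" "weighted_norm ?\<theta> a \<le> ennreal A" and am: "a \<in> borel_measurable lebesgue"
  proof -
    have fin: "weighted_norm ?\<theta> a < \<top>" and m: "a \<in> borel_measurable lebesgue"
      using a by (auto simp: weighted_Linfty_def)
    show ?thesis by (rule that[of "enn2real (weighted_norm ?\<theta> a)"]) (use fin m in auto)
  qed
  obtain C1 where C1: "C1 > 0" "\<And>t x j. 0 < t \<Longrightarrow> t \<le> T1 \<Longrightarrow> \<bar>heat t a x $ j\<bar> \<le> C1 * (1 + norm x) powr (- ?\<theta>)"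
    using heat_bound[of ?\<theta> A a T1] \<epsilon> A am weighted_norm_AE[OF A(2,1)] by auto
  define P where "P C j \<longleftrightarrow> (\<forall>t>0. \<forall>f. \<forall>M\<ge>0. f \<in> borel_measurable lebesgue \<longrightarrow> (AE y in lebesgue. norm (f y) \<le> M * weight y) \<longrightarrow>
     (\<forall>x::real^'n. \<bar>heat_leray_div t (\<lambda>y. tensor (f y) (f y)) x $ j\<bar> \<le> C * M\<^sup>2 * (1 + sqrt t + 1 / sqrt t) \<and>
       (1 \<le> norm x \<longrightarrow> \<bar>heat_leray_div t (\<lambda>y. tensor (f y) (f y)) x $ j - (\<Sum>h\<in>UNIV. \<Sum>k\<in>UNIV. profile j h k x * quad_moment f h k)\<bar>
          \<le> C * M\<^sup>2 * (1 + sqrt t + 1 / sqrt t) / norm x ^ (CARD('n) + 2))))" for C j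
  have "\<exists>C. C > 0 \<and> P C j" for j
    using heat_leray_div_bounds[of j] unfolding P_def by auto
  then obtain c where c: "\<And>j. c j > 0" "\<And>j. P (c j) j" by metis
  \<comment> \<open>From \<open>1 + sqrt r + 1 / sqrt r = (sqrt r + r + 1) / sqrt r\<close>, with
    the numerator bounded at \<open>r = T1\<close>; the constants \<open>c j\<close> are added up to
    be independent of the component.\<close>
  define B where "B = (\<Sum>j\<in>UNIV. c j) * M\<^sup>2 * (1 + sqrt T1 + T1)"
  have B: "0 \<le> B" using c(1) T1 unfolding B_def by (intro mult_nonneg_nonneg sum_nonneg) (auto simp: less_imp_le)
  have cB: "c j * M\<^sup>2 * (1 + sqrt r + 1 / sqrt r) \<le> B / sqrt r" if "0 < r" "r \<le> T1" for r j
  proof -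
    have "1 + sqrt r + 1 / sqrt r = (sqrt r + r + 1) / sqrt r" using that by (simp add: add_divide_distrib real_div_sqrt)
    also have "\<dots> \<le> (1 + sqrt T1 + T1) / sqrt r" using that by (intro divide_right_mono) (auto intro: add_mono)
    finally have "c j * M\<^sup>2 * (1 + sqrt r + 1 / sqrt r) \<le> c j * M\<^sup>2 * ((1 + sqrt T1 + T1) / sqrt r)"
      using c(1)[of j] by (intro mult_left_mono) auto
    also have "\<dots> \<le> (\<Sum>j\<in>UNIV. c j) * M\<^sup>2 * ((1 + sqrt T1 + T1) / sqrt r)"
      using c(1) that T1 by (intro mult_right_mono member_le_sum) (auto simp: less_imp_le)
    finally show ?thesis by (simp add: B_def)
  qed
  define R where "R = B * (2 * sqrt T1)"
  have R: "0 \<le> R" using B T1 by (simp add: R_def)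
  define C where "C = C1 + R * 2 ^ (CARD('n) + 2)"
  have C: "C > 0" using C1(1) R by (simp add: C_def add_pos_nonneg)
  show ?thesis
  proof (intro exI[of _ C] conjI allI impI)
    fix t assume t: "0 < t \<and> t \<le> T1"
    have tT: "ereal t < T" using t T1 by (meson ereal_less_eq(3) le_less_trans)
    let ?H = "\<lambda>s x. heat_leray_div (t - s) (\<lambda>y. tensor (u s y) (u s y)) x"
    have uMt: "AE y in lebesgue. norm (u r y) \<le> M * weight y" if "0 \<le> r" "r \<le> t" for r
      using that t by (intro uM) auto
    note contH = continuous_on_heat_leray_div(1)[OF u conjunct1[OF t] tT M uMt]
    note contq = continuous_on_heat_leray_div(2)[OF u conjunct1[OF t] tT M uMt]
    have Hb: "\<bar>?H s x $ j\<bar> \<le> c j * M\<^sup>2 * (1 + sqrt (t - s) + 1 / sqrt (t - s)) \<and>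
        (1 \<le> norm x \<longrightarrow> \<bar>?H s x $ j - (\<Sum>h\<in>UNIV. \<Sum>k\<in>UNIV. profile j h k x * quad_moment (u s) h k)\<bar>
          \<le> c j * M\<^sup>2 * (1 + sqrt (t - s) + 1 / sqrt (t - s)) / norm x ^ (CARD('n) + 2))"
      if s: "0 < s" "s < t" for s x j
    proof -
      have "0 < t - s" "u s \<in> borel_measurable lebesgue" "AE y in lebesgue. norm (u s y) \<le> M * weight y"
        using s t meas[of s] uMt[of s] by auto
      then show ?thesis using c(2)[of j] M unfolding P_def by blast
    qed
    have H1: "\<bar>?H s x $ j\<bar> \<le> B / sqrt (t - s)" if "0 < s" "s < t" for s x j
    proof -
      have "\<bar>?H s x $ j\<bar> \<le> c j * M\<^sup>2 * (1 + sqrt (t - s) + 1 / sqrt (t - s))"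
        using Hb[OF that] by blast
      also have "\<dots> \<le> B / sqrt (t - s)" using that t by (intro cB) auto
      finally show ?thesis .
    qed
    \<comment> \<open>The moments are bounded; the bound is written with the singular factor, using
      \<open>t - s \<le> T1\<close>, to match
      \<open>set_integral_bound_inverse_sqrt\<close>.\<close>
    have q: "\<bar>quad_moment (u s) h k\<bar> \<le> (M * M * ?W * sqrt T1) / sqrt (t - s)" if "0 < s" "s < t" for s h k
    proof -
      have "\<bar>quad_moment (u s) h k\<bar> \<le> M * M * ?W"
      proof (rule order_trans[OF _ integral_abs_product[OF meas meas uM uM M M]])
        show "\<bar>quad_moment (u s) h k\<bar> \<le> (LINT y|lebesgue. \<bar>u s y $ h * u s y $ k\<bar>)"
          using integral_norm_bound[of lebesgue "\<lambda>y. u s y $ h * u s y $ k"] by (simp add: quad_moment_def)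
      qed (use that t in auto)
      also have "\<dots> \<le> M * M * ?W * (sqrt T1 / sqrt (t - s))"
        using that t M weight_mass_nonneg[where 'n='n] by (intro mult_left_mono[of 1 _ "M * M * ?W", simplified]) (auto simp: le_divide_eq)
      finally show ?thesis by simp
    qed
    have intq: "set_integrable lborel {0<..<t} (\<lambda>s. quad_moment (u s) h k)" for h k
      using t by (intro set_integral_bound_inverse_sqrt(1)[OF _ contq q]) auto
    have intH: "set_integrable lborel {0<..<t} (\<lambda>s. ?H s x $ j)" for x j
      using t by (intro set_integral_bound_inverse_sqrt(1)[OF _ contH H1]) auto
    have Rt: "B * (2 * sqrt t) \<le> R" unfolding R_def using B t by (intro mult_left_mono) auto
    define K :: "real^'n^'n" where "K = (\<chi> h k. LINT s:{0<..<t}|lborel. quad_moment (u s) h k)"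
    have sym: "K $ h $ k = K $ k $ h" for h k
      by (simp add: K_def quad_moment_def mult.commute)
    have ut: "u t x $ j = heat t a x $ j - (LINT s:{0<..<t}|lborel. ?H s x $ j)" for x j
    proof -
      have "u t x = heat t a x - (LINT s:{0<..<t}|lebesgue. ?H s x)"
        using mild t tT unfolding mild_solution_def by blast
      then show ?thesis using set_integral_vec_nth[OF intH] by simp
    qed
    have b1: "\<bar>u t x $ j\<bar> \<le> C" for x j
    proof -
      have "\<bar>LINT s:{0<..<t}|lborel. ?H s x $ j\<bar> \<le> R"
        using t by (intro order_trans[OF set_integral_bound_inverse_sqrt(2)[OF _ contH H1] Rt]) auto
      moreover have "R \<le> R * 2 ^ (CARD('n) + 2)" using mult_left_mono[OF one_le_power[of "2::real" "CARD('n) + 2"] R] by simp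
      moreover have "(1 + norm x) powr (- ?\<theta>) \<le> 1"
        using powr_mono[of "- ?\<theta>" 0 "1 + norm x"] \<epsilon> by (auto split: if_splits)
      then have "C1 * (1 + norm x) powr (- ?\<theta>) \<le> C1" using C1(1) by (simp add: mult_le_cancel_left1)
      ultimately show ?thesis using C1(2)[of t x j] t unfolding ut C_def by linarith
    qed
    have b2: "\<bar>u t x $ j + (\<Sum>h\<in>UNIV. \<Sum>k\<in>UNIV. profile j h k x * K $ h $ k)\<bar> \<le> C * (1 + norm x) powr (- ?\<theta>)"
      if x: "1 \<le> norm x" for x j
    proof -
      let ?X = "(1 + norm x) powr (- ?\<theta>)"
      let ?S = "\<lambda>s. \<Sum>h\<in>UNIV. \<Sum>k\<in>UNIV. profile j h k x * quad_moment (u s) h k"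
      let ?q = "\<lambda>s h k. indicator {0<..<t} s *\<^sub>R quad_moment (u s) h k"
      have iq: "integrable lborel (\<lambda>s. profile j h k x * ?q s h k)" for h k
        using intq unfolding set_integrable_def by (rule integrable_mult_right)
      have iSq: "indicator {0<..<t} s *\<^sub>R ?S s = (\<Sum>h\<in>UNIV. \<Sum>k\<in>UNIV. profile j h k x * ?q s h k)" for s
        by (simp add: sum_distrib_left mult.left_commute)
      have intS: "set_integrable lborel {0<..<t} ?S"
        unfolding set_integrable_def iSq by (intro Bochner_Integration.integrable_sum iq)
      have IS: "(LINT s:{0<..<t}|lborel. ?S s) = (\<Sum>h\<in>UNIV. \<Sum>k\<in>UNIV. profile j h k x * K $ h $ k)"
      proof -
        have "(LINT s:{0<..<t}|lborel. ?S s) = (\<Sum>h\<in>UNIV. LINT s|lborel. (\<Sum>k\<in>UNIV. profile j h k x * ?q s h k))"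
          unfolding set_lebesgue_integral_def iSq
          by (intro Bochner_Integration.integral_sum Bochner_Integration.integrable_sum iq)
        also have "\<dots> = (\<Sum>h\<in>UNIV. \<Sum>k\<in>UNIV. LINT s|lborel. profile j h k x * ?q s h k)"
          by (intro sum.cong refl Bochner_Integration.integral_sum iq)
        finally show ?thesis
          unfolding integral_mult_right_zero by (simp only: K_def set_lebesgue_integral_def vec_lambda_beta)
      qed
      have "\<bar>LINT s:{0<..<t}|lborel. ?H s x $ j - ?S s\<bar> \<le> (B / norm x ^ (CARD('n) + 2)) * (2 * sqrt t)"
      proof (rule set_integral_bound_inverse_sqrt(2))
        show "continuous_on {0<..<t} (\<lambda>s. ?H s x $ j - ?S s)"
          by (intro continuous_on_diff continuous_on_sum continuous_on_mult continuous_on_const contH contq)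
        fix s assume s: "0 < s" "s < t"
        have "\<bar>?H s x $ j - ?S s\<bar> \<le> c j * M\<^sup>2 * (1 + sqrt (t - s) + 1 / sqrt (t - s)) / norm x ^ (CARD('n) + 2)"
          using Hb[OF s] x by blast
        also have "\<dots> \<le> B / sqrt (t - s) / norm x ^ (CARD('n) + 2)"
          using s t by (intro divide_right_mono cB) auto
        finally show "\<bar>?H s x $ j - ?S s\<bar> \<le> B / norm x ^ (CARD('n) + 2) / sqrt (t - s)" by (simp add: mult.commute)
      qed (use t in auto)
      also have "\<dots> = (B * (2 * sqrt t)) * (1 / norm x ^ (CARD('n) + 2))" by simp
      also have "\<dots> \<le> R * (2 ^ (CARD('n) + 2) * ?X)"
      proof (intro mult_mono Rt)
        have p: "0 < 1 + norm x" using x by linarith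
        \<comment> \<open>For \<open>norm x \<ge> 1\<close> one has
          \<open>1 + norm x \<le> 2 * norm x\<close>, whence the power of 2 in \<open>C\<close>;
          \<epsilon> < 1 then lowers the exponent d + 2 to d + 1 + \<epsilon>.\<close>
        have "1 / norm x ^ (CARD('n) + 2) \<le> 1 / ((1 + norm x) / 2) ^ (CARD('n) + 2)"
          using x p by (intro divide_left_mono power_mono mult_pos_pos zero_less_power) auto
        also have "\<dots> = 2 ^ (CARD('n) + 2) * (1 / (1 + norm x) ^ (CARD('n) + 2))"
          by (simp only: power_divide divide_divide_eq_right times_divide_eq_right mult_1_left mult_1_right)
        also have "1 / (1 + norm x) ^ (CARD('n) + 2) = (1 + norm x) powr (- real (CARD('n) + 2))"
          by (simp only: powr_minus powr_realpow[OF p] inverse_eq_divide)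
        also have "2 ^ (CARD('n) + 2) * (1 + norm x) powr (- real (CARD('n) + 2)) \<le> 2 ^ (CARD('n) + 2) * ?X"
          using \<epsilon> by (intro mult_left_mono powr_mono) auto
        finally show "1 / norm x ^ (CARD('n) + 2) \<le> 2 ^ (CARD('n) + 2) * ?X" .
      qed (use R in auto)
      also have "(LINT s:{0<..<t}|lborel. ?H s x $ j - ?S s)
          = (LINT s:{0<..<t}|lborel. ?H s x $ j) - (\<Sum>h\<in>UNIV. \<Sum>k\<in>UNIV. profile j h k x * K $ h $ k)"
        by (subst set_integral_diff(2)[OF intH intS]) (simp only: IS)
      finally have "\<bar>(LINT s:{0<..<t}|lborel. ?H s x $ j) - (\<Sum>h\<in>UNIV. \<Sum>k\<in>UNIV. profile j h k x * K $ h $ k)\<bar>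
          \<le> R * (2 ^ (CARD('n) + 2) * ?X)" .
      then show ?thesis using C1(2)[of t x j] t unfolding ut C_def distrib_right mult.assoc by linarith
    qed
    show "\<exists>K::real^'n^'n. (\<forall>h k. K $ h $ k = K $ k $ h) \<and>
      (\<forall>x j. \<bar>u t x $ j\<bar> \<le> C \<and> (1 \<le> norm x \<longrightarrow>
       \<bar>u t x $ j + (\<Sum>h\<in>UNIV. \<Sum>k\<in>UNIV. profile j h k x * K $ h $ k)\<bar> \<le> C * (1 + norm x) powr (- ?\<theta>)))"
      using sym b1 b2 by blast
  qed (rule C)
qed

text \<open>Along the ray through \<sigma>, the profile term times |x|^(d + 1) is the constant
  \<open>cubic \<beta> \<gamma> K j \<sigma>\<close>, by homogeneity. Both the scaled solution and
  the scaled remainder, of order \<open>r powr (- \<epsilon>)\<close>, tend to zero, so this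
  constant is zero.\<close>

lemma decay_condition_imp_cubic_eq_0:
  fixes v :: "real^'n \<Rightarrow> real^'n" and K :: "real^'n^'n"
  assumes decay: "decay_condition v" and sym: "\<And>h k. K $ h $ k = K $ k $ h" and pos: "0 < \<beta>" "0 < \<gamma>" "0 < \<epsilon>"
    and asym: "\<And>x j. 1 \<le> norm x \<Longrightarrow>
      \<bar>v x $ j + cubic \<beta> \<gamma> K j x / norm x ^ (CARD('n) + 4)\<bar> \<le> C * (1 + norm x) powr (- (real CARD('n) + 1 + \<epsilon>))"
  shows "cubic \<beta> \<gamma> K i z = 0"
proof -
  let ?d = "CARD('n)"
  obtain j S where S: "S \<subseteq> sphere 0 1" "sphere_measure S > 0" and dec: "decays_along v j S"
    using decay unfolding decay_condition_def by blast
  have "cubic \<beta> \<gamma> K j \<sigma> = 0" if \<sigma>: "\<sigma> \<in> S" for \<sigma>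
  proof -
    have n: "norm \<sigma> = 1" using \<sigma> S(1) by auto
    have C0: "0 \<le> C"
    proof -
      have "0 \<le> C * (1 + norm \<sigma>) powr (- (real ?d + 1 + \<epsilon>))"
        by (rule order_trans[OF abs_ge_zero asym]) (simp add: n)
      moreover have "0 < (1 + norm \<sigma>) powr (- (real ?d + 1 + \<epsilon>))" by (simp add: n)
      ultimately show ?thesis by (simp only: zero_le_mult_iff) linarith
    qed
    have "filterlim (\<lambda>r. r *\<^sub>R \<sigma>) at_infinity at_top"
      by (rule filterlim_norm_at_top_imp_at_infinity) (simp add: n filterlim_abs_real)
    \<comment> \<open>Restricts the limit along the line to its positive half, parametrized by
      \<open>r\<close>.\<close>
    then have ray: "filterlim (\<lambda>r. r *\<^sub>R \<sigma>) (inf at_infinity (principal (range (\<lambda>r. r *\<^sub>R \<sigma>)))) at_top"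
      by (auto simp: filterlim_inf filterlim_principal intro!: always_eventually)
    have "((\<lambda>x. norm x ^ (?d + 1) * v x $ j) \<longlongrightarrow> 0) (inf at_infinity (principal (range (\<lambda>r. r *\<^sub>R \<sigma>))))"
      using dec \<sigma> unfolding decays_along_def by blast
    then have lim1: "((\<lambda>r. norm (r *\<^sub>R \<sigma>) ^ (?d + 1) * v (r *\<^sub>R \<sigma>) $ j) \<longlongrightarrow> 0) at_top"
      by (rule filterlim_compose[OF _ ray])
    have lim2: "((\<lambda>r. C * r powr (- \<epsilon>)) \<longlongrightarrow> 0) at_top"
      using pos(3) by (intro tendsto_mult_right_zero tendsto_neg_powr filterlim_ident) auto
    have "((\<lambda>r. \<bar>norm (r *\<^sub>R \<sigma>) ^ (?d + 1) * v (r *\<^sub>R \<sigma>) $ j\<bar> + C * r powr (- \<epsilon>)) \<longlongrightarrow> \<bar>0\<bar> + 0) at_top"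
      by (intro tendsto_add tendsto_rabs lim1 lim2)
    moreover have "eventually (\<lambda>r. \<bar>cubic \<beta> \<gamma> K j \<sigma>\<bar> \<le> \<bar>norm (r *\<^sub>R \<sigma>) ^ (?d + 1) * v (r *\<^sub>R \<sigma>) $ j\<bar> + C * r powr (- \<epsilon>)) at_top"
      using eventually_ge_at_top[of 1]
    proof eventually_elim
      case (elim r)
      have r: "0 < r" "norm (r *\<^sub>R \<sigma>) = r" using elim n by auto
      define X where "X = r ^ (?d + 1) * (v (r *\<^sub>R \<sigma>) $ j + cubic \<beta> \<gamma> K j (r *\<^sub>R \<sigma>) / r ^ (?d + 4))"
      define Y where "Y = r ^ (?d + 1) * v (r *\<^sub>R \<sigma>) $ j"
      have "?d + 4 = (?d + 1) + 3" by simp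
      then have split: "r ^ (?d + 4) = r ^ (?d + 1) * r ^ 3" by (simp only: power_add)
      have "p * (q * Q / (p * q)) = Q" if "p \<noteq> 0" "q \<noteq> 0" for p q Q :: real using that by simp
      from this[of "r ^ (?d + 1)" "r ^ 3" "cubic \<beta> \<gamma> K j \<sigma>"] r(1)
      have "r ^ (?d + 1) * (cubic \<beta> \<gamma> K j (r *\<^sub>R \<sigma>) / r ^ (?d + 4)) = cubic \<beta> \<gamma> K j \<sigma>"
        unfolding split cubic_scaleR by (metis power_not_zero less_irrefl)
      moreover have "X = Y + r ^ (?d + 1) * (cubic \<beta> \<gamma> K j (r *\<^sub>R \<sigma>) / r ^ (?d + 4))"
        unfolding X_def Y_def by (rule distrib_left)
      ultimately have "cubic \<beta> \<gamma> K j \<sigma> = X - Y" by linarith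
      then have "\<bar>cubic \<beta> \<gamma> K j \<sigma>\<bar> \<le> \<bar>X\<bar> + \<bar>Y\<bar>" using abs_triangle_ineq4[of X Y] by simp
      moreover have "\<bar>X\<bar> \<le> C * r powr (- \<epsilon>)"
      proof -
        have "\<bar>X\<bar> = r ^ (?d + 1) * \<bar>v (r *\<^sub>R \<sigma>) $ j + cubic \<beta> \<gamma> K j (r *\<^sub>R \<sigma>) / r ^ (?d + 4)\<bar>"
          unfolding X_def abs_mult using r(1) by (simp only: abs_of_pos zero_less_power)
        also have "\<dots> \<le> r ^ (?d + 1) * (C * (1 + r) powr (- (real ?d + 1 + \<epsilon>)))"
          using asym[of "r *\<^sub>R \<sigma>" j] elim r(1) unfolding r(2) by (intro mult_left_mono zero_le_power) linarith+
        also have "\<dots> \<le> r ^ (?d + 1) * (C * r powr (- (real ?d + 1 + \<epsilon>)))"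
          using r(1) C0 pos(3) by (intro mult_left_mono powr_mono2') auto
        also have "\<dots> = C * (r powr (real (?d + 1)) * r powr (- (real ?d + 1 + \<epsilon>)))"
          unfolding powr_realpow[OF r(1)] by (rule mult.left_commute)
        also have "r powr (real (?d + 1)) * r powr (- (real ?d + 1 + \<epsilon>)) = r powr (real (?d + 1) + - (real ?d + 1 + \<epsilon>))"
          by (rule powr_add[symmetric])
        also have "real (?d + 1) + - (real ?d + 1 + \<epsilon>) = - \<epsilon>" by simp
        finally show ?thesis .
      qed
      ultimately show ?case unfolding r(2) Y_def by linarith
    qed
    ultimately have "\<bar>cubic \<beta> \<gamma> K j \<sigma>\<bar> \<le> \<bar>0\<bar> + 0"
      by (rule tendsto_lowerbound) simp
    then show ?thesis by simp
  qed
  then have "cubic \<beta> \<gamma> K j w = 0" for w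
    by (rule cubic_eq_0_of_positive_measure[OF S])
  then show ?thesis by (rule cubic_eq_0_all_components[OF sym pos(1,2)])
qed

theorem proposition3p9:
  fixes a :: "real^'n \<Rightarrow> real^'n"
    and u :: "real \<Rightarrow> real^'n \<Rightarrow> real^'n"
    and T :: ereal
    and \<epsilon> :: real
  assumes "CARD('n) \<ge> 2"
    and "0 < \<epsilon>" and "\<epsilon> < 1"
    and "0 < T"
    and "a \<in> weighted_Linfty (real CARD('n) + 1 + \<epsilon>)"
    and "divergence_free a"
    and "u \<in> Cw T (real CARD('n) + 1)"
    and "mild_solution T a u"
  shows "(\<forall>t. 0 < t \<and> ereal t < T \<and> decay_condition (u t) \<longrightarrow>
            (\<exists>C>0. \<forall>x k. \<bar>u t x $ k\<bar> \<le> C * (1 + norm x) powr (- (real CARD('n) + 1 + \<epsilon>))))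
       \<and> (\<forall>T0 T1. 0 < T0 \<and> T0 \<le> T1 \<and> ereal T1 < T \<and> (\<forall>t\<in>{T0..T1}. decay_condition (u t)) \<longrightarrow>
            (\<exists>C>0. \<forall>t\<in>{T0..T1}. \<forall>x k.
               \<bar>u t x $ k\<bar> \<le> C * (1 + norm x) powr (- (real CARD('n) + 1 + \<epsilon>))))"
proof -
  let ?\<theta> = "real CARD('n) + 1 + \<epsilon>"
  let ?\<beta> = "profile_const CARD('n) 2 / 4" and ?\<gamma> = "profile_const CARD('n) 3 / 8"
  have pos: "0 < ?\<beta>" "0 < ?\<gamma>" by (simp_all add: profile_const_pos)
  \<comment> \<open>The decay condition only makes the cubic vanish at the given time and does not
    enter the constant, so one bound serves both claims: with \<open>T1 = t\<close> for the first,
    with the right endpoint for the second.\<close>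
  have uniform: "\<exists>C>0. \<forall>t x k. 0 < t \<and> t \<le> T1 \<and> decay_condition (u t) \<longrightarrow> \<bar>u t x $ k\<bar> \<le> C * (1 + norm x) powr (- ?\<theta>)"
    if T1: "0 < T1" "ereal T1 < T" for T1
  proof -
    obtain C where C: "C > 0" and asym: "\<And>t. 0 < t \<Longrightarrow> t \<le> T1 \<Longrightarrow> \<exists>K::real^'n^'n. (\<forall>h k. K $ h $ k = K $ k $ h) \<and>
      (\<forall>x j. \<bar>u t x $ j\<bar> \<le> C \<and> (1 \<le> norm x \<longrightarrow>
       \<bar>u t x $ j + (\<Sum>h\<in>UNIV. \<Sum>k\<in>UNIV. profile j h k x * K $ h $ k)\<bar> \<le> C * (1 + norm x) powr (- ?\<theta>)))"
      using solution_asymptotics[OF assms(2,3,5,7,8) T1] by blast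
    \<comment> \<open>The extra factor covers \<open>norm x < 1\<close>, where only boundedness by
      \<open>C\<close> is available and the target weight is at least
      \<open>2 powr (- \<theta>)\<close>, with \<theta> = d + 1 + \<epsilon>.\<close>
    define D where "D = C * 2 powr ?\<theta>"
    have "1 \<le> 2 powr ?\<theta>" using assms(2) by (intro ge_one_powr_ge_zero) auto
    then have D: "D > 0" "C \<le> D" using C by (auto simp: D_def mult_le_cancel_left1)
    show ?thesis
    proof (intro exI[of _ D] conjI allI impI)
      fix t k and x :: "real^'n" assume t: "0 < t \<and> t \<le> T1 \<and> decay_condition (u t)"
      let ?X = "(1 + norm x) powr (- ?\<theta>)"
      obtain K :: "real^'n^'n" where sym: "\<And>h k. K $ h $ k = K $ k $ h" and b1: "\<And>x j. \<bar>u t x $ j\<bar> \<le> C"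
        and b2: "\<And>x j. 1 \<le> norm x \<Longrightarrow> \<bar>u t x $ j + (\<Sum>h\<in>UNIV. \<Sum>k\<in>UNIV. profile j h k x * K $ h $ k)\<bar> \<le> C * (1 + norm x) powr (- ?\<theta>)"
        using asym[of t] t by blast
      have b3: "\<bar>u t x $ j + cubic ?\<beta> ?\<gamma> K j x / norm x ^ (CARD('n) + 4)\<bar> \<le> C * (1 + norm x) powr (- ?\<theta>)" if "1 \<le> norm x" for x j
      proof -
        have nz: "x \<noteq> 0" using that by auto
        show ?thesis using b2[OF that, of j] unfolding sum_profile_eq_cubic[OF nz] .
      qed
      show "\<bar>u t x $ k\<bar> \<le> D * ?X"
      proof (cases "1 \<le> norm x")
        case True
        have "cubic ?\<beta> ?\<gamma> K k x = 0"
          using t by (intro decay_condition_imp_cubic_eq_0[OF _ sym pos assms(2) b3]) auto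
        then have "\<bar>u t x $ k\<bar> \<le> C * ?X" using b3[OF True, of k] by simp
        also have "\<dots> \<le> D * ?X" using D by (intro mult_right_mono) auto
        finally show ?thesis .
      next
        case False
        have "2 powr (- ?\<theta>) \<le> ?X" using False assms(2) by (intro powr_mono2') (auto intro: add_pos_nonneg)
        then have "C * 2 powr ?\<theta> * 2 powr (- ?\<theta>) \<le> D * ?X" unfolding D_def using C by (intro mult_left_mono) auto
        then show ?thesis using b1[of x k] by (simp add: mult.assoc flip: powr_add)
      qed
    qed (rule D)
  qed
  show ?thesis
  proof (intro conjI allI impI)
    fix t assume "0 < t \<and> ereal t < T \<and> decay_condition (u t)"
    then show "\<exists>C>0. \<forall>x k. \<bar>u t x $ k\<bar> \<le> C * (1 + norm x) powr (- ?\<theta>)"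
      using uniform[of t] by blast
  next
    fix T0 T1 assume *: "0 < T0 \<and> T0 \<le> T1 \<and> ereal T1 < T \<and> (\<forall>t\<in>{T0..T1}. decay_condition (u t))"
    then have "0 < T1" by linarith
    then obtain C where C: "C > 0" "\<forall>t x k. 0 < t \<and> t \<le> T1 \<and> decay_condition (u t) \<longrightarrow> \<bar>u t x $ k\<bar> \<le> C * (1 + norm x) powr (- ?\<theta>)"
      using uniform[of T1] * by blast
    show "\<exists>C>0. \<forall>t\<in>{T0..T1}. \<forall>x k. \<bar>u t x $ k\<bar> \<le> C * (1 + norm x) powr (- ?\<theta>)"
    proof (intro exI[of _ C] conjI ballI allI)
      fix t x k assume "t \<in> {T0..T1}"
      then have "0 < t \<and> t \<le> T1 \<and> decay_condition (u t)" using * by simp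
      then show "\<bar>u t x $ k\<bar> \<le> C * (1 + norm x) powr (- ?\<theta>)" using C(2) by blast
    qed (rule C(1))
  qed
qed

end
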